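(* Let $m_1\ge m_2$ be multiples of three. There is an algorithm running in time polynomial in $m_1m_2$ which, for MRPP instances on the $m_1\times m_2$ grid with $n\le\frac{m_1m_2}{3}$ robots, outputs a feasible solution such that, for random instances, the makespan is at most $m_1+2m_2+o(m_1)$ with high probability (i.e., there is $f(m_1)=o(m_1)$ with the probability that the makespan is at most $m_1+2m_2+f(m_1)$ tending to $1$ as $m_1\to\infty$). *)

theory Defs
  imports "HOL-Analysis.Analysis" "HOL-Library.Landau_Symbols"
begin

text \<open>Registers are indexed by naturals and hold naturals. Instructions:
  load a constant, addition, truncated subtraction, indirect load/store,
  conditional jump on zero, halt. Running off the end of the program also halts.
  (Unit-cost RAMs with addition/subtraction are polynomially equivalent to
  Turing machines.)\<close>

datatype instr =
    LoadC nat nat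
  | AddI nat nat nat
  | SubI nat nat nat
  | LoadInd nat nat
  | StoreInd nat nat
  | Jz nat nat
  | Halt

type_synonym ram_conf = "nat \<times> (nat \<Rightarrow> nat)"

definition ram_halted :: "instr list \<Rightarrow> ram_conf \<Rightarrow> bool" where
  "ram_halted prog c = (fst c \<ge> length prog \<or> prog ! fst c = Halt)"

fun exec_instr :: "instr \<Rightarrow> ram_conf \<Rightarrow> ram_conf" where
  "exec_instr (LoadC r k) (pc, m) = (Suc pc, m(r := k))"
| "exec_instr (AddI r a b) (pc, m) = (Suc pc, m(r := m a + m b))"
| "exec_instr (SubI r a b) (pc, m) = (Suc pc, m(r := m a - m b))"
| "exec_instr (LoadInd r a) (pc, m) = (Suc pc, m(r := m (m a)))"
| "exec_instr (StoreInd a r) (pc, m) = (Suc pc, m(m a := m r))"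
| "exec_instr (Jz r l) (pc, m) = (if m r = 0 then l else Suc pc, m)"
| "exec_instr Halt (pc, m) = (pc, m)"

definition ram_step :: "instr list \<Rightarrow> ram_conf \<Rightarrow> ram_conf" where
  "ram_step prog c = (if ram_halted prog c then c else exec_instr (prog ! fst c) c)"

definition ram_run :: "instr list \<Rightarrow> nat \<Rightarrow> ram_conf \<Rightarrow> ram_conf" where
  "ram_run prog t c = (ram_step prog ^^ t) c"

definition ram_init :: "nat list \<Rightarrow> ram_conf" where
  "ram_init xs = (0, \<lambda>i. if i = 0 then length xs
                        else if i - 1 < length xs then xs ! (i - 1) else 0)"

definition ram_output :: "(nat \<Rightarrow> nat) \<Rightarrow> nat list" where
  "ram_output m = map (\<lambda>i. m (Suc i)) [0..<m 0]"

definition ram_computes_within :: "instr list \<Rightarrow> nat list \<Rightarrow> nat \<Rightarrow> nat list \<Rightarrow> bool" where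
  "ram_computes_within prog xs t ys =
     (ram_halted prog (ram_run prog t (ram_init xs)) \<and>
      ram_output (snd (ram_run prog t (ram_init xs))) = ys)"

definition grid_V :: "nat \<Rightarrow> nat \<Rightarrow> (nat \<times> nat) set" where
  "grid_V m1 m2 = {0..<m1} \<times> {0..<m2}"

definition grid_adj :: "nat \<times> nat \<Rightarrow> nat \<times> nat \<Rightarrow> bool" where
  "grid_adj u v = (\<bar>int (fst u) - int (fst v)\<bar> + \<bar>int (snd u) - int (snd v)\<bar> = 1)"

definition configs :: "nat \<Rightarrow> nat \<Rightarrow> nat \<Rightarrow> (nat \<Rightarrow> nat \<times> nat) set" where
  "configs m1 m2 n = {s \<in> {0..<n} \<rightarrow>\<^sub>E grid_V m1 m2. inj_on s {0..<n}}"

definition mrpp_feasible ::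
  "nat \<Rightarrow> nat \<Rightarrow> nat \<Rightarrow> (nat \<Rightarrow> nat \<times> nat) \<Rightarrow> (nat \<Rightarrow> nat \<times> nat) \<Rightarrow> nat \<Rightarrow> (nat \<Rightarrow> nat \<Rightarrow> nat \<times> nat) \<Rightarrow> bool"
  where
  "mrpp_feasible m1 m2 n s g T P =
     ((\<forall>i<n. P 0 i = s i \<and> P T i = g i) \<and>
      (\<forall>t\<le>T. \<forall>i<n. P t i \<in> grid_V m1 m2) \<and>
      (\<forall>t\<le>T. inj_on (P t) {0..<n}) \<and>
      (\<forall>t<T. \<forall>i<n. P (Suc t) i = P t i \<or> grid_adj (P t i) (P (Suc t) i)) \<and>
      (\<forall>t<T. \<forall>i<n. \<forall>j<n. i \<noteq> j \<longrightarrow> \<not> (P (Suc t) i = P t j \<and> P (Suc t) j = P t i)))"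

definition enc_conf :: "nat \<Rightarrow> (nat \<Rightarrow> nat \<times> nat) \<Rightarrow> nat list" where
  "enc_conf n s = concat (map (\<lambda>i. [fst (s i), snd (s i)]) [0..<n])"

definition enc_instance :: "nat \<Rightarrow> nat \<Rightarrow> nat \<Rightarrow> (nat \<Rightarrow> nat \<times> nat) \<Rightarrow> (nat \<Rightarrow> nat \<times> nat) \<Rightarrow> nat list" where
  "enc_instance m1 m2 n s g = [m1, m2, n] @ enc_conf n s @ enc_conf n g"

text \<open>Output format: [T] followed by the positions (row, column) of robots 0..n-1 at times 0..T.\<close>
definition dec_makespan :: "nat list \<Rightarrow> nat" where
  "dec_makespan out = out ! 0"

definition dec_paths :: "nat \<Rightarrow> nat list \<Rightarrow> nat \<Rightarrow> nat \<Rightarrow> nat \<times> nat" where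
  "dec_paths n out t i = (out ! (1 + 2 * (t * n + i)), out ! (2 + 2 * (t * n + i)))"

definition output_feasible ::
  "nat \<Rightarrow> nat \<Rightarrow> nat \<Rightarrow> (nat \<Rightarrow> nat \<times> nat) \<Rightarrow> (nat \<Rightarrow> nat \<times> nat) \<Rightarrow> nat list \<Rightarrow> bool" where
  "output_feasible m1 m2 n s g out =
     (out \<noteq> [] \<and> length out = 1 + 2 * (dec_makespan out + 1) * n \<and>
      mrpp_feasible m1 m2 n s g (dec_makespan out) (dec_paths n out))"

end

theory Submission
  imports Defs "HOL-Real_Asymp.Real_Asymp"
begin

text \<open>
A plan consists of a balancing phase for the start configuration, three routing phases, and the
time reversal of a balancing phase for the goal configuration. Balancing moves the robots inside
every column, in an order-preserving way, to slots chosen such that every strip of three rows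
receives at most \<open>m2\<close> robots, and then inside every strip along a snake-like path to the middle
row. For routing, the robots are the edges of a bipartite multigraph joining the strip of their
start to the strip of their goal. It has maximum degree at most \<open>m2\<close>, so by Koenig's theorem there
is a proper edge colouring with the columns as colours. Every robot goes to the column given by its
colour, changes rows, and goes to its final column; each time all robots of a strip move
simultaneously, using the outer two of its three lanes as one-way highways. This takes
\<open>m1 + 2 m2 + O(1)\<close> steps.

The number of robots in an interval of a column of a random configuration has a moment generating
function bounded by that of a binomial variable, so with high probability all these numbers deviate
from their means by at most \<open>m1 powr (3/4)\<close>. The balancing phases then take \<open>O(m1 powr (3/4))\<close> steps.

All positions are given by closed expressions built from bounded sums, apart from the colouring,
which is computed by iterating a map on vectors that inserts an edge or flips one edge of a Kempe
chain. Such expressions are evaluated by a machine in polynomial time, and so are iterations in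
which the stored numbers stay below a fixed limit.
\<close>

section \<open>Structured programs for the random access machine\<close>

text \<open>The density bound 1/3 is used twice. It lets all robots stand on the middle lanes of the
  strips, one per column, so that the outer lanes are free as highways; and it makes the slots at
  least as dense as the robots, which bounds the balancing displacements. A colour \<open>k\<close>
  has two readings: column \<open>k\<close> while robots move inside strips, and row residue
  \<open>k mod 3\<close> in the block \<open>k div 3\<close> of three columns while they change
  strips. \<open>turn\<close> passes from one to the other, and a proper colouring excludes
  collisions under both. Balancing must give no strip more than \<open>m2\<close> robots and yet
  displace nobody far. Dealing consecutive ranks of each column to the strips by residues achieves
  both: strip loads are exact, and each column's slots are nearly uniform. Waiting times are maxima
  of the actual displacements, so the plan is feasible for every instance, and randomness enters
  only the estimate of the makespan. If all counts deviate by at most \<open>d\<close>, each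
  balancing phase has two motions of at most \<open>9 * d + 4\<close> and \<open>9 * d + 8\<close>
  steps. On the machine, values must stay polynomial along with time, which loops could spoil; hence
  the truncation of stores.\<close>

lemma ram_run_add: "ram_run prog (a + b) c = ram_run prog b (ram_run prog a c)"
  unfolding ram_run_def by (subst add.commute) (simp add: funpow_add)

lemma ram_run_1: "ram_run prog (Suc 0) c = ram_step prog c"
  unfolding ram_run_def by simp

text \<open>A code fragment is a function of its load address, because jump targets are absolute.\<close>
type_synonym code = "nat \<Rightarrow> instr list"

text \<open>Quantifying over the surrounding program makes fragments relocatable: control enters at
  the load address and stands just behind the fragment after exactly \<open>t\<close> steps. With
  exact counts, run times add up under \<open>;;\<close>.\<close>

definition runs :: "code \<Rightarrow> (nat \<Rightarrow> nat) \<Rightarrow> nat \<Rightarrow> (nat \<Rightarrow> nat) \<Rightarrow> bool" where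
  "runs cd m t m' \<longleftrightarrow> (\<forall>pre post. ram_run (pre @ cd (length pre) @ post) t (length pre, m)
     = (length pre + length (cd (length pre)), m'))"

definition seqc :: "code \<Rightarrow> code \<Rightarrow> code" (infixr ";;" 60) where
  "(c1 ;; c2) p = c1 p @ c2 (p + length (c1 p))"

definition ins :: "instr \<Rightarrow> code" where
  "ins i = (\<lambda>p. [i])"

text \<open>A while loop on register \<open>r\<close>. The way back is a conditional jump on
  register \<open>z\<close>, which is cleared just before. The exit address skips the leading test,
  the body and the two closing instructions.\<close>

definition loopc :: "nat \<Rightarrow> nat \<Rightarrow> code \<Rightarrow> code" where
  "loopc z r body = (\<lambda>p. Jz r (p + length (body (Suc p)) + 3) # body (Suc p) @ [LoadC z 0, Jz z p])"

lemma runs_seq: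
  assumes "runs c1 m t1 m1" "runs c2 m1 t2 m2"
  shows "runs (c1 ;; c2) m (t1 + t2) m2"
  unfolding runs_def
proof (intro allI)
  fix pre post :: "instr list"
  let ?prog = "pre @ (c1 ;; c2) (length pre) @ post"
  let ?p1 = "pre @ c1 (length pre)"
  have 1: "ram_run ?prog t1 (length pre, m) = (length ?p1, m1)"
    using assms(1)[unfolded runs_def, rule_format, of pre "c2 (length ?p1) @ post"]
    by (simp add: seqc_def)
  have 2: "ram_run ?prog t2 (length ?p1, m1) = (length ?p1 + length (c2 (length ?p1)), m2)"
    using assms(2)[unfolded runs_def, rule_format, of ?p1 post]
    by (simp add: seqc_def)
  show "ram_run ?prog (t1 + t2) (length pre, m)
      = (length pre + length ((c1 ;; c2) (length pre)), m2)"
    unfolding ram_run_add 1 2 by (simp add: seqc_def add.assoc)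
qed

lemma runs_ins:
  assumes "i \<noteq> Halt" "\<And>p. exec_instr i (p, m) = (Suc p, m')"
  shows "runs (ins i) m 1 m'"
  unfolding runs_def ins_def using assms
  by (simp add: ram_run_1 ram_step_def ram_halted_def)

lemma runs_LoadC: "runs (ins (LoadC r k)) m 1 (m(r := k))"
  and runs_AddI: "runs (ins (AddI r a b)) m 1 (m(r := m a + m b))"
  and runs_SubI: "runs (ins (SubI r a b)) m 1 (m(r := m a - m b))"
  and runs_LoadInd: "runs (ins (LoadInd r a)) m 1 (m(r := m (m a)))"
  and runs_StoreInd: "runs (ins (StoreInd a r)) m 1 (m(m a := m r))"
  by (rule runs_ins; simp)+

lemma runs_loop_exit:
  assumes "m r = 0"
  shows "runs (loopc z r body) m 1 m"
  unfolding runs_def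
proof (intro allI)
  fix pre post :: "instr list"
  show "ram_run (pre @ loopc z r body (length pre) @ post) 1 (length pre, m) =
       (length pre + length (loopc z r body (length pre)), m)"
    using assms by (simp add: ram_run_1 ram_step_def ram_halted_def loopc_def nth_append)
qed

lemma runs_loop_step:
  assumes "m r \<noteq> 0" "runs body m t m1" "runs (loopc z r body) (m1(z := 0)) t' m2"
  shows "runs (loopc z r body) m (t + 3 + t') m2"
  unfolding runs_def
proof (intro allI)
  fix pre post :: "instr list"
  let ?p = "length pre"
  let ?L = "loopc z r body ?p"
  let ?prog = "pre @ ?L @ post"
  let ?b = "body (Suc ?p)"
  let ?j = "Jz r (?p + length ?b + 3)"
  have prog: "?prog = (pre @ [?j]) @ ?b @ ([LoadC z 0, Jz z ?p] @ post)"
    by (simp add: loopc_def)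
  have 1: "ram_run ?prog 1 (?p, m) = (Suc ?p, m)"
    using assms(1) by (simp add: ram_run_1 ram_step_def ram_halted_def loopc_def nth_append)
  have 2: "ram_run ?prog t (Suc ?p, m) = (Suc ?p + length ?b, m1)"
    unfolding prog
    using assms(2)[unfolded runs_def, rule_format, of "pre @ [?j]" "[LoadC z 0, Jz z ?p] @ post"]
    by simp
  have n1: "?prog ! (Suc ?p + length ?b) = LoadC z 0"
    and n2: "?prog ! (Suc (Suc ?p + length ?b)) = Jz z ?p"
    and l: "length ?prog > Suc (Suc ?p + length ?b)"
    unfolding prog by (simp_all add: nth_append)
  have 3: "ram_run ?prog 1 (Suc ?p + length ?b, m1) = (Suc (Suc ?p + length ?b), m1(z := 0))"
    using n1 l by (simp add: ram_run_1 ram_step_def ram_halted_def del: length_append)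
  have 4: "ram_run ?prog 1 (Suc (Suc ?p + length ?b), m1(z := 0)) = (?p, m1(z := 0))"
    using n2 l by (simp add: ram_run_1 ram_step_def ram_halted_def del: length_append)
  have 5: "ram_run ?prog t' (?p, m1(z := 0)) = (?p + length ?L, m2)"
    using assms(3) unfolding runs_def by blast
  have "t + 3 + t' = 1 + (t + (1 + (1 + t')))" by simp
  then show "ram_run ?prog (t + 3 + t') (?p, m) = (?p + length ?L, m2)"
    by (simp only: ram_run_add 1 2 3 4 5)
qed

text \<open>The invariant counts completed passes and is demanded after clearing \<open>z\<close>,
  because the jump back overwrites that register. The 3 steps per pass are the test and the two
  closing instructions; the induction is over the passes still to come.\<close>

lemma runs_loop:
  assumes step: "\<And>i m. i < N \<Longrightarrow> Inv i m \<Longrightarrow>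
      m r \<noteq> 0 \<and> (\<exists>t m'. t \<le> \<tau> \<and> runs body m t m' \<and> Inv (Suc i) (m'(z := 0)))"
    and stop: "\<And>m. Inv N m \<Longrightarrow> m r = 0"
    and init: "Inv 0 m"
  shows "\<exists>t m'. t \<le> N * (\<tau> + 3) + 1 \<and> runs (loopc z r body) m t m' \<and> Inv N m'"
proof -
  have "\<exists>t m'. t \<le> j * (\<tau> + 3) + 1 \<and> runs (loopc z r body) m t m' \<and> Inv N m'"
    if "Inv (N - j) m" "j \<le> N" for j m
    using that
  proof (induction j arbitrary: m)
    case 0
    then show ?case using runs_loop_exit[of m r z body] stop[of m] by auto
  next
    case (Suc j)
    have *: "Suc (N - Suc j) = N - j" using Suc.prems by simp
    obtain t m' where t: "m r \<noteq> 0" "t \<le> \<tau>" "runs body m t m'" "Inv (N - j) (m'(z := 0))"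
      using step[of "N - Suc j" m] Suc.prems * by auto
    obtain t' m'' where t': "t' \<le> j * (\<tau> + 3) + 1" "runs (loopc z r body) (m'(z := 0)) t' m''" "Inv N m''"
      using Suc.IH[OF t(4)] Suc.prems(2) Suc_leD by blast
    have "runs (loopc z r body) m (t + 3 + t') m''"
      by (rule runs_loop_step[OF t(1,3) t'(2)])
    then show ?case using t(2) t'(1,3) by (intro exI[of _ "t + 3 + t'"] exI[of _ m'']) auto
  qed
  from this[of N m] init show ?thesis by simp
qed

subsection \<open>Polynomial bounds\<close>

text \<open>With base \<open>B + 2\<close> every constant, and \<open>B\<close> itself, is below a
  power even for \<open>B = 0\<close>, and the factor 2 arising in sums is absorbed by one more
  power.\<close>

definition pb :: "(nat \<Rightarrow> nat) \<Rightarrow> bool" where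
  "pb T \<longleftrightarrow> mono T \<and> (\<exists>k. \<forall>B. T B \<le> (B + 2) ^ k)"

lemma pb_const [intro!]: "pb (\<lambda>B. c)"
proof -
  have "c \<le> (B + 2) ^ c" for B :: nat
  proof -
    have "c \<le> 2 ^ c" by (simp add: less_imp_le)
    also have "\<dots> \<le> (B + 2) ^ c" by (rule power_mono) auto
    finally show ?thesis .
  qed
  then show ?thesis unfolding pb_def mono_def by blast
qed

lemma pb_id [intro!]: "pb (\<lambda>B. B)"
  unfolding pb_def by (auto simp: mono_def intro!: exI[of _ 1])

lemma pb_add [intro!]:
  assumes "pb S" "pb T"
  shows "pb (\<lambda>B. S B + T B)"
proof -
  obtain i j where i: "\<And>B. S B \<le> (B + 2) ^ i" and j: "\<And>B. T B \<le> (B + 2) ^ j"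
    using assms by (auto simp: pb_def)
  have "S B + T B \<le> (B + 2) ^ (i + j + 1)" for B
  proof -
    have "S B \<le> (B + 2) ^ (i + j)"
      by (rule order_trans[OF i]) (simp add: power_increasing)
    moreover have "T B \<le> (B + 2) ^ (i + j)"
      by (rule order_trans[OF j]) (simp add: power_increasing)
    ultimately have "S B + T B \<le> 2 * (B + 2) ^ (i + j)" by simp
    also have "\<dots> \<le> (B + 2) * (B + 2) ^ (i + j)" by (rule mult_right_mono) auto
    finally show ?thesis by simp
  qed
  moreover have "mono (\<lambda>B. S B + T B)"
    using assms by (auto simp: pb_def mono_def add_mono)
  ultimately show ?thesis unfolding pb_def by blast
qed

lemma pb_mult [intro!]:
  assumes "pb S" "pb T"
  shows "pb (\<lambda>B. S B * T B)"
proof -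
  obtain i j where i: "\<And>B. S B \<le> (B + 2) ^ i" and j: "\<And>B. T B \<le> (B + 2) ^ j"
    using assms by (auto simp: pb_def)
  have "S B * T B \<le> (B + 2) ^ (i + j)" for B
    unfolding power_add by (rule mult_mono[OF i j]) auto
  moreover have "mono (\<lambda>B. S B * T B)"
    using assms by (auto simp: pb_def mono_def mult_mono)
  ultimately show ?thesis unfolding pb_def by blast
qed

lemma pb_comp:
  assumes "pb S" "pb T"
  shows "pb (\<lambda>B. S (T B))"
proof -
  obtain i j where i: "\<And>B. S B \<le> (B + 2) ^ i" and j: "\<And>B. T B + 2 \<le> (B + 2) ^ j"
    using assms pb_add[OF assms(2) pb_const[of 2]] by (auto simp: pb_def)
  have "S (T B) \<le> (B + 2) ^ (j * i)" for B
    unfolding power_mult by (rule order_trans[OF i]) (rule power_mono[OF j], simp)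
  moreover have "mono (\<lambda>B. S (T B))"
    using assms by (auto simp: pb_def mono_def)
  ultimately show ?thesis unfolding pb_def by blast
qed

subsection \<open>Computable expressions\<close>

text \<open>A memory \<open>m\<close> is read as an environment (the registers below \<open>d\<close>) together with a heap
  (the cells from register \<open>R\<close> on). Registers from \<open>d\<close> to \<open>R - 1\<close> are scratch space, and the
  value of an expression at depth \<open>d\<close> is delivered in register \<open>d\<close>.\<close>

definition evaluates :: "nat \<Rightarrow> nat \<Rightarrow> (nat \<Rightarrow> nat) \<Rightarrow> code \<Rightarrow>
    ((nat \<Rightarrow> nat) \<Rightarrow> (nat \<Rightarrow> nat) \<Rightarrow> nat) \<Rightarrow> bool" where
  "evaluates d R T cd f \<longleftrightarrow> (\<forall>m B. (\<forall>i<d. m i \<le> B) \<longrightarrow> (\<forall>a. m (R + a) \<le> B) \<longrightarrow>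
     f m (\<lambda>a. m (R + a)) \<le> T B \<and>
     (\<exists>t m'. t \<le> T B \<and> runs cd m t m' \<and> m' d = f m (\<lambda>a. m (R + a)) \<and>
        (\<forall>i<d. m' i = m i) \<and> (\<forall>a. m' (R + a) = m (R + a))))"

definition CE0 :: "nat \<Rightarrow> ((nat \<Rightarrow> nat) \<Rightarrow> (nat \<Rightarrow> nat) \<Rightarrow> nat) \<Rightarrow> bool" where
  "CE0 d f \<longleftrightarrow> (\<exists>K T. pb T \<and> d < K \<and> (\<forall>R\<ge>K. \<exists>cd. evaluates d R T cd f))"

text \<open>Every larger depth is included because a subexpression is evaluated while further
  registers hold partial results. The first clause says that those additional registers do not
  influence the value.\<close>

definition CE :: "nat \<Rightarrow> ((nat \<Rightarrow> nat) \<Rightarrow> (nat \<Rightarrow> nat) \<Rightarrow> nat) \<Rightarrow> bool" where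
  "CE d f \<longleftrightarrow> (\<forall>e e' h. (\<forall>i<d. e i = e' i) \<longrightarrow> f e h = f e' h) \<and> (\<forall>d'\<ge>d. CE0 d' f)"

text \<open>Bound variables in the style of higher-order abstract syntax: \<open>S\<close> counts as
  computable if substituting any computable argument, at any larger depth, gives a computable
  expression. A loop substitutes the register of its counter.\<close>

definition CF :: "nat \<Rightarrow> ((nat \<Rightarrow> nat) \<Rightarrow> (nat \<Rightarrow> nat) \<Rightarrow> nat \<Rightarrow> nat) \<Rightarrow> bool" where
  "CF d S \<longleftrightarrow> (\<forall>d'\<ge>d. \<forall>a. CE d' a \<longrightarrow> CE d' (\<lambda>e h. S e h (a e h)))"

lemma CE_dep: "CE d f \<Longrightarrow> (\<And>i. i < d \<Longrightarrow> e i = e' i) \<Longrightarrow> f e h = f e' h"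
  unfolding CE_def by blast

lemma CE_lift: "CE d f \<Longrightarrow> d \<le> d' \<Longrightarrow> CE d' f"
  unfolding CE_def by (meson order.strict_trans2 order_trans)

lemma CFI: "(\<And>d' a. d \<le> d' \<Longrightarrow> CE d' a \<Longrightarrow> CE d' (\<lambda>e h. S e h (a e h))) \<Longrightarrow> CF d S"
  unfolding CF_def by blast

lemma CFD: "CF d S \<Longrightarrow> d \<le> d' \<Longrightarrow> CE d' a \<Longrightarrow> CE d' (\<lambda>e h. S e h (a e h))"
  unfolding CF_def by blast

lemma CE0I:
  assumes "pb T" "d < K" "\<And>R. K \<le> R \<Longrightarrow> \<exists>cd. evaluates d R T cd f"
  shows "CE0 d f"
  unfolding CE0_def using assms by blast

lemma CE_E:
  assumes "CE d f" "d \<le> D"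
  obtains K T where "pb T" "D < K" "\<And>R. K \<le> R \<Longrightarrow> \<exists>cd. evaluates D R T cd f"
  using assms unfolding CE_def CE0_def by blast

lemma evaluatesI:
  assumes "\<And>m B. (\<forall>i<d. m i \<le> B) \<Longrightarrow> (\<forall>a. m (R + a) \<le> B) \<Longrightarrow> f m (\<lambda>a. m (R + a)) \<le> T B \<and>
     (\<exists>t m'. t \<le> T B \<and> runs cd m t m' \<and> m' d = f m (\<lambda>a. m (R + a)) \<and>
        (\<forall>i<d. m' i = m i) \<and> (\<forall>a. m' (R + a) = m (R + a)))"
  shows "evaluates d R T cd f"
  unfolding evaluates_def using assms by blast

lemma evaluatesE:
  assumes "evaluates d R T cd f" "\<forall>i<d. m i \<le> B" "\<forall>a. m (R + a) \<le> B"
  obtains t m' where "f m (\<lambda>a. m (R + a)) \<le> T B" "t \<le> T B" "runs cd m t m'"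
    "m' d = f m (\<lambda>a. m (R + a))" "\<forall>i<d. m' i = m i" "\<forall>a. m' (R + a) = m (R + a)"
  using assms unfolding evaluates_def by blast

lemma CE_const: "CE d (\<lambda>e h. c)"
  unfolding CE_def
proof (intro conjI allI impI)
  fix d' assume "d \<le> d'"
  show "CE0 d' (\<lambda>e h. c)"
  proof (rule CE0I[of "\<lambda>B. c + 1" d' "Suc d'"])
    fix R assume R: "Suc d' \<le> R"
    show "\<exists>cd. evaluates d' R (\<lambda>B. c + 1) cd (\<lambda>e h. c)"
    proof (intro exI[of _ "ins (LoadC d' c)"] evaluatesI conjI)
      fix m :: "nat \<Rightarrow> nat"
      show "\<exists>t m'. t \<le> c + 1 \<and> runs (ins (LoadC d' c)) m t m' \<and> m' d' = c \<and>
          (\<forall>i<d'. m' i = m i) \<and> (\<forall>a. m' (R + a) = m (R + a))"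
        using R by (intro exI[of _ 1] exI[of _ "m(d' := c)"]) (auto intro: runs_LoadC[simplified])
    qed simp
  qed auto
qed simp

lemma CE_var:
  assumes "i < d"
  shows "CE d (\<lambda>e h. e i)"
  unfolding CE_def
proof (intro conjI allI impI)
  fix d' assume d': "d \<le> d'"
  show "CE0 d' (\<lambda>e h. e i)"
  proof (rule CE0I[of "\<lambda>B. B + 2" d' "Suc d'"])
    show "pb (\<lambda>B. B + 2)" by (intro pb_add pb_id pb_const)
    fix R assume R: "Suc d' \<le> R"
    let ?cd = "ins (LoadC d' 0) ;; ins (AddI d' i d')"
    show "\<exists>cd. evaluates d' R (\<lambda>B. B + 2) cd (\<lambda>e h. e i)"
    proof (intro exI[of _ ?cd] evaluatesI conjI)
      fix m :: "nat \<Rightarrow> nat" and B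
      assume "\<forall>i<d'. m i \<le> B"
      then have "m i \<le> B" using assms d' by simp
      then show "m i \<le> B + 2" by simp
      have "runs ?cd m (1 + 1) ((m(d' := 0))(d' := (m(d' := 0)) i + (m(d' := 0)) d'))"
        by (intro runs_seq[OF runs_LoadC] runs_AddI)
      then have "runs ?cd m 2 (m(d' := m i))"
        using assms d' by (simp add: numeral_2_eq_2)
      then show "\<exists>t m'. t \<le> B + 2 \<and> runs ?cd m t m' \<and> m' d' = m i \<and>
          (\<forall>i<d'. m' i = m i) \<and> (\<forall>a. m' (R + a) = m (R + a))"
        using R by (intro exI[of _ 2] exI[of _ "m(d' := m i)"]) auto
    qed
  qed auto
qed (use assms in simp)

text \<open>The left value is parked in register \<open>D\<close> and thereby joins the environment
  in which the right operand is evaluated; this is why the second bound is taken at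
  \<open>B + T1 B\<close>.\<close>

lemma CE_binop:
  assumes f: "CE d f" and g: "CE d g"
    and I: "\<And>D m. runs (ins (I D)) m 1 (m(D := op (m D) (m (Suc D))))"
    and op: "\<And>x y :: nat. op x y \<le> x + y"
  shows "CE d (\<lambda>e h. op (f e h) (g e h))"
  unfolding CE_def
proof (intro conjI allI impI)
  fix e e' :: "nat \<Rightarrow> nat" and h assume *: "\<forall>i<d. e i = e' i"
  show "op (f e h) (g e h) = op (f e' h) (g e' h)"
    using CE_dep[OF f, of e e' h] CE_dep[OF g, of e e' h] * by simp
next
  fix D assume D: "d \<le> D"
  obtain K1 T1 where 1: "pb T1" "D < K1"
    "\<And>R. K1 \<le> R \<Longrightarrow> \<exists>cd. evaluates D R T1 cd f"
    by (rule CE_E[OF f D]) blast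
  obtain K2 T2 where 2: "pb T2" "Suc D < K2"
    "\<And>R. K2 \<le> R \<Longrightarrow> \<exists>cd. evaluates (Suc D) R T2 cd g"
    by (rule CE_E[OF g le_SucI[OF D]]) blast
  let ?T = "\<lambda>B. T1 B + T2 (B + T1 B) + 1"
  show "CE0 D (\<lambda>e h. op (f e h) (g e h))"
  proof (rule CE0I[of ?T D "K1 + K2"])
    show "pb ?T" by (intro pb_add pb_id pb_const 1(1) pb_comp[OF 2(1)])
    show "D < K1 + K2" using 1(2) by simp
    fix R assume R: "K1 + K2 \<le> R"
    obtain c1 where c1: "evaluates D R T1 c1 f" using 1(3)[of R] R by auto
    obtain c2 where c2: "evaluates (Suc D) R T2 c2 g" using 2(3)[of R] R by auto
    let ?cd = "c1 ;; c2 ;; ins (I D)"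
    show "\<exists>cd. evaluates D R ?T cd (\<lambda>e h. op (f e h) (g e h))"
    proof (rule exI[of _ ?cd], rule evaluatesI)
      fix m :: "nat \<Rightarrow> nat" and B assume m: "\<forall>i<D. m i \<le> B" "\<forall>a. m (R + a) \<le> B"
      obtain t1 m1 where m1: "f m (\<lambda>a. m (R + a)) \<le> T1 B" "t1 \<le> T1 B" "runs c1 m t1 m1"
        "m1 D = f m (\<lambda>a. m (R + a))" "\<forall>i<D. m1 i = m i" "\<forall>a. m1 (R + a) = m (R + a)"
        by (rule evaluatesE[OF c1 m])
      have "\<forall>i<Suc D. m1 i \<le> B + T1 B" "\<forall>a. m1 (R + a) \<le> B + T1 B"
        using m1 m by (auto simp: less_Suc_eq trans_le_add1 trans_le_add2)
      then obtain t2 m2 where m2: "g m1 (\<lambda>a. m1 (R + a)) \<le> T2 (B + T1 B)"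
        "t2 \<le> T2 (B + T1 B)" "runs c2 m1 t2 m2" "m2 (Suc D) = g m1 (\<lambda>a. m1 (R + a))"
        "\<forall>i<Suc D. m2 i = m1 i" "\<forall>a. m2 (R + a) = m1 (R + a)"
        by (rule evaluatesE[OF c2])
      have gm: "g m1 (\<lambda>a. m1 (R + a)) = g m (\<lambda>a. m (R + a))"
        using CE_dep[OF g, of m1 m] m1(5,6) D by simp
      have r: "runs ?cd m (t1 + (t2 + 1)) (m2(D := op (m2 D) (m2 (Suc D))))"
        by (rule runs_seq[OF m1(3) runs_seq[OF m2(3) I]])
      show "op (f m (\<lambda>a. m (R + a))) (g m (\<lambda>a. m (R + a))) \<le> ?T B \<and>
       (\<exists>t m'. t \<le> ?T B \<and> runs ?cd m t m' \<and>
          m' D = op (f m (\<lambda>a. m (R + a))) (g m (\<lambda>a. m (R + a))) \<and>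
          (\<forall>i<D. m' i = m i) \<and> (\<forall>a. m' (R + a) = m (R + a)))"
      proof (intro conjI exI)
        show "op (f m (\<lambda>a. m (R + a))) (g m (\<lambda>a. m (R + a))) \<le> ?T B"
          using op[of "f m (\<lambda>a. m (R + a))" "g m (\<lambda>a. m (R + a))"] m1(1) m2(1) gm by simp
        show "t1 + (t2 + 1) \<le> ?T B" using m1(2) m2(2) by simp
        show "runs ?cd m (t1 + (t2 + 1)) (m2(D := op (m2 D) (m2 (Suc D))))" by (rule r)
      qed (use m1 m2 gm R 1(2) in auto)
    qed
  qed
qed

lemma CE_add: "CE d f \<Longrightarrow> CE d g \<Longrightarrow> CE d (\<lambda>e h. f e h + g e h)"
  by (rule CE_binop[where I = "\<lambda>D. AddI D D (Suc D)"]) (auto intro: runs_AddI[simplified])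

lemma CE_sub: "CE d f \<Longrightarrow> CE d g \<Longrightarrow> CE d (\<lambda>e h. f e h - g e h)"
  by (rule CE_binop[where I = "\<lambda>D. SubI D D (Suc D)"]) (auto intro: runs_SubI[simplified])

lemma CE_heap:
  assumes f: "CE d f"
  shows "CE d (\<lambda>e h. h (f e h))"
  unfolding CE_def
proof (intro conjI allI impI)
  fix e e' :: "nat \<Rightarrow> nat" and h :: "nat \<Rightarrow> nat" assume *: "\<forall>i<d. e i = e' i"
  show "h (f e h) = h (f e' h)"
    using CE_dep[OF f, of e e' h] * by simp
next
  fix D assume D: "d \<le> D"
  obtain K T where 1: "pb T" "D < K"
    "\<And>R. K \<le> R \<Longrightarrow> \<exists>cd. evaluates D R T cd f"
    by (rule CE_E[OF f D]) blast
  let ?T = "\<lambda>B. T B + B + 3"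
  show "CE0 D (\<lambda>e h. h (f e h))"
  proof (rule CE0I[of ?T D "Suc (Suc K)"])
    show "pb ?T" using 1(1) by auto
    show "D < Suc (Suc K)" using 1(2) by simp
    fix R assume R: "Suc (Suc K) \<le> R"
    obtain c1 where c1: "evaluates D R T c1 f" using 1(3)[of R] R by auto
    let ?cd = "c1 ;; ins (LoadC (Suc D) R) ;; ins (AddI D (Suc D) D) ;; ins (LoadInd D D)"
    show "\<exists>cd. evaluates D R ?T cd (\<lambda>e h. h (f e h))"
    proof (rule exI[of _ ?cd], rule evaluatesI)
      fix m :: "nat \<Rightarrow> nat" and B assume m: "\<forall>i<D. m i \<le> B" "\<forall>a. m (R + a) \<le> B"
      obtain t1 m1 where m1: "f m (\<lambda>a. m (R + a)) \<le> T B" "t1 \<le> T B" "runs c1 m t1 m1"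
        "m1 D = f m (\<lambda>a. m (R + a))" "\<forall>i<D. m1 i = m i" "\<forall>a. m1 (R + a) = m (R + a)"
        by (rule evaluatesE[OF c1 m])
      let ?m2 = "m1(Suc D := R)"
      let ?m3 = "?m2(D := ?m2 (Suc D) + ?m2 D)"
      let ?m4 = "?m3(D := ?m3 (?m3 D))"
      have r: "runs ?cd m (t1 + (1 + (1 + 1))) ?m4"
        by (intro runs_seq[OF m1(3)] runs_seq[OF runs_LoadC] runs_seq[OF runs_AddI] runs_LoadInd)
      show "m (R + f m (\<lambda>a. m (R + a))) \<le> ?T B \<and>
       (\<exists>t m'. t \<le> ?T B \<and> runs ?cd m t m' \<and> m' D = m (R + f m (\<lambda>a. m (R + a))) \<and>
          (\<forall>i<D. m' i = m i) \<and> (\<forall>a. m' (R + a) = m (R + a)))"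
      proof (intro conjI exI)
        show "m (R + f m (\<lambda>a. m (R + a))) \<le> ?T B" using m(2) by (simp add: trans_le_add1 trans_le_add2)
        show "t1 + (1 + (1 + 1)) \<le> ?T B" using m1(2) by simp
        show "runs ?cd m (t1 + (1 + (1 + 1))) ?m4" by (rule r)
      qed (use m1 R 1(2) in auto)
    qed
  qed
qed

lemma CF_dep:
  assumes "CF d S" "\<And>i. i < d \<Longrightarrow> e i = e' i"
  shows "S e h x = S e' h x"
  using CE_dep[OF CFD[OF assms(1) order_refl CE_const[of d x]] assms(2)] .

text \<open>Register \<open>D\<close> holds the counter, \<open>D + 1\<close> the partial sum,
  \<open>D + 2\<close> the number of remaining passes, and \<open>D + 3\<close> the current summand,
  later the constant 1.\<close>

lemma CE_sum:
  assumes b: "CE d b" and S: "CF d S"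
  shows "CE d (\<lambda>e h. \<Sum>x<b e h. S e h x)"
  unfolding CE_def
proof (intro conjI allI impI)
  fix e e' :: "nat \<Rightarrow> nat" and h assume *: "\<forall>i<d. e i = e' i"
  show "(\<Sum>x<b e h. S e h x) = (\<Sum>x<b e' h. S e' h x)"
    using CE_dep[OF b, of e e' h] CF_dep[OF S, of e e' h] * by simp
next
  fix D assume D: "d \<le> D"
  obtain K1 T1 where 1: "pb T1" "D < K1"
    "\<And>R. K1 \<le> R \<Longrightarrow> \<exists>cd. evaluates D R T1 cd b"
    by (rule CE_E[OF b D]) blast
  have S': "CE (Suc D) (\<lambda>e h. S e h (e D))"
    by (rule CFD[OF S _ CE_var]) (use D in auto)
  obtain K2 T2 where 2: "pb T2" "Suc D < K2"
    "\<And>R. K2 \<le> R \<Longrightarrow> \<exists>cd. evaluates (Suc D) R T2 cd (\<lambda>e h. S e h (e D))"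
    by (rule CE_E[OF S' order_refl]) blast
  obtain K3 T3 where 3: "pb T3" "D + 3 < K3"
    "\<And>R. K3 \<le> R \<Longrightarrow> \<exists>cd. evaluates (D + 3) R T3 cd (\<lambda>e h. S e h (e D))"
    by (rule CE_E[OF S', of "D + 3"]) (simp, blast)
  let ?B = "\<lambda>B. B + T1 B"
  let ?V = "\<lambda>B. T1 B * T2 (?B B)"
  let ?t = "\<lambda>B. T3 (?B B + ?V B) + 5"
  let ?T = "\<lambda>B. T1 B + T1 B * (?t B + 3) + ?V B + 9"
  show "CE0 D (\<lambda>e h. \<Sum>x<b e h. S e h x)"
  proof (rule CE0I[of ?T D "K1 + K2 + K3"])
    have pV: "pb ?V" by (intro pb_mult 1(1) pb_comp[OF 2(1)] pb_add pb_id)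
    show "pb ?T"
      by (intro pb_add pb_mult 1(1) pV pb_comp[OF 3(1)] pb_id pb_const)
    show "D < K1 + K2 + K3" using 1(2) by simp
    fix R assume R: "K1 + K2 + K3 \<le> R"
    obtain c1 where c1: "evaluates D R T1 c1 b" using 1(3)[of R] R by auto
    \<comment> \<open>\<open>c2\<close> is not executed. It only bounds the summands independently
      of the partial sum: the bound of the executed \<open>c3\<close> depends on the partial sum in
      its environment, and bounding the summands by it would be circular.\<close>
    obtain c2 where c2: "evaluates (Suc D) R T2 c2 (\<lambda>e h. S e h (e D))" using 2(3)[of R] R by auto
    obtain c3 where c3: "evaluates (D + 3) R T3 c3 (\<lambda>e h. S e h (e D))" using 3(3)[of R] R by auto
    let ?body = "c3 ;; ins (AddI (D + 1) (D + 1) (D + 3)) ;; ins (LoadC (D + 3) 1) ;;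
      ins (AddI D D (D + 3)) ;; ins (SubI (D + 2) (D + 2) (D + 3))"
    let ?init = "ins (LoadC (D + 1) 0) ;; ins (AddI (D + 2) D (D + 1)) ;; ins (LoadC D 0)"
    let ?cd = "c1 ;; ?init ;; loopc (D + 3) (D + 2) ?body ;; ins (LoadC D 0) ;; ins (AddI D D (D + 1))"
    show "\<exists>cd. evaluates D R ?T cd (\<lambda>e h. \<Sum>x<b e h. S e h x)"
    proof (rule exI[of _ ?cd], rule evaluatesI)
      fix m :: "nat \<Rightarrow> nat" and B assume m: "\<forall>i<D. m i \<le> B" "\<forall>a. m (R + a) \<le> B"
      define H where "H = (\<lambda>a. m (R + a))"
      obtain t1 m1 where m1: "b m H \<le> T1 B" "t1 \<le> T1 B" "runs c1 m t1 m1"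
        "m1 D = b m H" "\<forall>i<D. m1 i = m i" "\<forall>a. m1 (R + a) = m (R + a)"
        using evaluatesE[OF c1 m] unfolding H_def by blast
      define N where "N = b m H"
      have Seq: "S m' H x = S m H x" if "\<forall>i<D. m' i = m i" for m' x
        by (rule CF_dep[OF S]) (use that D in auto)
      have Sle: "S m H x \<le> T2 (?B B)" if "x < N" for x
      proof -
        let ?m = "m(D := x)"
        have "\<forall>i<Suc D. ?m i \<le> ?B B" "\<forall>a. ?m (R + a) \<le> ?B B"
          using m m1(1) that R 1(2) unfolding N_def by (auto simp: less_Suc_eq trans_le_add1)
        then have "S ?m (\<lambda>a. ?m (R + a)) (?m D) \<le> T2 (?B B)" by (rule evaluatesE[OF c2])
        then have "S ?m (\<lambda>a. ?m (R + a)) x \<le> T2 (?B B)" by simp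
        moreover have "(\<lambda>a. ?m (R + a)) = H" using R 1(2) by (auto simp: H_def)
        ultimately show ?thesis using Seq[of ?m x] by simp
      qed
      have sum_le: "(\<Sum>x<j. S m H x) \<le> ?V B" if "j \<le> N" for j
      proof -
        have "(\<Sum>x<j. S m H x) \<le> of_nat (card {..<j}) * T2 (?B B)"
          by (rule sum_bounded_above) (use that Sle in auto)
        also have "\<dots> \<le> ?V B" using that m1(1) N_def by simp
        finally show ?thesis .
      qed
      let ?m2 = "((m1(D + 1 := 0))(D + 2 := N))(D := 0)"
      have r2: "runs ?init m1 (1 + (1 + 1)) ?m2"
        using runs_seq[OF runs_LoadC[of "D + 1" 0 m1]
            runs_seq[OF runs_AddI[of "D + 2" D "D + 1"] runs_LoadC[of D 0]]]
          m1(4) N_def by simp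
      define Inv where "Inv = (\<lambda>j (M :: nat \<Rightarrow> nat). M D = j \<and> M (D + 1) = (\<Sum>x<j. S m H x) \<and>
         M (D + 2) = N - j \<and> (\<forall>i<D. M i = m i) \<and> (\<forall>a. M (R + a) = m (R + a)))"
      have "\<exists>t M'. t \<le> N * (?t B + 3) + 1 \<and> runs (loopc (D + 3) (D + 2) ?body) ?m2 t M' \<and> Inv N M'"
      proof (rule runs_loop)
        show "Inv 0 ?m2" using m1 R 3(2) by (auto simp: Inv_def)
        show "M (D + 2) = 0" if "Inv N M" for M using that by (simp add: Inv_def)
        fix j M assume j: "j < N" and M: "Inv j M"
        have MH: "(\<lambda>a. M (R + a)) = H" using M by (auto simp: Inv_def H_def)
        have "\<forall>i<D + 3. M i \<le> ?B B + ?V B"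
        proof (intro allI impI)
          fix i assume i: "i < D + 3"
          have N: "N \<le> T1 B" using m1(1) N_def by simp
          consider "i < D" | "i = D" | "i = D + 1" | "i = D + 2" using i by linarith
          then show "M i \<le> ?B B + ?V B"
          proof cases
            case 1 then show ?thesis using M m(1) by (auto simp: Inv_def trans_le_add1)
          next
            case 2 then show ?thesis using M j N by (auto simp: Inv_def)
          next
            case 3 then show ?thesis using M sum_le[of j] j by (auto simp: Inv_def)
          next
            case 4 then show ?thesis using M N by (auto simp: Inv_def)
          qed
        qed
        moreover have "\<forall>a. M (R + a) \<le> ?B B + ?V B"
          using M m(2) by (auto simp: Inv_def trans_le_add1)
        ultimately obtain t3 M3 where M3: "t3 \<le> T3 (?B B + ?V B)" "runs c3 M t3 M3"
          "M3 (D + 3) = S M (\<lambda>a. M (R + a)) (M D)" "\<forall>i<D + 3. M3 i = M i"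
          "\<forall>a. M3 (R + a) = M (R + a)"
          by (rule evaluatesE[OF c3])
        have sv: "M3 (D + 3) = S m H j"
          using M3(3) M Seq[of M j] unfolding MH by (simp add: Inv_def)
        have e3: "M3 D = j" "M3 (D + 1) = (\<Sum>x<j. S m H x)" "M3 (D + 2) = N - j"
          "\<forall>i<D. M3 i = m i" "\<forall>a. M3 (R + a) = m (R + a)"
          using M3(4,5) M by (auto simp: Inv_def)
        let ?M4 = "M3(D + 1 := (\<Sum>x<j. S m H x) + S m H j)"
        let ?M5 = "?M4(D + 3 := 1)"
        let ?M6 = "?M5(D := Suc j)"
        let ?M7 = "?M6(D + 2 := N - j - 1)"
        have "runs (ins (AddI (D + 1) (D + 1) (D + 3))) M3 1 ?M4"
          using runs_AddI[of "D + 1" "D + 1" "D + 3" M3] e3 sv by simp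
        moreover have "runs (ins (LoadC (D + 3) 1)) ?M4 1 ?M5" by (rule runs_LoadC)
        moreover have "runs (ins (AddI D D (D + 3))) ?M5 1 ?M6"
          using runs_AddI[of D D "D + 3" ?M5] e3 by simp
        moreover have "runs (ins (SubI (D + 2) (D + 2) (D + 3))) ?M6 1 ?M7"
          using runs_SubI[of "D + 2" "D + 2" "D + 3" ?M6] e3 by simp
        ultimately have r: "runs ?body M (t3 + (1 + (1 + (1 + 1)))) ?M7"
          by (intro runs_seq[OF M3(2)] runs_seq[of "ins (AddI (D + 1) (D + 1) (D + 3))"]
            runs_seq[of "ins (LoadC (D + 3) 1)"] runs_seq[of "ins (AddI D D (D + 3))"])
        show "M (D + 2) \<noteq> 0 \<and> (\<exists>t m'. t \<le> ?t B \<and> runs ?body M t m' \<and> Inv (Suc j) (m'(D + 3 := 0)))"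
        proof (intro conjI exI)
          show "M (D + 2) \<noteq> 0" using M j by (simp add: Inv_def)
          show "t3 + (1 + (1 + (1 + 1))) \<le> ?t B" using M3(1) by simp
          show "runs ?body M (t3 + (1 + (1 + (1 + 1)))) ?M7" by (rule r)
          show "Inv (Suc j) (?M7(D + 3 := 0))"
            using e3 R 3(2) by (auto simp: Inv_def)
        qed
      qed
      then obtain t4 M where M: "t4 \<le> N * (?t B + 3) + 1"
        "runs (loopc (D + 3) (D + 2) ?body) ?m2 t4 M" "Inv N M" by blast
      have r: "runs ?cd m (t1 + ((1 + (1 + 1)) + (t4 + (1 + 1))))
          ((M(D := 0))(D := (M(D := 0)) D + (M(D := 0)) (D + 1)))"
        by (intro runs_seq[OF m1(3)] runs_seq[OF r2] runs_seq[OF M(2)] runs_seq[OF runs_LoadC] runs_AddI)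
      have NT: "N * (?t B + 3) \<le> T1 B * (?t B + 3)"
        using m1(1) N_def by (intro mult_right_mono) auto
      show "(\<Sum>x<b m (\<lambda>a. m (R + a)). S m (\<lambda>a. m (R + a)) x) \<le> ?T B \<and>
       (\<exists>t m'. t \<le> ?T B \<and> runs ?cd m t m' \<and>
          m' D = (\<Sum>x<b m (\<lambda>a. m (R + a)). S m (\<lambda>a. m (R + a)) x) \<and>
          (\<forall>i<D. m' i = m i) \<and> (\<forall>a. m' (R + a) = m (R + a)))"
        unfolding H_def[symmetric] N_def[symmetric]
      proof (intro conjI exI)
        show "(\<Sum>x<N. S m H x) \<le> ?T B" using sum_le[of N] by simp
        show "t1 + ((1 + (1 + 1)) + (t4 + (1 + 1))) \<le> ?T B" using m1(2) order_trans[OF M(1) add_right_mono[OF NT]] by linarith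
        show "runs ?cd m (t1 + ((1 + (1 + 1)) + (t4 + (1 + 1))))
          ((M(D := 0))(D := (M(D := 0)) D + (M(D := 0)) (D + 1)))" by (rule r)
      qed (use M(3) R 1(2) in \<open>auto simp: Inv_def H_def\<close>)
    qed
  qed
qed

subsection \<open>Computable commands\<close>

text \<open>A command transforms the heap. Register 0 holds a limit at which every store is truncated,
  so that iterating a command cannot make the contents of the heap grow.\<close>

definition executes :: "nat \<Rightarrow> nat \<Rightarrow> (nat \<Rightarrow> nat) \<Rightarrow> code \<Rightarrow>
    ((nat \<Rightarrow> nat) \<Rightarrow> (nat \<Rightarrow> nat) \<Rightarrow> nat \<Rightarrow> nat) \<Rightarrow> bool" where
  "executes d R T cd F \<longleftrightarrow> (\<forall>m B. (\<forall>i<d. m i \<le> B) \<longrightarrow> (\<forall>a. m (R + a) \<le> B) \<longrightarrow>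
     (\<exists>t m'. t \<le> T B \<and> runs cd m t m' \<and> (\<forall>i<d. m' i = m i) \<and>
        (\<lambda>a. m' (R + a)) = F m (\<lambda>a. m (R + a))))"

definition CC :: "nat \<Rightarrow> ((nat \<Rightarrow> nat) \<Rightarrow> (nat \<Rightarrow> nat) \<Rightarrow> nat \<Rightarrow> nat) \<Rightarrow> bool" where
  "CC d F \<longleftrightarrow> 0 < d \<and> (\<forall>e e' h. (\<forall>i<d. e i = e' i) \<longrightarrow> F e h = F e' h) \<and>
     (\<forall>e h B. e 0 \<le> B \<longrightarrow> (\<forall>a. h a \<le> B) \<longrightarrow> (\<forall>a. F e h a \<le> B)) \<and>
     (\<forall>d'\<ge>d. \<exists>K T. pb T \<and> d' < K \<and> (\<forall>R\<ge>K. \<exists>cd. executes d' R T cd F))"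

definition CCF :: "nat \<Rightarrow> ((nat \<Rightarrow> nat) \<Rightarrow> nat \<Rightarrow> (nat \<Rightarrow> nat) \<Rightarrow> nat \<Rightarrow> nat) \<Rightarrow> bool" where
  "CCF d F \<longleftrightarrow> (\<forall>x. \<forall>e e' h. (\<forall>i<d. e i = e' i) \<longrightarrow> F e x h = F e' x h) \<and>
     (\<forall>d' i. d \<le> i \<longrightarrow> i < d' \<longrightarrow> CC d' (\<lambda>e. F e (e i)))"

fun forl :: "nat \<Rightarrow> (nat \<Rightarrow> 'a \<Rightarrow> 'a) \<Rightarrow> 'a \<Rightarrow> 'a" where
  "forl 0 F h = h"
| "forl (Suc n) F h = F n (forl n F h)"

lemma CC_dep: "CC d F \<Longrightarrow> (\<And>i. i < d \<Longrightarrow> e i = e' i) \<Longrightarrow> F e h = F e' h"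
  unfolding CC_def by blast

lemma CC_grow: "CC d F \<Longrightarrow> e 0 \<le> B \<Longrightarrow> \<forall>a. h a \<le> B \<Longrightarrow> F e h a \<le> B"
  unfolding CC_def by blast

lemma CC_E:
  assumes "CC d F" "d \<le> D"
  obtains K T where "pb T" "D < K" "\<And>R. K \<le> R \<Longrightarrow> \<exists>cd. executes D R T cd F"
  using assms unfolding CC_def by blast

lemma executesI:
  assumes "\<And>m B. (\<forall>i<d. m i \<le> B) \<Longrightarrow> (\<forall>a. m (R + a) \<le> B) \<Longrightarrow>
     (\<exists>t m'. t \<le> T B \<and> runs cd m t m' \<and> (\<forall>i<d. m' i = m i) \<and>
        (\<lambda>a. m' (R + a)) = F m (\<lambda>a. m (R + a)))"
  shows "executes d R T cd F"
  unfolding executes_def using assms by blast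

lemma executesE:
  assumes "executes d R T cd F" "\<forall>i<d. m i \<le> B" "\<forall>a. m (R + a) \<le> B"
  obtains t m' where "t \<le> T B" "runs cd m t m'"
    "\<forall>i<d. m' i = m i" "(\<lambda>a. m' (R + a)) = F m (\<lambda>a. m (R + a))"
  using assms unfolding executes_def by blast

lemma CC_I:
  assumes "0 < d" "\<And>e e' h. (\<And>i. i < d \<Longrightarrow> e i = e' i) \<Longrightarrow> F e h = F e' h"
    "\<And>e h B a. e 0 \<le> B \<Longrightarrow> (\<And>a. h a \<le> B) \<Longrightarrow> F e h a \<le> B"
    "\<And>D. d \<le> D \<Longrightarrow> \<exists>K T. pb T \<and> D < K \<and> (\<forall>R\<ge>K. \<exists>cd. executes D R T cd F)"
  shows "CC d F"
  unfolding CC_def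
proof (intro conjI allI impI)
  show "0 < d" by fact
next
  fix e e' :: "nat \<Rightarrow> nat" and h assume "\<forall>i<d. e i = e' i"
  then show "F e h = F e' h" by (intro assms(2)) simp
next
  fix e h :: "nat \<Rightarrow> nat" and B a assume "e 0 \<le> B" "\<forall>a. h a \<le> B"
  then show "F e h a \<le> B" by (intro assms(3)) simp_all
next
  fix D assume "d \<le> D"
  then show "\<exists>K T. pb T \<and> D < K \<and> (\<forall>R\<ge>K. \<exists>cd. executes D R T cd F)" by (rule assms(4))
qed

lemma executes_exI:
  assumes "pb T" "D < K" "\<And>R. K \<le> R \<Longrightarrow> \<exists>cd. executes D R T cd F"
  shows "\<exists>K T. pb T \<and> D < K \<and> (\<forall>R\<ge>K. \<exists>cd. executes D R T cd F)"
  using assms by blast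

lemma CE_min: "CE d f \<Longrightarrow> CE d g \<Longrightarrow> CE d (\<lambda>e h. min (f e h) (g e h))"
proof -
  assume "CE d f" "CE d g"
  then have "CE d (\<lambda>e h. f e h - (f e h - g e h))" by (intro CE_sub)
  moreover have "f e h - (f e h - g e h) = min (f e h) (g e h)" for e h by simp
  ultimately show ?thesis by simp
qed

lemma CC_store:
  assumes f: "CE d f" and g: "CE d g" and d: "0 < d"
  shows "CC d (\<lambda>e h. h(f e h := min (g e h) (e 0)))"
proof (rule CC_I)
  fix e e' :: "nat \<Rightarrow> nat" and h assume *: "\<And>i. i < d \<Longrightarrow> e i = e' i"
  show "h(f e h := min (g e h) (e 0)) = h(f e' h := min (g e' h) (e' 0))"
    using CE_dep[OF f, of e e' h] CE_dep[OF g, of e e' h] * d by simp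
next
  fix D assume D: "d \<le> D"
  have g': "CE d (\<lambda>e h. min (g e h) (e 0))" by (intro CE_min g CE_var d)
  obtain K1 T1 where 1: "pb T1" "D < K1" "\<And>R. K1 \<le> R \<Longrightarrow> \<exists>cd. evaluates D R T1 cd f"
    by (rule CE_E[OF f D]) blast
  obtain K2 T2 where 2: "pb T2" "Suc D < K2"
    "\<And>R. K2 \<le> R \<Longrightarrow> \<exists>cd. evaluates (Suc D) R T2 cd (\<lambda>e h. min (g e h) (e 0))"
    by (rule CE_E[OF g' le_SucI[OF D]]) blast
  let ?T = "\<lambda>B. T1 B + T2 (B + T1 B) + 3"
  show "\<exists>K T. pb T \<and> D < K \<and> (\<forall>R\<ge>K. \<exists>cd. executes D R T cd (\<lambda>e h. h(f e h := min (g e h) (e 0))))"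
  proof (rule executes_exI)
    show "pb ?T" by (intro pb_add pb_id pb_const 1(1) pb_comp[OF 2(1)])
    show "D < Suc (K1 + K2)" using 1(2) by simp
    fix R assume R: "Suc (K1 + K2) \<le> R"
    obtain c1 where c1: "evaluates D R T1 c1 f" using 1(3)[of R] R by auto
    obtain c2 where c2: "evaluates (Suc D) R T2 c2 (\<lambda>e h. min (g e h) (e 0))"
      using 2(3)[of R] R by auto
    let ?cd = "c1 ;; c2 ;; ins (LoadC (D + 2) R) ;; ins (AddI D (D + 2) D) ;; ins (StoreInd D (Suc D))"
    show "\<exists>cd. executes D R ?T cd (\<lambda>e h. h(f e h := min (g e h) (e 0)))"
    proof (rule exI[of _ "?cd"], rule executesI)
      fix m :: "nat \<Rightarrow> nat" and B assume m: "\<forall>i<D. m i \<le> B" "\<forall>a. m (R + a) \<le> B"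
      define H where "H = (\<lambda>a. m (R + a))"
      obtain t1 m1 where m1: "f m H \<le> T1 B" "t1 \<le> T1 B" "runs c1 m t1 m1"
        "m1 D = f m H" "\<forall>i<D. m1 i = m i" "\<forall>a. m1 (R + a) = m (R + a)"
        using evaluatesE[OF c1 m] unfolding H_def by blast
      have "\<forall>i<Suc D. m1 i \<le> B + T1 B" "\<forall>a. m1 (R + a) \<le> B + T1 B"
        using m1 m by (auto simp: less_Suc_eq trans_le_add1 trans_le_add2)
      then obtain t2 m2 where m2:
        "t2 \<le> T2 (B + T1 B)" "runs c2 m1 t2 m2" "m2 (Suc D) = min (g m1 (\<lambda>a. m1 (R + a))) (m1 0)"
        "\<forall>i<Suc D. m2 i = m1 i" "\<forall>a. m2 (R + a) = m1 (R + a)"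
        by (rule evaluatesE[OF c2])
      have gm: "m2 (Suc D) = min (g m H) (m 0)"
        using CE_dep[OF g, of m1 m] m1(5,6) D d m2(3) by (simp add: H_def)
      let ?m3 = "m2(D + 2 := R)"
      let ?m4 = "?m3(D := ?m3 (D + 2) + ?m3 D)"
      let ?m5 = "?m4(?m4 D := ?m4 (Suc D))"
      have r: "runs ?cd m (t1 + (t2 + (1 + (1 + 1)))) ?m5"
        by (intro runs_seq[OF m1(3)] runs_seq[OF m2(2)] runs_seq[OF runs_LoadC]
            runs_seq[OF runs_AddI] runs_StoreInd)
      show "\<exists>t m'. t \<le> ?T B \<and> runs ?cd m t m' \<and> (\<forall>i<D. m' i = m i) \<and>
        (\<lambda>a. m' (R + a)) = (\<lambda>a. m (R + a))(f m (\<lambda>a. m (R + a)) := min (g m (\<lambda>a. m (R + a))) (m 0))"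
        unfolding H_def[symmetric]
      proof (intro exI conjI)
        show "t1 + (t2 + (1 + (1 + 1))) \<le> ?T B" using m1(2) m2(1) by simp
        show "runs ?cd m (t1 + (t2 + (1 + (1 + 1)))) ?m5" by (rule r)
        show "\<forall>i<D. ?m5 i = m i" using m2 m1 R 1(2) by auto
        show "(\<lambda>a. ?m5 (R + a)) = H(f m H := min (g m H) (m 0))"
          using m2 m1 R 1(2) 2(2) gm by (auto simp: H_def fun_eq_iff)
      qed
    qed
  qed
qed (use d in auto)

lemma CC_seq:
  assumes F: "CC d F" and G: "CC d G"
  shows "CC d (\<lambda>e h. G e (F e h))"
proof (rule CC_I)
  show "0 < d" using F by (simp add: CC_def)
next
  fix e e' :: "nat \<Rightarrow> nat" and h assume *: "\<And>i. i < d \<Longrightarrow> e i = e' i"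
  show "G e (F e h) = G e' (F e' h)"
    using CC_dep[OF F, of e e' h] CC_dep[OF G, of e e' "F e' h"] * by simp
next
  fix e h :: "nat \<Rightarrow> nat" and B a assume *: "e 0 \<le> B" "\<And>a. h a \<le> B"
  show "G e (F e h) a \<le> B"
    using CC_grow[of d G e B "F e h" a] CC_grow[of d F e B h] F G * by simp
next
  fix D assume D: "d \<le> D"
  have d: "0 < d" using F by (simp add: CC_def)
  obtain K1 T1 where 1: "pb T1" "D < K1" "\<And>R. K1 \<le> R \<Longrightarrow> \<exists>cd. executes D R T1 cd F"
    by (rule CC_E[OF F D]) blast
  obtain K2 T2 where 2: "pb T2" "D < K2" "\<And>R. K2 \<le> R \<Longrightarrow> \<exists>cd. executes D R T2 cd G"
    by (rule CC_E[OF G D]) blast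
  show "\<exists>K T. pb T \<and> D < K \<and> (\<forall>R\<ge>K. \<exists>cd. executes D R T cd (\<lambda>e h. G e (F e h)))"
  proof (rule executes_exI)
    show "pb (\<lambda>B. T1 B + T2 B)" by (intro pb_add 1 2)
    show "D < K1 + K2" using 1(2) by simp
    fix R assume R: "K1 + K2 \<le> R"
    obtain c1 where c1: "executes D R T1 c1 F" using 1(3)[of R] R by auto
    obtain c2 where c2: "executes D R T2 c2 G" using 2(3)[of R] R by auto
    show "\<exists>cd. executes D R (\<lambda>B. T1 B + T2 B) cd (\<lambda>e h. G e (F e h))"
    proof (rule exI[of _ "(c1 ;; c2)"], rule executesI)
      fix m :: "nat \<Rightarrow> nat" and B assume m: "\<forall>i<D. m i \<le> B" "\<forall>a. m (R + a) \<le> B"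
      obtain t1 m1 where m1: "t1 \<le> T1 B" "runs c1 m t1 m1" "\<forall>i<D. m1 i = m i"
        "(\<lambda>a. m1 (R + a)) = F m (\<lambda>a. m (R + a))"
        by (rule executesE[OF c1 m])
      have "F m (\<lambda>a. m (R + a)) a \<le> B" for a
        using CC_grow[of d F m B "\<lambda>a. m (R + a)" a] F m d D by simp
      then have "\<forall>a. m1 (R + a) \<le> B" using m1(4) by metis
      moreover have "\<forall>i<D. m1 i \<le> B" using m m1 by simp
      ultimately obtain t2 m2 where m2: "t2 \<le> T2 B" "runs c2 m1 t2 m2" "\<forall>i<D. m2 i = m1 i"
        "(\<lambda>a. m2 (R + a)) = G m1 (\<lambda>a. m1 (R + a))"
        using executesE[OF c2, of m1 B] by blast
      have "G m1 (\<lambda>a. m1 (R + a)) = G m (F m (\<lambda>a. m (R + a)))"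
        using CC_dep[OF G, of m1 m] m1 D by simp
      then show "\<exists>t m'. t \<le> T1 B + T2 B \<and> runs (c1 ;; c2) m t m' \<and> (\<forall>i<D. m' i = m i) \<and>
        (\<lambda>a. m' (R + a)) = G m (F m (\<lambda>a. m (R + a)))"
        using m1 m2 by (intro exI[of _ "t1 + t2"] exI[of _ m2] conjI runs_seq[of c1 m t1 m1]) auto
    qed
  qed
qed

lemma CCF_dep: "CCF d F \<Longrightarrow> (\<And>i. i < d \<Longrightarrow> e i = e' i) \<Longrightarrow> F e x h = F e' x h"
  unfolding CCF_def by blast

lemma CCF_grow:
  assumes "CCF d F" "e 0 \<le> B" "\<forall>a. h a \<le> B" "0 < d"
  shows "F e x h a \<le> B"
proof -
  have C: "CC (Suc d) (\<lambda>e. F e (e d))" using assms(1) by (simp add: CCF_def)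
  have "F (e(d := x)) ((e(d := x)) d) h a \<le> B"
    using CC_grow[of "Suc d" "\<lambda>e. F e (e d)" "e(d := x)" B h a] C assms by simp
  moreover have "F (e(d := x)) x h = F e x h"
    by (rule CCF_dep[OF assms(1)]) simp
  ultimately show ?thesis by simp
qed

lemma forl_grow:
  assumes "CCF d F" "e 0 \<le> B" "\<forall>a. h a \<le> B" "0 < d"
  shows "forl n (F e) h a \<le> B"
proof (induction n arbitrary: a)
  case (Suc n)
  then show ?case using CCF_grow[of d F e B "forl n (F e) h" n a] assms by simp
qed (use assms in simp)

text \<open>By \<open>forl_grow\<close> the same bound \<open>B\<close> holds for the heap before
  every pass, so all passes cost at most \<open>T2\<close> at one fixed argument. The counter is in
  register \<open>D\<close>, the number of remaining passes in \<open>D + 1\<close>.\<close>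

lemma CC_for:
  assumes b: "CE d b" and F: "CCF d F" and d: "0 < d"
  shows "CC d (\<lambda>e h. forl (b e h) (F e) h)"
proof (rule CC_I[OF d])
  fix e e' :: "nat \<Rightarrow> nat" and h assume *: "\<And>i. i < d \<Longrightarrow> e i = e' i"
  have "F e = F e'" using CCF_dep[OF F, of e e'] * by (intro ext) simp
  then show "forl (b e h) (F e) h = forl (b e' h) (F e') h"
    using CE_dep[OF b, of e e' h] * by simp
next
  fix e h :: "nat \<Rightarrow> nat" and B a assume "e 0 \<le> B" "\<And>a. h a \<le> B"
  then show "forl (b e h) (F e) h a \<le> B" using forl_grow[of d F e B h "b e h" a] F d by blast
next
  fix D assume D: "d \<le> D"
  obtain K1 T1 where 1: "pb T1" "D < K1" "\<And>R. K1 \<le> R \<Longrightarrow> \<exists>cd. evaluates D R T1 cd b"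
    by (rule CE_E[OF b D]) blast
  have F': "CC (D + 2) (\<lambda>e. F e (e D))" using F D by (simp add: CCF_def)
  obtain K2 T2 where 2: "pb T2" "D + 2 < K2"
    "\<And>R. K2 \<le> R \<Longrightarrow> \<exists>cd. executes (D + 2) R T2 cd (\<lambda>e. F e (e D))"
    by (rule CC_E[OF F' order_refl]) blast
  let ?B = "\<lambda>B. B + T1 B"
  let ?t = "\<lambda>B. T2 (?B B) + 3"
  let ?T = "\<lambda>B. T1 B + T1 B * (?t B + 3) + 9"
  show "\<exists>K T. pb T \<and> D < K \<and> (\<forall>R\<ge>K. \<exists>cd. executes D R T cd (\<lambda>e h. forl (b e h) (F e) h))"
  proof (rule executes_exI)
    show "pb ?T" by (intro pb_add pb_mult 1(1) pb_comp[OF 2(1)] pb_id pb_const)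
    show "D < Suc (K1 + K2)" using 1(2) by simp
    fix R assume R: "Suc (K1 + K2) \<le> R"
    obtain c1 where c1: "evaluates D R T1 c1 b" using 1(3)[of R] R by auto
    obtain c2 where c2: "executes (D + 2) R T2 c2 (\<lambda>e. F e (e D))" using 2(3)[of R] R by auto
    let ?body = "c2 ;; ins (LoadC (D + 2) 1) ;;
      ins (AddI D D (D + 2)) ;; ins (SubI (D + 1) (D + 1) (D + 2))"
    let ?init = "ins (LoadC (D + 2) 0) ;; ins (AddI (D + 1) D (D + 2)) ;; ins (LoadC D 0)"
    let ?cd = "c1 ;; ?init ;; loopc (D + 2) (D + 1) ?body"
    show "\<exists>cd. executes D R ?T cd (\<lambda>e h. forl (b e h) (F e) h)"
    proof (rule exI[of _ "?cd"], rule executesI)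
      fix m :: "nat \<Rightarrow> nat" and B assume m: "\<forall>i<D. m i \<le> B" "\<forall>a. m (R + a) \<le> B"
      define H where "H = (\<lambda>a. m (R + a))"
      obtain t1 m1 where m1: "b m H \<le> T1 B" "t1 \<le> T1 B" "runs c1 m t1 m1"
        "m1 D = b m H" "\<forall>i<D. m1 i = m i" "\<forall>a. m1 (R + a) = m (R + a)"
        using evaluatesE[OF c1 m] unfolding H_def by blast
      define N where "N = b m H"
      let ?m2 = "((m1(D + 2 := 0))(D + 1 := N))(D := 0)"
      have r2: "runs ?init m1 (1 + (1 + 1)) ?m2"
        using runs_seq[OF runs_LoadC[of "D + 2" 0 m1]
            runs_seq[OF runs_AddI[of "D + 1" D "D + 2"] runs_LoadC[of D 0]]]
          m1(4) N_def by simp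
      define Inv where "Inv = (\<lambda>j (M :: nat \<Rightarrow> nat). M D = j \<and> M (D + 1) = N - j \<and>
        (\<forall>i<D. M i = m i) \<and> (\<lambda>a. M (R + a)) = forl j (F m) H)"
      have "\<exists>t M'. t \<le> N * (?t B + 3) + 1 \<and> runs (loopc (D + 2) (D + 1) ?body) ?m2 t M' \<and> Inv N M'"
      proof (rule runs_loop)
        show "Inv 0 ?m2" using m1 R 2(2) by (auto simp: Inv_def H_def)
        show "M (D + 1) = 0" if "Inv N M" for M using that by (simp add: Inv_def)
        fix j M assume j: "j < N" and M: "Inv j M"
        have "\<forall>i<D + 2. M i \<le> ?B B"
        proof (intro allI impI)
          fix i assume i: "i < D + 2"
          have N: "N \<le> T1 B" using m1(1) N_def by simp
          consider "i < D" | "i = D" | "i = D + 1" using i by linarith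
          then show "M i \<le> ?B B"
          proof cases
            case 1 then show ?thesis using M m(1) by (auto simp: Inv_def trans_le_add1)
          next
            case 2 then show ?thesis using M j N by (auto simp: Inv_def)
          next
            case 3 then show ?thesis using M N by (auto simp: Inv_def)
          qed
        qed
        moreover have "\<forall>a. M (R + a) \<le> ?B B"
        proof
          fix a
          have "forl j (F m) H a \<le> B"
            using forl_grow[of d F m B H j a] F m d D by (simp add: H_def)
          then have "M (R + a) \<le> B" using M unfolding Inv_def by metis
          then show "M (R + a) \<le> ?B B" by simp
        qed
        ultimately obtain t3 M3 where M3: "t3 \<le> T2 (?B B)" "runs c2 M t3 M3"
          "\<forall>i<D + 2. M3 i = M i" "(\<lambda>a. M3 (R + a)) = F M (M D) (\<lambda>a. M (R + a))"
          by (rule executesE[OF c2])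
        have "F M (M D) (\<lambda>a. M (R + a)) = F m j (forl j (F m) H)"
          using M CCF_dep[OF F, of M m] D unfolding Inv_def by auto
        then have h3: "(\<lambda>a. M3 (R + a)) = forl (Suc j) (F m) H" using M3(4) by simp
        have e3: "M3 D = j" "M3 (D + 1) = N - j" "\<forall>i<D. M3 i = m i"
          using M3(3) M by (auto simp: Inv_def)
        let ?M5 = "M3(D + 2 := 1)"
        let ?M6 = "?M5(D := Suc j)"
        let ?M7 = "?M6(D + 1 := N - j - 1)"
        have "runs (ins (LoadC (D + 2) 1)) M3 1 ?M5" by (rule runs_LoadC)
        moreover have "runs (ins (AddI D D (D + 2))) ?M5 1 ?M6"
          using runs_AddI[of D D "D + 2" ?M5] e3 by simp
        moreover have "runs (ins (SubI (D + 1) (D + 1) (D + 2))) ?M6 1 ?M7"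
          using runs_SubI[of "D + 1" "D + 1" "D + 2" ?M6] e3 by simp
        ultimately have r: "runs ?body M (t3 + (1 + (1 + 1))) ?M7"
          by (intro runs_seq[OF M3(2)]
            runs_seq[of "ins (LoadC (D + 2) 1)"] runs_seq[of "ins (AddI D D (D + 2))"])
        show "M (D + 1) \<noteq> 0 \<and> (\<exists>t m'. t \<le> ?t B \<and> runs ?body M t m' \<and> Inv (Suc j) (m'(D + 2 := 0)))"
        proof (intro conjI exI)
          show "M (D + 1) \<noteq> 0" using M j by (simp add: Inv_def)
          show "t3 + (1 + (1 + 1)) \<le> ?t B" using M3(1) by simp
          show "runs ?body M (t3 + (1 + (1 + 1))) ?M7" by (rule r)
          show "Inv (Suc j) (?M7(D + 2 := 0))"
          proof -
            have "(\<lambda>a. (?M7(D + 2 := 0)) (R + a)) = (\<lambda>a. M3 (R + a))"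
              using R 2(2) by (auto simp: fun_eq_iff)
            then show ?thesis using e3 h3 unfolding Inv_def by simp
          qed
        qed
      qed
      then obtain t4 M where M: "t4 \<le> N * (?t B + 3) + 1"
        "runs (loopc (D + 2) (D + 1) ?body) ?m2 t4 M" "Inv N M" by blast
      have r: "runs ?cd m (t1 + ((1 + (1 + 1)) + t4)) M"
        by (intro runs_seq[OF m1(3)] runs_seq[OF r2] M(2))
      have NT: "N * (?t B + 3) \<le> T1 B * (?t B + 3)"
        using m1(1) N_def by (intro mult_right_mono) auto
      show "\<exists>t m'. t \<le> ?T B \<and> runs ?cd m t m' \<and> (\<forall>i<D. m' i = m i) \<and>
        (\<lambda>a. m' (R + a)) = forl (b m (\<lambda>a. m (R + a))) (F m) (\<lambda>a. m (R + a))"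
        unfolding H_def[symmetric] N_def[symmetric]
      proof (intro exI conjI)
        show "t1 + ((1 + (1 + 1)) + t4) \<le> ?T B" using m1(2) order_trans[OF M(1) add_right_mono[OF NT]] by linarith
        show "runs ?cd m (t1 + ((1 + (1 + 1)) + t4)) M" by (rule r)
      qed (use M(3) in \<open>auto simp: Inv_def\<close>)
    qed
  qed
qed

subsection \<open>Derived expressions\<close>

definition CP :: "nat \<Rightarrow> ((nat \<Rightarrow> nat) \<Rightarrow> (nat \<Rightarrow> nat) \<Rightarrow> bool) \<Rightarrow> bool" where
  "CP d P \<longleftrightarrow> CE d (\<lambda>e h. of_bool (P e h))"

definition CPF :: "nat \<Rightarrow> ((nat \<Rightarrow> nat) \<Rightarrow> (nat \<Rightarrow> nat) \<Rightarrow> nat \<Rightarrow> bool) \<Rightarrow> bool" where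
  "CPF d P \<longleftrightarrow> (\<forall>d'\<ge>d. \<forall>a. CE d' a \<longrightarrow> CP d' (\<lambda>e h. P e h (a e h)))"

named_theorems ce

lemma CPFI: "(\<And>d' a. d \<le> d' \<Longrightarrow> CE d' a \<Longrightarrow> CP d' (\<lambda>e h. P e h (a e h))) \<Longrightarrow> CPF d P"
  unfolding CPF_def by blast

lemma CPFD: "CPF d S \<Longrightarrow> d \<le> d' \<Longrightarrow> CE d' a \<Longrightarrow> CP d' (\<lambda>e h. S e h (a e h))"
  unfolding CPF_def by blast

lemma CPF_CF: "CPF d P \<Longrightarrow> CF d (\<lambda>e h x. of_bool (P e h x))"
  unfolding CPF_def CF_def CP_def by blast

lemma CF_const: "CE d f \<Longrightarrow> CF d (\<lambda>e h x. f e h)"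
  by (rule CFI) (rule CE_lift)

lemma CP_CE: "CP d P \<Longrightarrow> CE d (\<lambda>e h. of_bool (P e h))"
  by (simp add: CP_def)

text \<open>A product is a sum of equal terms, so multiplication comes from the loop behind
  \<open>CE_sum\<close>.\<close>

lemma CE_mult: "CE d f \<Longrightarrow> CE d g \<Longrightarrow> CE d (\<lambda>e h. f e h * g e h)"
  using CE_sum[of d f "\<lambda>e h x. g e h"] CF_const[of d g] by simp

lemma CP_not: "CP d P \<Longrightarrow> CP d (\<lambda>e h. \<not> P e h)"
proof -
  assume "CP d P"
  then have "CE d (\<lambda>e h. 1 - of_bool (P e h))" unfolding CP_def by (intro CE_sub CE_const)
  moreover have "1 - of_bool (P e h) = (of_bool (\<not> P e h) :: nat)" for e h by simp
  ultimately show ?thesis unfolding CP_def by simp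
qed

lemma CP_less: "CE d f \<Longrightarrow> CE d g \<Longrightarrow> CP d (\<lambda>e h. f e h < g e h)"
  unfolding CP_def
proof -
  assume "CE d f" "CE d g"
  then have "CE d (\<lambda>e h. 1 - (1 - (g e h - f e h)))" by (intro CE_sub CE_const)
  moreover have "1 - (1 - (g e h - f e h)) = of_bool (f e h < g e h)" for e h by auto
  ultimately show "CE d (\<lambda>e h. of_bool (f e h < g e h))" by simp
qed

lemma CP_le: "CE d f \<Longrightarrow> CE d g \<Longrightarrow> CP d (\<lambda>e h. f e h \<le> g e h)"
  using CP_not[OF CP_less[of d g f]] by (simp add: not_less)

lemma CP_conj: "CP d P \<Longrightarrow> CP d Q \<Longrightarrow> CP d (\<lambda>e h. P e h \<and> Q e h)"
  unfolding CP_def using CE_mult[of d "\<lambda>e h. of_bool (P e h)" "\<lambda>e h. of_bool (Q e h)"]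
  by (simp add: of_bool_conj)

lemma CP_disj: "CP d P \<Longrightarrow> CP d Q \<Longrightarrow> CP d (\<lambda>e h. P e h \<or> Q e h)"
proof -
  assume P: "CP d P" and Q: "CP d Q"
  have "CP d (\<lambda>e h. \<not> (\<not> P e h \<and> \<not> Q e h))"
    by (rule CP_not, rule CP_conj) (rule CP_not, fact)+
  then show ?thesis by simp
qed

lemma CP_imp: "CP d P \<Longrightarrow> CP d Q \<Longrightarrow> CP d (\<lambda>e h. P e h \<longrightarrow> Q e h)"
  unfolding imp_conv_disj by (rule CP_disj, rule CP_not)

lemma CP_eq: "CE d f \<Longrightarrow> CE d g \<Longrightarrow> CP d (\<lambda>e h. f e h = g e h)"
  unfolding eq_iff by (rule CP_conj; rule CP_le)

lemma CE_if: "CP d P \<Longrightarrow> CE d f \<Longrightarrow> CE d g \<Longrightarrow> CE d (\<lambda>e h. if P e h then f e h else g e h)"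
proof -
  assume P: "CP d P" and fg: "CE d f" "CE d g"
  have "CE d (\<lambda>e h. of_bool (P e h) * f e h + of_bool (\<not> P e h) * g e h)"
    using P CP_not[OF P] fg unfolding CP_def by (intro CE_add CE_mult)
  moreover have "of_bool (P e h) * f e h + of_bool (\<not> P e h) * g e h =
    (if P e h then f e h else g e h)" for e h by simp
  ultimately show ?thesis by simp
qed

lemma CP_ex: "CE d b \<Longrightarrow> CPF d P \<Longrightarrow> CP d (\<lambda>e h. \<exists>x<b e h. P e h x)"
  unfolding CP_def
proof -
  assume "CE d b" "CPF d P"
  then have "CE d (\<lambda>e h. 1 - (1 - (\<Sum>x<b e h. of_bool (P e h x))))"
    by (intro CE_sub CE_const CE_sum CPF_CF)
  moreover have "1 - (1 - (\<Sum>x<b e h. of_bool (P e h x))) = (of_bool (\<exists>x<b e h. P e h x) :: nat)" for e h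
  proof (cases "\<exists>x<b e h. P e h x")
    case True
    then obtain x where x: "x < b e h" "P e h x" by blast
    have "of_bool (P e h x) \<le> (\<Sum>x<b e h. of_bool (P e h x) :: nat)"
      by (rule member_le_sum) (use x in auto)
    moreover have "of_bool (P e h x) = (1 :: nat)" using x by simp
    ultimately have "1 - (1 - (\<Sum>x<b e h. of_bool (P e h x))) = (1 :: nat)" by linarith
    then show ?thesis using True by (simp only: of_bool_eq)
  qed auto
  ultimately show "CE d (\<lambda>e h. of_bool (\<exists>x<b e h. P e h x))" by simp
qed

lemma CPF_not: "CPF d P \<Longrightarrow> CPF d (\<lambda>e h x. \<not> P e h x)"
  unfolding CPF_def using CP_not by blast

lemma CP_all: "CE d b \<Longrightarrow> CPF d P \<Longrightarrow> CP d (\<lambda>e h. \<forall>x<b e h. P e h x)"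
proof -
  assume b: "CE d b" and P: "CPF d P"
  have "CP d (\<lambda>e h. \<not> (\<exists>x<b e h. \<not> P e h x))"
    by (rule CP_not, rule CP_ex[OF b], rule CPF_not[OF P])
  then show ?thesis by simp
qed

lemma CE_max: "CE d f \<Longrightarrow> CE d g \<Longrightarrow> CE d (\<lambda>e h. max (f e h) (g e h))"
proof -
  assume "CE d f" "CE d g"
  then have "CE d (\<lambda>e h. f e h + (g e h - f e h))" by (intro CE_add CE_sub)
  moreover have "f e h + (g e h - f e h) = max (f e h) (g e h)" for e h by simp
  ultimately show ?thesis by simp
qed

text \<open>The quotient counts the positive multiples of \<open>b\<close> up to \<open>a\<close>.
  The guard \<open>0 < b\<close> reproduces the convention that division by 0 gives 0.\<close>

lemma div_eq_sum: "a div b = (\<Sum>x<a. of_bool (0 < b \<and> b * (x + 1) \<le> a))" for a b :: nat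
proof (cases "b = 0")
  case False
  have "(\<Sum>x<a. of_bool (0 < b \<and> b * (x + 1) \<le> a)) = card {x. x < a \<and> b * (x + 1) \<le> a}"
    using False by (simp add: sum.If_cases of_bool_def Int_def lessThan_def)
  also have "{x. x < a \<and> b * (x + 1) \<le> a} = {..<a div b}"
  proof -
    have "x < a \<and> b * (x + 1) \<le> a \<longleftrightarrow> x < a div b" for x
    proof -
      have "b * (x + 1) \<le> a \<longleftrightarrow> x < a div b"
        using False less_eq_div_iff_mult_less_eq[of b "x + 1" a] by (simp add: mult.commute Suc_le_eq)
      moreover have "x < a" if "x < a div b" using that div_le_dividend[of a b] by linarith
      ultimately show ?thesis by blast
    qed
    then show ?thesis by auto
  qed
  finally show ?thesis by simp
qed simp

lemma CE_div: "CE d f \<Longrightarrow> CE d g \<Longrightarrow> CE d (\<lambda>e h. f e h div g e h)"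
  unfolding div_eq_sum
  by (intro CE_sum CPF_CF CPFI CP_conj CP_less CP_le CE_mult CE_add CE_const) (auto intro: CE_lift)

lemma CE_mod: "CE d f \<Longrightarrow> CE d g \<Longrightarrow> CE d (\<lambda>e h. f e h mod g e h)"
  unfolding minus_mult_div_eq_mod[symmetric] by (intro CE_sub CE_mult CE_div)

lemma CP_even: "CE d f \<Longrightarrow> CP d (\<lambda>e h. even (f e h))"
  unfolding even_iff_mod_2_eq_zero by (intro CP_eq CE_mod CE_const)

lemma CE_Suc: "CE d f \<Longrightarrow> CE d (\<lambda>e h. Suc (f e h))"
  using CE_add[of d f "\<lambda>e h. 1"] CE_const by simp

lemmas [ce] = CFI CPFI CE_const CE_add CE_sub CE_mult CE_div CE_mod CE_max CE_min CE_if CE_sum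
  CE_Suc CP_CE CP_not CP_less CP_le CP_conj CP_disj CP_imp CP_eq CP_ex CP_all CP_even

subsection \<open>Straight-line code\<close>

fun straight :: "instr \<Rightarrow> bool" where
  "straight (Jz r l) = False"
| "straight Halt = False"
| "straight _ = True"

definition eff :: "instr \<Rightarrow> (nat \<Rightarrow> nat) \<Rightarrow> nat \<Rightarrow> nat" where
  "eff i m = snd (exec_instr i (0, m))"

lemma eff_simps [simp]:
  "eff (LoadC r k) m = m(r := k)" "eff (AddI r a b) m = m(r := m a + m b)"
  "eff (SubI r a b) m = m(r := m a - m b)" "eff (LoadInd r a) m = m(r := m (m a))"
  "eff (StoreInd a r) m = m(m a := m r)"
  by (simp_all add: eff_def)

definition insl :: "instr list \<Rightarrow> code" where
  "insl xs = (\<lambda>p. xs)"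

lemma runs_insl: "(\<And>i. i \<in> set is \<Longrightarrow> straight i) \<Longrightarrow> runs (insl is) m (length is) (fold eff is m)"
proof (induction "is" arbitrary: m)
  case Nil
  then show ?case by (simp add: runs_def insl_def ram_run_def)
next
  case (Cons i "is")
  have "runs (ins i) m 1 (eff i m)"
    by (rule runs_ins) (use Cons.prems[of i] in \<open>cases i; simp\<close>)+
  from runs_seq[OF this Cons.IH[of "eff i m"]] Cons.prems
  have "runs (ins i ;; insl is) m (1 + length is) (fold eff is (eff i m))" by simp
  moreover have "ins i ;; insl is = insl (i # is)"
    by (simp add: seqc_def ins_def insl_def fun_eq_iff)
  ultimately show ?case by simp
qed

lemma fold_double: "fold eff (replicate q (AddI 0 0 0)) m = m(0 := 2 ^ q * m 0)"
  by (induction q arbitrary: m) auto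

text \<open>Register 0 is the moving pointer and register 1 its increment 1. Since
  \<open>k < m 0\<close>, the copies lie above the registers that are still to be saved.\<close>

lemma fold_save:
  assumes "2 \<le> k" "k < m 0" "m 1 = 1"
  shows "fold eff (concat (map (\<lambda>r. [AddI 0 0 1, StoreInd 0 r]) [2..<k])) m
    = (\<lambda>a. if a = 0 then m 0 + (k - 2) else
        if m 0 + 1 \<le> a \<and> a < m 0 + (k - 1) then m (a - m 0 + 1) else m a)"
  using assms(1,2)
proof (induction k rule: dec_induct)
  case base
  then show ?case by (auto simp: fun_eq_iff)
next
  case (step k)
  then have IH: "fold eff (concat (map (\<lambda>r. [AddI 0 0 1, StoreInd 0 r]) [2..<k])) m
    = (\<lambda>a. if a = 0 then m 0 + (k - 2) else
        if m 0 + 1 \<le> a \<and> a < m 0 + (k - 1) then m (a - m 0 + 1) else m a)" by simp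
  have "fold eff (concat (map (\<lambda>r. [AddI 0 0 1, StoreInd 0 r]) [2..<Suc k])) m
    = eff (StoreInd 0 k) (eff (AddI 0 0 1)
        (fold eff (concat (map (\<lambda>r. [AddI 0 0 1, StoreInd 0 r]) [2..<k])) m))"
    using step.hyps by simp
  also have "\<dots> = (\<lambda>a. if a = 0 then m 0 + (Suc k - 2) else
        if m 0 + 1 \<le> a \<and> a < m 0 + (Suc k - 1) then m (a - m 0 + 1) else m a)"
  proof
    fix a
    show "eff (StoreInd 0 k) (eff (AddI 0 0 1)
        (fold eff (concat (map (\<lambda>r. [AddI 0 0 1, StoreInd 0 r]) [2..<k])) m)) a =
      (if a = 0 then m 0 + (Suc k - 2) else
        if m 0 + 1 \<le> a \<and> a < m 0 + (Suc k - 1) then m (a - m 0 + 1) else m a)"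
    proof -
      obtain q where q: "k = q + 2" using step.hyps by (metis add.commute le_Suc_ex)
      have l: "q + 3 < m 0" using step.prems q by simp
      have e: "m 0 + (Suc (q + 2) - 2) = m 0 + q + 1" "m 0 + (Suc (q + 2) - 1) = m 0 + q + 2"
        "m 0 + (q + 2 - 2) = m 0 + q" "m 0 + (q + 2 - 1) = m 0 + q + 1" by simp_all
      show ?thesis
        unfolding IH using assms(3) l unfolding q e by (auto simp del: One_nat_def)
    qed
  qed
  finally show ?case .
qed

lemma fold_pointers:
  assumes "1 \<le> k"
  shows "fold eff (concat (map (\<lambda>r. [LoadC r r, AddI r r 0]) [1..<k])) m
    = (\<lambda>a. if 1 \<le> a \<and> a < k then a + m 0 else m a)"
  using assms
proof (induction k rule: dec_induct)
  case base
  then show ?case by (auto simp: fun_eq_iff)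
next
  case (step k)
  then show ?case by (auto simp: fun_eq_iff)
qed

lemma fold_fetch:
  assumes "1 \<le> k" "\<And>r. 1 \<le> r \<Longrightarrow> r < k \<Longrightarrow> k \<le> m r"
  shows "fold eff (map (\<lambda>r. LoadInd r r) [1..<k]) m
    = (\<lambda>a. if 1 \<le> a \<and> a < k then m (m a) else m a)"
proof -
  have "fold eff (map (\<lambda>r. LoadInd r r) [1..<j]) m
    = (\<lambda>a. if 1 \<le> a \<and> a < j then m (m a) else m a)" if "1 \<le> j" "j \<le> k" for j
    using that
  proof (induction j rule: dec_induct)
    case base
    then show ?case by (auto simp: fun_eq_iff)
  next
    case (step j)
    then show ?case using assms(2)[of j] by (auto simp: fun_eq_iff)
  qed
  from this[OF assms(1) order_refl] show ?thesis .
qed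

lemma forl_store:
  assumes "\<And>k h'. k < n \<Longrightarrow> (\<forall>a. a < A \<or> A + n \<le> a \<longrightarrow> h' a = h a) \<Longrightarrow> F k h' = h'(A + k := w k)"
  shows "forl n F h = (\<lambda>a. if A \<le> a \<and> a < A + n then w (a - A) else h a)"
proof -
  have "forl j F h = (\<lambda>a. if A \<le> a \<and> a < A + j then w (a - A) else h a)"
    if "j \<le> n" for j using that
  proof (induction j)
    case 0
    then show ?case by (auto simp: fun_eq_iff)
  next
    case (Suc j)
    then have IH: "forl j F h = (\<lambda>a. if A \<le> a \<and> a < A + j then w (a - A) else h a)"
      by (intro Suc.IH) simp
    have "F j (\<lambda>a. if A \<le> a \<and> a < A + j then w (a - A) else h a)
       = (\<lambda>a. if A \<le> a \<and> a < A + j then w (a - A) else h a)(A + j := w j)"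
      by (rule assms) (use Suc.prems in auto)
    then show ?case unfolding forl.simps IH by auto
  qed
  then show ?thesis by simp
qed

lemma CCF_store:
  assumes "CF d A" "CF d V" "0 < d"
  shows "CCF d (\<lambda>e k h. h(A e h k := min (V e h k) (e 0)))"
  unfolding CCF_def
proof (intro conjI allI impI)
  fix x and e e' :: "nat \<Rightarrow> nat" and h assume *: "\<forall>i<d. e i = e' i"
  show "h(A e h x := min (V e h x) (e 0)) = h(A e' h x := min (V e' h x) (e' 0))"
    using CF_dep[OF assms(1), of e e' h x] CF_dep[OF assms(2), of e e' h x] * assms(3) by simp
next
  fix d' i assume "d \<le> i" "i < d'"
  then show "CC d' (\<lambda>e h. h(A e h (e i) := min (V e h (e i)) (e 0)))"
    by (intro CC_store CFD[OF assms(1)] CFD[OF assms(2)] CE_var) (use assms(3) in auto)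
qed

subsection \<open>Iterating a computable map on vectors\<close>

text \<open>Heap cell \<open>a\<close> is register \<open>e 2 + a\<close>, and position
  \<open>i\<close> of the word was originally in register \<open>i + 1\<close>. It is found in the
  saved copy if that register belongs to the scratch area, and in its original place
  otherwise.\<close>

definition raw :: "(nat \<Rightarrow> nat) \<Rightarrow> (nat \<Rightarrow> nat) \<Rightarrow> nat \<Rightarrow> nat" where
  "raw e h i = (if i + 1 < e 2 then h (e 1 + i - e 2) else h (i + 1 - e 2))"

text \<open>The input word: register 1 holds the address of the copy of the first registers, and
  register 2 the number \<open>R\<close> of registers. Words of length \<open>3 + 4 n\<close> carry \<open>n\<close> in position 2.\<close>
definition acc :: "(nat \<Rightarrow> nat) \<Rightarrow> (nat \<Rightarrow> nat) \<Rightarrow> nat \<Rightarrow> nat" where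
  "acc e h i = (if i < 3 + 4 * raw e h 2 then raw e h i else 0)"

lemma CF_raw: "3 \<le> d \<Longrightarrow> CF d raw"
  unfolding raw_def by (intro ce CE_heap CE_var) (auto intro: CE_lift)

lemma CF_acc: "3 \<le> d \<Longrightarrow> CF d acc"
  unfolding acc_def
  by (intro ce CFD[OF CF_raw order_refl]) (auto intro: CE_lift)

lemma CE_acc: "3 \<le> d \<Longrightarrow> CE d a \<Longrightarrow> CE d (\<lambda>e h. acc e h (a e h))"
  by (rule CFD[OF CF_acc order_refl])

lemma acc_cong:
  assumes "3 < e 2" "e 2 \<le> e 1" "3 + 4 * raw e h 2 \<le> e 1" "\<And>a. a < e 1 \<Longrightarrow> h' a = h a"
  shows "acc e h' = acc e h"
proof -
  have 1: "raw e h' i = raw e h i" if "i < e 1" for i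
    unfolding raw_def using assms(1,2) that by (auto intro!: assms(4))
  have 2: "raw e h' 2 = raw e h 2" by (rule 1) (use assms in auto)
  show ?thesis unfolding acc_def 2 using 1 assms(3) by (auto simp: fun_eq_iff)
qed

text \<open>Components from \<open>yl\<close> on are reset to 0, so that the state is determined by
  the \<open>yl\<close> cells that the machine stores.\<close>

primrec yseq :: "nat \<Rightarrow> (nat \<Rightarrow> (nat \<Rightarrow> nat) \<Rightarrow> nat \<Rightarrow> nat) \<Rightarrow> nat \<Rightarrow> nat \<Rightarrow> nat" where
  "yseq yl Phi 0 = (\<lambda>k. 0)"
| "yseq yl Phi (Suc t) = (\<lambda>k. if k < yl then Phi t (yseq yl Phi t) k else 0)"

lemma yseq_0: "yl \<le> k \<Longrightarrow> yseq yl Phi t k = 0"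
  by (cases t) auto

text \<open>\<open>lim\<close> is the truncation limit, \<open>N\<close> the number of rounds,
  \<open>yl\<close> the length of the vector and \<open>Phi\<close> the update in a given round.
  \<open>Out\<close> describes a memory image: component 0 is the length of the output, and the
  output words follow.\<close>

locale vector_iteration =
  fixes lim N yl :: "(nat \<Rightarrow> nat) \<Rightarrow> nat"
    and Phi :: "(nat \<Rightarrow> nat) \<Rightarrow> nat \<Rightarrow> (nat \<Rightarrow> nat) \<Rightarrow> nat \<Rightarrow> nat"
    and Out :: "(nat \<Rightarrow> nat) \<Rightarrow> (nat \<Rightarrow> nat) \<Rightarrow> nat \<Rightarrow> nat"
  assumes CE_lim: "\<And>d I. CF d I \<Longrightarrow> CE d (\<lambda>e h. lim (I e h))"
    and CE_N: "\<And>d I. CF d I \<Longrightarrow> CE d (\<lambda>e h. N (I e h))"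
    and CE_yl: "\<And>d I. CF d I \<Longrightarrow> CE d (\<lambda>e h. yl (I e h))"
    and CE_Phi: "\<And>d I t Y k. CF d I \<Longrightarrow> CE d t \<Longrightarrow> CF d Y \<Longrightarrow> CE d k \<Longrightarrow>
      CE d (\<lambda>e h. Phi (I e h) (t e h) (Y e h) (k e h))"
    and CE_Out: "\<And>d I Y k. CF d I \<Longrightarrow> CF d Y \<Longrightarrow> CE d k \<Longrightarrow>
      CE d (\<lambda>e h. Out (I e h) (Y e h) (k e h))"
begin

definition yacc :: "(nat \<Rightarrow> nat) \<Rightarrow> (nat \<Rightarrow> nat) \<Rightarrow> nat \<Rightarrow> nat" where
  "yacc e h k = (if k < yl (acc e h) then h (e 1 + k) else 0)"

text \<open>The new vector goes to a second buffer, because \<open>Phi\<close> may read any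
  component of the old one while the new one is being computed; \<open>copy\<close> then moves it
  back.\<close>

definition calc :: "(nat \<Rightarrow> nat) \<Rightarrow> nat \<Rightarrow> (nat \<Rightarrow> nat) \<Rightarrow> nat \<Rightarrow> nat" where
  "calc e t h = forl (yl (acc e h)) (\<lambda>k h. h(e 1 + yl (acc e h) + k :=
     min (Phi (acc e h) t (yacc e h) k) (e 0))) h"

definition copy :: "(nat \<Rightarrow> nat) \<Rightarrow> (nat \<Rightarrow> nat) \<Rightarrow> nat \<Rightarrow> nat" where
  "copy e h = forl (yl (acc e h)) (\<lambda>k h. h(e 1 + k := min (h (e 1 + yl (acc e h) + k)) (e 0))) h"

definition iter :: "(nat \<Rightarrow> nat) \<Rightarrow> (nat \<Rightarrow> nat) \<Rightarrow> nat \<Rightarrow> nat" where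
  "iter e h = forl (N (acc e h)) (\<lambda>t h. copy e (calc e t h)) h"

text \<open>The output is first assembled at \<open>e 1 + e 0\<close>, an address available from the
  registers, because \<open>Out\<close> still reads the input and the vector, which its final place
  would overwrite.\<close>

definition outc :: "(nat \<Rightarrow> nat) \<Rightarrow> (nat \<Rightarrow> nat) \<Rightarrow> nat \<Rightarrow> nat" where
  "outc e h = forl (Suc (Out (acc e h) (yacc e h) 0)) (\<lambda>k h. h(e 1 + e 0 + k :=
     min (Out (acc e h) (yacc e h) k) (e 0))) h"

definition fin :: "(nat \<Rightarrow> nat) \<Rightarrow> (nat \<Rightarrow> nat) \<Rightarrow> nat \<Rightarrow> nat" where
  "fin e h = forl (Suc (h (e 1 + e 0)) - e 2)
     (\<lambda>k h. h(k := min (h (e 1 + e 0 + e 2 + k)) (e 0))) h"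

definition cmd :: "(nat \<Rightarrow> nat) \<Rightarrow> (nat \<Rightarrow> nat) \<Rightarrow> nat \<Rightarrow> nat" where
  "cmd e h = fin e (outc e (iter e h))"

lemma CF_yacc: "3 \<le> d \<Longrightarrow> CF d yacc"
  unfolding yacc_def
  by (intro ce CE_heap CE_var CE_yl CE_acc) (auto intro: CE_lift)

lemma CE_yacc: "3 \<le> d \<Longrightarrow> CE d a \<Longrightarrow> CE d (\<lambda>e h. yacc e h (a e h))"
  by (rule CFD[OF CF_yacc order_refl])

lemma CC_calc:
  assumes "3 \<le> d" "i < d"
  shows "CC d (\<lambda>e. calc e (e i))"
  unfolding calc_def
  by (intro CC_for CCF_store ce CE_var CE_yl CE_acc CE_Phi CE_yacc) (use assms in auto)

lemma CC_copy: "3 \<le> d \<Longrightarrow> CC d copy"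
  unfolding copy_def
  by (intro CC_for CCF_store ce CE_heap CE_var CE_yl CE_acc) auto

lemma CC_iter: "CC 3 iter"
  unfolding iter_def
proof (rule CC_for)
  show "CE 3 (\<lambda>e h. N (acc e h))" by (intro CE_N CF_acc) simp
  show "CCF 3 (\<lambda>e t h. copy e (calc e t h))"
    unfolding CCF_def
  proof (intro conjI allI impI)
    fix x and e e' :: "nat \<Rightarrow> nat" and h :: "nat \<Rightarrow> nat" assume "\<forall>i<3. e i = e' i"
    then have *: "e 0 = e' 0" "e 1 = e' 1" "e 2 = e' 2" by simp_all
    then have a: "acc e = acc e'" by (intro ext) (simp add: acc_def raw_def)
    then have "yacc e = yacc e'" using * by (intro ext) (simp add: yacc_def)
    then show "copy e (calc e x h) = copy e' (calc e' x h)"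
      using * a by (simp add: copy_def calc_def)
  next
    fix d' i :: nat assume "3 \<le> i" "i < d'"
    then show "CC d' (\<lambda>e h. copy e (calc e (e i) h))"
      using CC_seq[OF CC_calc[of d' i] CC_copy[of d']] by simp
  qed
qed simp

lemma CC_outc: "CC 3 outc"
  unfolding outc_def
  by (intro CC_for CCF_store ce CE_heap CE_var CE_Out CE_acc CE_yacc) auto

lemma CC_fin: "CC 3 fin"
  unfolding fin_def
  by (intro CC_for CCF_store ce CE_heap CE_var) auto

lemma CC_cmd: "CC 3 cmd"
  unfolding cmd_def using CC_seq[OF CC_seq[OF CC_iter CC_outc] CC_fin] .

text \<open>Heap layout: input below \<open>e 1\<close>, current vector from \<open>e 1\<close>,
  next vector from \<open>e 1 + yl I\<close>, output image from \<open>e 1 + e 0\<close>. The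
  condition \<open>2 * yl I \<le> lim I\<close> keeps the image clear of both vectors, and the
  bounds on \<open>Phi\<close> and \<open>Out\<close> make truncation invisible. There are two
  conclusions because the first \<open>e 2\<close> output words belong in registers outside the heap
  and have to stay in the image for the time being.\<close>

lemma cmd_correct:
  fixes e h I
  defines "Y \<equiv> yseq (yl I) (Phi I) (N I)"
  assumes I: "acc e h = I" and e: "e 0 = lim I" "3 < e 2" "e 2 \<le> e 1" "3 + 4 * I 2 \<le> e 1"
    and h0: "\<And>k. k < yl I \<Longrightarrow> h (e 1 + k) = 0"
    and y: "2 * yl I \<le> lim I"
      "\<And>t k. t < N I \<Longrightarrow> k < yl I \<Longrightarrow> Phi I t (yseq (yl I) (Phi I) t) k \<le> lim I"
    and out: "\<And>k. k \<le> Out I Y 0 \<Longrightarrow> Out I Y k \<le> lim I"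
  shows "k < e 2 \<Longrightarrow> k \<le> Out I Y 0 \<Longrightarrow> cmd e h (e 1 + e 0 + k) = Out I Y k"
    and "e 2 + x \<le> Out I Y 0 \<Longrightarrow> cmd e h x = Out I Y (e 2 + x)"
proof -
  have r2: "raw e h 2 = I 2" using I by (auto simp: acc_def)
  have accI: "acc e h' = I" if "\<forall>a<e 1. h' a = h a" for h'
    unfolding I[symmetric] by (rule acc_cong) (use e r2 that in auto)
  define J where "J t h' \<longleftrightarrow> (\<forall>a<e 1. h' a = h a) \<and> (\<forall>k<yl I. h' (e 1 + k) = yseq (yl I) (Phi I) t k)"
    for t h'
  have yaccJ: "yacc e h' = yseq (yl I) (Phi I) t" if "J t h'" for t h'
  proof -
    have "acc e h' = I" by (rule accI) (use that in \<open>simp add: J_def\<close>)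
    then show ?thesis using that by (intro ext) (simp add: J_def yacc_def yseq_0)
  qed
  have step: "J (Suc t) (copy e (calc e t h'))" if J: "J t h'" and t: "t < N I" for t h'
  proof -
    let ?w = "Phi I t (yseq (yl I) (Phi I) t)"
    have a: "acc e h' = I" using J accI by (simp add: J_def)
    have c: "calc e t h' = (\<lambda>a. if e 1 + yl I \<le> a \<and> a < e 1 + yl I + yl I
        then ?w (a - (e 1 + yl I)) else h' a)"
      unfolding calc_def a
    proof (rule forl_store)
      fix k h'' assume k: "k < yl I" and h'': "\<forall>a. a < e 1 + yl I \<or> e 1 + yl I + yl I \<le> a \<longrightarrow> h'' a = h' a"
      have J': "J t h''" using J h'' by (auto simp: J_def)
      have a': "acc e h'' = I" using J' accI by (simp add: J_def)
      show "h''(e 1 + yl (acc e h'') + k := min (Phi (acc e h'') t (yacc e h'') k) (e 0))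
        = h''(e 1 + yl I + k := ?w k)"
        using y(2)[OF t k] unfolding a' yaccJ[OF J'] e(1) by (simp add: min_absorb1)
    qed
    have a2: "acc e (calc e t h') = I" by (rule accI) (use J in \<open>auto simp: c J_def\<close>)
    have "copy e (calc e t h') = (\<lambda>a. if e 1 \<le> a \<and> a < e 1 + yl I
        then ?w (a - e 1) else calc e t h' a)"
      unfolding copy_def a2
    proof (rule forl_store)
      fix k h'' assume k: "k < yl I" and h'': "\<forall>a. a < e 1 \<or> e 1 + yl I \<le> a \<longrightarrow> h'' a = calc e t h' a"
      have a': "acc e h'' = I" by (rule accI) (use J h'' in \<open>auto simp: c J_def\<close>)
      have "h'' (e 1 + yl I + k) = ?w k" using h'' k by (simp add: c)
      then show "h''(e 1 + k := min (h'' (e 1 + yl (acc e h'') + k)) (e 0)) = h''(e 1 + k := ?w k)"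
        using y(2)[OF t k] unfolding a' e(1) by (simp add: min_absorb1)
    qed
    then show ?thesis using J by (auto simp: J_def c)
  qed
  have "J t (forl t (\<lambda>t h. copy e (calc e t h)) h)" if "t \<le> N I" for t
    using that by (induction t) (use h0 step in \<open>auto simp: J_def\<close>)
  then have J: "J (N I) (iter e h)" unfolding iter_def I by simp
  define h1 where "h1 = iter e h"
  have a1: "acc e h1 = I" using J accI by (simp add: J_def h1_def)
  have y1: "yacc e h1 = Y" using yaccJ[OF J] by (simp add: Y_def h1_def)
  have o: "outc e h1 = (\<lambda>a. if e 1 + e 0 \<le> a \<and> a < e 1 + e 0 + Suc (Out I Y 0)
      then Out I Y (a - (e 1 + e 0)) else h1 a)"
    unfolding outc_def a1 y1
  proof (rule forl_store)
    fix k h' assume k: "k < Suc (Out I Y 0)"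
      and h': "\<forall>a. a < e 1 + e 0 \<or> e 1 + e 0 + Suc (Out I Y 0) \<le> a \<longrightarrow> h' a = h1 a"
    have J': "J (N I) h'" using J h' y(1) e(1) by (auto simp: J_def h1_def)
    have a': "acc e h' = I" using J' accI by (simp add: J_def)
    have y': "yacc e h' = Y" using yaccJ[OF J'] by (simp add: Y_def)
    show "h'(e 1 + e 0 + k := min (Out (acc e h') (yacc e h') k) (e 0)) = h'(e 1 + e 0 + k := Out I Y k)"
      using out[of k] k unfolding a' y' e(1) by (simp add: min_absorb1)
  qed
  define h2 where "h2 = outc e h1"
  have h20: "h2 (e 1 + e 0) = Out I Y 0" by (simp add: h2_def o)
  have l: "Out I Y 0 \<le> e 0" using out[of 0] e(1) by simp
  have f: "fin e h2 = (\<lambda>a. if 0 \<le> a \<and> a < 0 + (Suc (Out I Y 0) - e 2)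
      then Out I Y (e 2 + (a - 0)) else h2 a)"
    unfolding fin_def h20
  proof (rule forl_store)
    fix k h' assume k: "k < Suc (Out I Y 0) - e 2"
      and h': "\<forall>a. a < 0 \<or> 0 + (Suc (Out I Y 0) - e 2) \<le> a \<longrightarrow> h' a = h2 a"
    \<comment> \<open>Moving is safe in increasing order: all targets lie below \<open>e 0\<close>,
      all sources at or above \<open>e 1 + e 0 + e 2\<close>.\<close>
    have "h' (e 1 + e 0 + e 2 + k) = h2 (e 1 + e 0 + e 2 + k)"
      using h' l e(2) by (intro h'[rule_format]) linarith
    also have "\<dots> = Out I Y (e 2 + k)"
    proof -
      have "e 2 + k < Suc (Out I Y 0)" using k by linarith
      then show ?thesis by (simp add: h2_def o)
    qed
    finally show "h'(k := min (h' (e 1 + e 0 + e 2 + k)) (e 0)) = h'(0 + k := Out I Y (e 2 + k))"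
      using out[of "e 2 + k"] k e(1) by (simp add: min_absorb1)
  qed
  have c: "cmd e h = fin e h2" by (simp add: cmd_def h1_def h2_def)
  show "cmd e h (e 1 + e 0 + k) = Out I Y k" if "k < e 2" "k \<le> Out I Y 0"
    using that l e(2,3) unfolding c f by (auto simp: h2_def o)
  show "cmd e h x = Out I Y (e 2 + x)" if "e 2 + x \<le> Out I Y 0"
    using that unfolding c f by auto
qed

section \<open>Converting between the machine's input and output format and the heap\<close>

definition prologue :: "nat \<Rightarrow> instr list" where
  "prologue R = replicate R (AddI 0 0 0) @ [StoreInd 0 1, LoadC 1 1] @
     concat (map (\<lambda>r. [AddI 0 0 1, StoreInd 0 r]) [2..<R]) @
     [LoadC 2 (R - 2), SubI 1 0 2, LoadC 2 R]"

definition epilogue :: "nat \<Rightarrow> instr list" where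
  "epilogue R = [AddI 0 0 1, AddI 0 0 2] @
     concat (map (\<lambda>r. [LoadC r r, AddI r r 0]) [1..<R]) @
     map (\<lambda>r. LoadInd r r) [1..<R] @ [LoadInd 0 0]"

text \<open>Doubling the input length \<open>R\<close> times yields an address \<open>b\<close>
  beyond the scratch registers and the input. Registers 1 to \<open>R - 1\<close> are copied there.
  The length in register 0 is lost, but \<open>acc\<close> recovers it from the number of robots in
  the word.\<close>

lemma prologue_effect:
  assumes R: "4 \<le> R" and b: "b = 2 ^ R * m 0" "R < b"
  shows "fold eff (prologue R) m 1 = b" "fold eff (prologue R) m 2 = R"
    "fold eff (prologue R) m 0 = b + (R - 2)"
    "i < R - 1 \<Longrightarrow> fold eff (prologue R) m (b + i) = m (i + 1)"
    "R \<le> a \<Longrightarrow> a < b \<or> b + (R - 1) \<le> a \<Longrightarrow> fold eff (prologue R) m a = m a"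
proof -
  let ?m1 = "m(0 := b)"
  let ?m2 = "(?m1(b := m 1))(1 := 1)"
  let ?m3 = "\<lambda>a. if a = 0 then ?m2 0 + (R - 2) else
        if ?m2 0 + 1 \<le> a \<and> a < ?m2 0 + (R - 1) then ?m2 (a - ?m2 0 + 1) else ?m2 a"
  have m3: "fold eff (concat (map (\<lambda>r. [AddI 0 0 1, StoreInd 0 r]) [2..<R])) ?m2 = ?m3"
    by (rule fold_save) (use R b in auto)
  have "fold eff (prologue R) m = ((?m3(2 := R - 2))(1 := ?m3 0 - (R - 2)))(2 := R)"
    unfolding prologue_def fold_append comp_apply fold_double b(1)[symmetric]
    using m3 by (simp del: One_nat_def)
  then have *: "fold eff (prologue R) m =
    (\<lambda>a. if a = 2 then R else if a = 1 then b else ?m3 a)" using b R by (auto simp: fun_eq_iff)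
  show "fold eff (prologue R) m 1 = b" "fold eff (prologue R) m 2 = R"
    "fold eff (prologue R) m 0 = b + (R - 2)"
    unfolding * using b R by auto
  show "fold eff (prologue R) m (b + i) = m (i + 1)" if "i < R - 1"
    unfolding * using that b R by auto
  show "fold eff (prologue R) m a = m a" if "R \<le> a" "a < b \<or> b + (R - 1) \<le> a"
    unfolding * using that b R by auto
qed

text \<open>Each register is turned into a pointer to its own output word and then loaded through
  itself, so no scratch register is required. Register 0 holds the base of the pointers and is
  therefore overwritten last.\<close>

lemma epilogue_effect:
  assumes R: "3 \<le> R" and p: "p = m 0 + m 1 + m 2" "R \<le> p"
  shows "fold eff (epilogue R) m = (\<lambda>a. if a < R then m (p + a) else m a)"
proof -
  let ?m1 = "m(0 := p)"
  let ?m2 = "\<lambda>a. if 1 \<le> a \<and> a < R then a + ?m1 0 else ?m1 a"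
  let ?m3 = "\<lambda>a. if 1 \<le> a \<and> a < R then ?m2 (?m2 a) else ?m2 a"
  have m2: "fold eff (concat (map (\<lambda>r. [LoadC r r, AddI r r 0]) [1..<R])) ?m1 = ?m2"
    by (rule fold_pointers) (use R in simp)
  have m3: "fold eff (map (\<lambda>r. LoadInd r r) [1..<R]) ?m2 = ?m3"
    by (rule fold_fetch) (use R p in auto)
  have "fold eff [AddI 0 0 1, AddI 0 0 2] m = ?m1" using p by (auto simp: fun_eq_iff)
  then have "fold eff (epilogue R) m = ?m3(0 := ?m3 (?m3 0))"
    unfolding epilogue_def fold_append comp_apply
    using m2 m3 by (simp del: One_nat_def upt_Suc)
  also have "\<dots> = (\<lambda>a. if a < R then m (p + a) else m a)"
    using p R by (auto simp: fun_eq_iff add.commute)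
  finally show ?thesis .
qed

lemma straight_prologue: "i \<in> set (prologue R) \<Longrightarrow> straight i"
  and straight_epilogue: "i \<in> set (epilogue R) \<Longrightarrow> straight i"
  by (auto simp: prologue_def epilogue_def split: if_splits)

text \<open>One program and one polynomial serve all inputs. The program computes the limit itself,
  so the bound \<open>T1\<close> on that evaluation also bounds the value of the limit and hence
  everything stored later.\<close>

theorem program_exists:
  "\<exists>prog P. pb P \<and> (\<forall>xs B. length xs = 3 + 4 * xs ! 2 \<longrightarrow> length xs \<le> B \<longrightarrow> (\<forall>x\<in>set xs. x \<le> B) \<longrightarrow>
     (let I = (\<lambda>i. if i < length xs then xs ! i else 0); Y = yseq (yl I) (Phi I) (N I) in
       2 * yl I \<le> lim I \<longrightarrow>
       (\<forall>t<N I. \<forall>k<yl I. Phi I t (yseq (yl I) (Phi I) t) k \<le> lim I) \<longrightarrow>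
       (\<forall>k\<le>Out I Y 0. Out I Y k \<le> lim I) \<longrightarrow>
       (\<exists>t\<le>P B. ram_computes_within prog xs t (map (\<lambda>i. Out I Y (Suc i)) [0..<Out I Y 0]))))"
proof -
  have CEl: "CE 3 (\<lambda>e h. lim (acc e h))" by (intro CE_lim CF_acc) simp
  obtain K1 T1 where 1: "pb T1" "3 < K1"
    "\<And>R. K1 \<le> R \<Longrightarrow> \<exists>cd. evaluates 3 R T1 cd (\<lambda>e h. lim (acc e h))"
    by (rule CE_E[OF CEl order_refl]) blast
  obtain K2 T2 where 2: "pb T2" "3 < K2" "\<And>R. K2 \<le> R \<Longrightarrow> \<exists>cd. executes 3 R T2 cd cmd"
    by (rule CC_E[OF CC_cmd order_refl]) blast
  define R where "R = K1 + K2"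
  obtain c1 where c1: "evaluates 3 R T1 c1 (\<lambda>e h. lim (acc e h))" using 1(3)[of R] R_def by auto
  obtain c2 where c2: "executes 3 R T2 c2 cmd" using 2(3)[of R] R_def by auto
  have R: "4 \<le> R" using 1(2) R_def by simp
  \<comment> \<open>\<open>c1\<close> delivers the limit in register 3, directly behind the three
    environment registers; the next two instructions move it to register 0.\<close>
  let ?code = "insl (prologue R) ;; c1 ;; insl [LoadC 0 0, AddI 0 0 3] ;; c2 ;; insl (epilogue R)"
  define prog where "prog = ?code 0"
  let ?B = "\<lambda>B. 2 ^ R * B + B + R"
  let ?B2 = "\<lambda>B. ?B B + T1 (?B B)"
  let ?P = "\<lambda>B. length (prologue R) + T1 (?B B) + 2 + T2 (?B2 B) + length (epilogue R)"
  show ?thesis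
  proof (intro exI[of _ prog] exI[of _ ?P] conjI allI impI)
    have pB: "pb ?B" by (intro pb_add pb_mult pb_const pb_id)
    show "pb ?P"
      by (intro pb_add pb_const pb_comp[OF 1(1) pB]
          pb_comp[OF 2(1) pb_add[OF pB pb_comp[OF 1(1) pB]]])
  next
    fix xs :: "nat list" and B
    assume xs: "length xs = 3 + 4 * xs ! 2" "length xs \<le> B" "\<forall>x\<in>set xs. x \<le> B"
    define I where "I = (\<lambda>i. if i < length xs then xs ! i else 0)"
    define Y where "Y = yseq (yl I) (Phi I) (N I)"
    let ?goal = "\<exists>t\<le>?P B. ram_computes_within prog xs t (map (\<lambda>i. Out I Y (Suc i)) [0..<Out I Y 0])"
    have ?goal if y: "2 * yl I \<le> lim I"
      "\<forall>t<N I. \<forall>k<yl I. Phi I t (yseq (yl I) (Phi I) t) k \<le> lim I"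
      and out: "\<forall>k\<le>Out I Y 0. Out I Y k \<le> lim I"
    proof -
      define m where "m = snd (ram_init xs)"
      define b where "b = 2 ^ R * m 0"
      have m0: "m 0 = length xs" by (simp add: m_def ram_init_def)
      have mS: "m (Suc i) = I i" for i by (simp add: m_def ram_init_def I_def)
      have mB: "m a \<le> B" for a
        using xs(2,3) by (cases a) (auto simp: m0 mS I_def)
      have R2: "R < 2 ^ R" by simp
      then have "R * 3 < 2 ^ R * m 0"
        using mult_less_le_imp_less[of R "2 ^ R" 3 "m 0"] xs(1) m0 by simp
      then have bR: "R < b" by (simp add: b_def)
      have "2 * m 0 \<le> b" unfolding b_def
        by (rule mult_right_mono) (use R power_increasing[of 1 R "2 :: nat"] in auto)
      then have bl: "length xs < b" using xs(1) m0 by simp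
      define m4 where "m4 = fold eff (prologue R) m"
      note pe = prologue_effect[where m = m and b = b and R = R, OF R b_def bR, folded m4_def]
      have r1: "runs (insl (prologue R)) m (length (prologue R)) m4"
        unfolding m4_def by (rule runs_insl) (rule straight_prologue)
      have bB: "b \<le> 2 ^ R * B" unfolding b_def m0 using xs(2) by simp
      have i4: "\<forall>i<3. m4 i \<le> ?B B"
      proof (intro allI impI)
        fix i :: nat assume "i < 3"
        then consider "i = 0" | "i = 1" | "i = 2" by linarith
        then show "m4 i \<le> ?B B" using pe(1-3) bB by cases auto
      qed
      have h4: "\<forall>a. m4 (R + a) \<le> ?B B"
      proof
        fix a
        have "m4 (R + a) \<le> B"
        proof (cases "R + a < b \<or> b + (R - 1) \<le> R + a")
          case True
          then show ?thesis using pe(5)[of "R + a"] mB by simp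
        next
          case False
          then have "R + a = b + (R + a - b)" "R + a - b < R - 1" by auto
          then show ?thesis using pe(4)[of "R + a - b"] mB by metis
        qed
        then show "m4 (R + a) \<le> ?B B" by simp
      qed
      define h where "h = (\<lambda>a. m4 (R + a))"
      have raw: "raw m4 h i = I i" if "i < length xs" for i
      proof (cases "i + 1 < R")
        case True
        then have "raw m4 h i = m4 (b + i)"
          using bR by (simp add: raw_def pe(1,2)[simplified] h_def)
        also have "\<dots> = I i" using pe(4)[of i] True by (simp add: mS)
        finally show ?thesis .
      next
        case False
        then have "raw m4 h i = m4 (i + 1)"
          by (simp add: raw_def pe(1,2)[simplified] h_def)
        also have "\<dots> = I i" using pe(5)[of "i + 1"] False that bl by (simp add: mS)
        finally show ?thesis .
      qed
      have I2: "3 + 4 * I 2 = length xs" using xs(1) by (simp add: I_def)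
      have raw2: "raw m4 h 2 = I 2" by (rule raw) (use xs(1) in simp)
      have acc4: "acc m4 h = I"
        unfolding acc_def raw2 I2 using raw by (auto simp: I_def)
      obtain t1 m5 where m5: "lim (acc m4 h) \<le> T1 (?B B)" "t1 \<le> T1 (?B B)" "runs c1 m4 t1 m5"
        "m5 3 = lim (acc m4 h)" "\<forall>i<3. m5 i = m4 i" "\<forall>a. m5 (R + a) = m4 (R + a)"
        using evaluatesE[OF c1 i4 h4] unfolding h_def by blast
      define m6 where "m6 = m5(0 := lim I)"
      have "runs (insl [LoadC 0 0, AddI 0 0 3]) m5 (length [LoadC 0 0, AddI 0 0 3])
          (fold eff [LoadC 0 0, AddI 0 0 3] m5)"
        by (rule runs_insl) auto
      then have r2: "runs (insl [LoadC 0 0, AddI 0 0 3]) m5 2 m6"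
        using m5(4) acc4 by (simp add: m6_def numeral_2_eq_2)
      have e6: "m6 0 = lim I" "m6 1 = b" "m6 2 = R" using m5(5) pe(1,2) by (auto simp: m6_def)
      have h6: "(\<lambda>a. m6 (R + a)) = h" using m5(6) R by (auto simp: m6_def h_def)
      have "\<forall>i<3. m6 i \<le> ?B2 B"
        using i4 m5(1,5) acc4 by (auto simp: m6_def trans_le_add1 trans_le_add2)
      moreover have "\<forall>a. m6 (R + a) \<le> ?B2 B"
        using h4 h6 by (auto simp: fun_eq_iff h_def trans_le_add1)
      ultimately obtain t2 m7 where m7: "t2 \<le> T2 (?B2 B)" "runs c2 m6 t2 m7" "\<forall>i<3. m7 i = m6 i"
        "(\<lambda>a. m7 (R + a)) = cmd m6 h"
        using executesE[OF c2] unfolding h6[symmetric] by blast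
      define m8 where "m8 = fold eff (epilogue R) m7"
      have r3: "runs (insl (epilogue R)) m7 (length (epilogue R)) m8"
        unfolding m8_def by (rule runs_insl) (rule straight_epilogue)
      have m8: "m8 = (\<lambda>a. if a < R then m7 (lim I + b + R + a) else m7 a)"
        unfolding m8_def
        by (rule epilogue_effect) (use R m7(3) e6 in auto)
      have acc6: "acc m6 h = I"
      proof -
        have "raw m6 h i = raw m4 h i" for i unfolding raw_def e6 pe(1,2) ..
        then have "acc m6 h = acc m4 h" by (simp add: acc_def fun_eq_iff)
        then show ?thesis using acc4 by simp
      qed
      \<comment> \<open>The saved registers end at address \<open>b + R - 2\<close> and the input
        ends before \<open>b\<close>, so the vector starts in cells that are still 0, the initial
        value of \<open>yseq\<close>.\<close>
      have h0: "h (b + k) = 0" for k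
      proof -
        have "h (b + k) = m (Suc (b + k + R - 1))"
          using pe(5)[of "R + (b + k)"] R by (simp add: h_def add.commute add.left_commute)
        then show ?thesis unfolding mS I_def using bl R by simp
      qed
      note cc = cmd_correct[of m6 h I, folded Y_def, unfolded e6, OF acc6 refl]
      have out1: "m8 k = Out I Y k" if k: "k \<le> Out I Y 0" for k
      proof (cases "k < R")
        case True
        have "m8 k = cmd m6 h (b + lim I + k)"
          using True fun_cong[OF m7(4), of "b + lim I + k"]
          by (simp add: m8 add.commute add.left_commute)
        also have "\<dots> = Out I Y k"
          by (rule cc(1)) (use R bR bl I2 h0 y out True k in auto)
        finally show ?thesis .
      next
        case False
        have "m8 k = cmd m6 h (k - R)"
          using False fun_cong[OF m7(4), of "k - R"] by (simp add: m8)
        also have "\<dots> = Out I Y (R + (k - R))"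
          by (rule cc(2)) (use R bR bl I2 h0 y out False k in auto)
        finally show ?thesis using False by simp
      qed
      have r: "runs ?code m (length (prologue R) + (t1 + (2 + (t2 + length (epilogue R))))) m8"
        by (intro runs_seq[OF r1] runs_seq[OF m5(3)] runs_seq[OF r2] runs_seq[OF m7(2)] r3)
      let ?t = "length (prologue R) + (t1 + (2 + (t2 + length (epilogue R))))"
      have "ram_run prog ?t (0, m) = (length prog, m8)"
        using r[unfolded runs_def, rule_format, of "[]" "[]"] by (simp add: prog_def)
      moreover have "ram_init xs = (0, m)" by (simp add: m_def ram_init_def)
      ultimately have run: "ram_run prog ?t (ram_init xs) = (length prog, m8)" by simp
      have "ram_output m8 = map (\<lambda>i. Out I Y (Suc i)) [0..<Out I Y 0]"
        unfolding ram_output_def using out1 by auto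
      then have "ram_computes_within prog xs ?t (map (\<lambda>i. Out I Y (Suc i)) [0..<Out I Y 0])"
        unfolding ram_computes_within_def run by (simp add: ram_halted_def)
      moreover have "?t \<le> ?P B" using m5(2) m7(1) by simp
      ultimately show ?goal by blast
    qed
    then show "let I = (\<lambda>i. if i < length xs then xs ! i else 0); Y = yseq (yl I) (Phi I) (N I) in
       2 * yl I \<le> lim I \<longrightarrow>
       (\<forall>t<N I. \<forall>k<yl I. Phi I t (yseq (yl I) (Phi I) t) k \<le> lim I) \<longrightarrow>
       (\<forall>k\<le>Out I Y 0. Out I Y k \<le> lim I) \<longrightarrow>
       (\<exists>t\<le>?P B. ram_computes_within prog xs t (map (\<lambda>i. Out I Y (Suc i)) [0..<Out I Y 0]))"
      unfolding Let_def I_def[symmetric] Y_def[symmetric] by blast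
  qed
qed

end

section \<open>Bounded search and counting\<close>

text \<open>The \<open>y\<close> such that no witness is at most \<open>y\<close> are exactly those
  below the least witness. Without a witness below \<open>b\<close> the value is \<open>b\<close>,
  which serves as a default.\<close>

definition bleast :: "nat \<Rightarrow> (nat \<Rightarrow> bool) \<Rightarrow> nat" where
  "bleast b P = (\<Sum>y<b. of_bool (\<forall>x<Suc y. \<not> P x))"

definition cnt :: "(nat \<Rightarrow> bool) \<Rightarrow> nat \<Rightarrow> nat" where
  "cnt P b = (\<Sum>x<b. of_bool (P x))"

text \<open>The maximum as the number of levels exceeded by some value; the total sum is a
  convenient range that contains all these levels.\<close>

definition bmax :: "nat \<Rightarrow> (nat \<Rightarrow> nat) \<Rightarrow> nat" where
  "bmax b f = (\<Sum>y<(\<Sum>x<b. f x). of_bool (\<exists>x<b. y < f x))"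

lemma CE_bleast [ce]: "CE d b \<Longrightarrow> CPF d P \<Longrightarrow> CE d (\<lambda>e h. bleast (b e h) (P e h))"
  unfolding bleast_def
  by (rule CE_sum, assumption, rule CFI, rule CP_CE, rule CP_all, rule CE_Suc, assumption,
      rule CPFI, rule CP_not, rule CPFD, assumption) (auto intro: order_trans)

lemma CE_cnt [ce]: "CPF d P \<Longrightarrow> CE d b \<Longrightarrow> CE d (\<lambda>e h. cnt (P e h) (b e h))"
  unfolding cnt_def by (intro CE_sum CPF_CF)

lemma CE_bmax [ce]: "CE d b \<Longrightarrow> CF d f \<Longrightarrow> CE d (\<lambda>e h. bmax (b e h) (f e h))"
  unfolding bmax_def
  by (rule CE_sum, rule CE_sum, assumption, assumption, rule CFI, rule CP_CE, rule CP_ex,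
      erule CE_lift, assumption, rule CPFI, rule CP_less, erule CE_lift, assumption,
      rule CFD, assumption) (auto intro: order_trans)

lemma cnt_card: "cnt P b = card {x. x < b \<and> P x}"
  unfolding cnt_def by (simp add: of_bool_def sum.If_cases Int_def lessThan_def)

lemma bleast_cases: "bleast b P = (if \<exists>x<b. P x then LEAST x. P x else b)"
proof -
  have "bleast b P = card {y. y < b \<and> (\<forall>x<Suc y. \<not> P x)}"
    using cnt_card[of "\<lambda>y. \<forall>x<Suc y. \<not> P x" b] by (simp only: bleast_def cnt_def)
  also have "{y. y < b \<and> (\<forall>x<Suc y. \<not> P x)} = {..<if \<exists>x<b. P x then LEAST x. P x else b}"
  proof (cases "\<exists>x<b. P x")
    case True
    then obtain x where x: "x < b" "P x" by blast
    have le: "(LEAST x. P x) < b" using Least_le[of P x] x by simp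
    have lt: "(\<forall>x<Suc y. \<not> P x) \<longleftrightarrow> y < (LEAST x. P x)" for y
      by (metis LeastI Suc_leI le_less_trans less_Suc_eq_le not_less_Least not_less x(2))
    have "{y. y < b \<and> (\<forall>x<Suc y. \<not> P x)} = {y. y < b \<and> y < (LEAST x. P x)}"
      by (simp only: lt)
    also have "\<dots> = {..<LEAST x. P x}" using le by auto
    finally have "{y. y < b \<and> (\<forall>x<Suc y. \<not> P x)} = {..<LEAST x. P x}" .
    then show ?thesis using True by simp
  qed auto
  finally show ?thesis by simp
qed

lemma bleast_le: "bleast b P \<le> b"
  using Least_le[of P] by (fastforce simp: bleast_cases intro: order_trans less_imp_le)

lemma bleastI: "bleast b P < b \<Longrightarrow> P (bleast b P)"
  by (auto simp: bleast_cases intro: LeastI split: if_splits)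

lemma bleast_ex: "x < b \<Longrightarrow> P x \<Longrightarrow> bleast b P < b"
  using Least_le[of P x] by (auto simp: bleast_cases)

lemma bmax_ge: "x < b \<Longrightarrow> f x \<le> bmax b f"
  and bmax_le: "(\<And>x. x < b \<Longrightarrow> f x \<le> M) \<Longrightarrow> bmax b f \<le> M"
proof -
  have eq: "bmax b f = card {y. y < (\<Sum>x<b. f x) \<and> (\<exists>x<b. y < f x)}"
    unfolding bmax_def using cnt_card[of "\<lambda>y. \<exists>x<b. y < f x" "\<Sum>x<b. f x"] by (simp only: cnt_def)
  show "f x \<le> bmax b f" if "x < b"
  proof -
    have "f x \<le> (\<Sum>x<b. f x)" by (rule member_le_sum) (use that in auto)
    then have "{..<f x} \<subseteq> {y. y < (\<Sum>x<b. f x) \<and> (\<exists>x<b. y < f x)}" using that by auto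
    then have "card {..<f x} \<le> bmax b f" unfolding eq by (rule card_mono[rotated]) auto
    then show ?thesis by simp
  qed
  show "bmax b f \<le> M" if "\<And>x. x < b \<Longrightarrow> f x \<le> M"
  proof -
    have "{y. y < (\<Sum>x<b. f x) \<and> (\<exists>x<b. y < f x)} \<subseteq> {..<M}" using that by fastforce
    then have "bmax b f \<le> card {..<M}" unfolding eq by (rule card_mono[rotated]) auto
    then show ?thesis by simp
  qed
qed

section \<open>Edge colouring of bipartite multigraphs\<close>

text \<open>The edges are \<open>0, \<dots>, n - 1\<close>, and edge \<open>e\<close> joins \<open>u e\<close> to \<open>v e\<close>. A state is a vector \<open>Y\<close>:
  the colours in positions below \<open>n\<close>, the current edge of a Kempe chain in position \<open>n\<close>, the
  side of its possible conflict in position \<open>n + 1\<close> (0 for \<open>u\<close>), and the sum of the two colours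
  of the chain in position \<open>n + 2\<close>.\<close>

definition endp :: "(nat \<Rightarrow> nat) \<Rightarrow> (nat \<Rightarrow> nat) \<Rightarrow> nat \<Rightarrow> nat \<Rightarrow> nat" where
  "endp u v s e = (if s = 0 then u e else v e)"

definition free_colour :: "nat \<Rightarrow> (nat \<Rightarrow> nat) \<Rightarrow> nat \<Rightarrow> (nat \<Rightarrow> nat) \<Rightarrow> nat" where
  "free_colour q w x Y = bleast q (\<lambda>c. \<forall>e<x. w e = w x \<longrightarrow> Y e \<noteq> c)"

text \<open>Edge \<open>x\<close> gets a colour missing at its end \<open>u\<close>, so a conflict
  can only occur at its end \<open>v\<close>, which is side 1. Storing the sum of the two colours
  makes flipping a subtraction.\<close>

definition insert_edge :: "nat \<Rightarrow> nat \<Rightarrow> (nat \<Rightarrow> nat) \<Rightarrow> (nat \<Rightarrow> nat) \<Rightarrow> nat \<Rightarrow> (nat \<Rightarrow> nat) \<Rightarrow> nat \<Rightarrow> nat" where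
  "insert_edge n q u v x Y k =
     (if k = x then free_colour q u x Y
      else if k = n then x
      else if k = n + 1 then 1
      else if k = n + 2 then free_colour q u x Y + free_colour q v x Y
      else Y k)"

definition conflict :: "nat \<Rightarrow> (nat \<Rightarrow> nat) \<Rightarrow> (nat \<Rightarrow> nat) \<Rightarrow> nat \<Rightarrow> (nat \<Rightarrow> nat) \<Rightarrow> nat" where
  "conflict n u v x Y = bleast n (\<lambda>f. f \<le> x \<and> f \<noteq> Y n \<and>
     endp u v (Y (n + 1)) f = endp u v (Y (n + 1)) (Y n) \<and> Y f = Y (Y n))"

text \<open>Only the conflicting edge is recoloured. This settles the conflict at the present end
  and can create one only at the other end of that edge, so the side is flipped as well. The value
  \<open>n\<close> of \<open>conflict\<close> signals that there is none.\<close>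

definition chain_step :: "nat \<Rightarrow> (nat \<Rightarrow> nat) \<Rightarrow> (nat \<Rightarrow> nat) \<Rightarrow> nat \<Rightarrow> (nat \<Rightarrow> nat) \<Rightarrow> nat \<Rightarrow> nat" where
  "chain_step n u v x Y k =
     (if conflict n u v x Y < n then
        (if k = conflict n u v x Y then Y (n + 2) - Y k
         else if k = n then conflict n u v x Y
         else if k = n + 1 then 1 - Y k
         else Y k)
      else Y k)"

text \<open>Every edge gets a fixed time slice of \<open>n + 1\<close> steps: one insertion and
  \<open>n\<close> chain steps, which suffice because a chain does not repeat an edge.\<close>

definition koenig_step :: "nat \<Rightarrow> nat \<Rightarrow> (nat \<Rightarrow> nat) \<Rightarrow> (nat \<Rightarrow> nat) \<Rightarrow> nat \<Rightarrow> (nat \<Rightarrow> nat) \<Rightarrow> nat \<Rightarrow> nat" where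
  "koenig_step n q u v t Y k =
     (if t mod (n + 1) = 0 then insert_edge n q u v (t div (n + 1)) Y k
      else chain_step n u v (t div (n + 1)) Y k)"

locale bipartite_edges =
  fixes n q :: nat and u v :: "nat \<Rightarrow> nat"
  assumes degree_u: "\<And>x. card {e. e < n \<and> u e = x} \<le> q"
    and degree_v: "\<And>x. card {e. e < n \<and> v e = x} \<le> q"
begin

abbreviation "W \<equiv> endp u v"

definition proper :: "nat \<Rightarrow> (nat \<Rightarrow> nat) \<Rightarrow> bool" where
  "proper m Y \<longleftrightarrow> (\<forall>e<m. Y e < q) \<and>
     (\<forall>e<m. \<forall>f<m. e \<noteq> f \<longrightarrow> Y e = Y f \<longrightarrow> u e \<noteq> u f \<and> v e \<noteq> v f)"

text \<open>Edge \<open>x\<close> itself counts towards the degree of its endpoint, so at most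
  \<open>q - 1\<close> earlier edges use colours there.\<close>

lemma free_colour:
  assumes "x < n" "\<And>y. card {e. e < n \<and> w e = y} \<le> q"
  shows "free_colour q w x Y < q"
    and "e < x \<Longrightarrow> w e = w x \<Longrightarrow> Y e \<noteq> free_colour q w x Y"
proof -
  let ?E = "{e. e < x \<and> w e = w x}"
  have "insert x ?E \<subseteq> {e. e < n \<and> w e = w x}" using assms(1) by auto
  from order_trans[OF card_mono[OF _ this] assms(2)[of "w x"]] have "card (insert x ?E) \<le> q" by simp
  then have "card ?E < q" by simp
  then have "card (Y ` ?E) < card {..<q}"
    using card_image_le[of ?E Y] by simp
  then have "\<not> {..<q} \<subseteq> Y ` ?E" using card_mono[of "Y ` ?E" "{..<q}"] by auto
  then obtain c where "c < q" "c \<notin> Y ` ?E" by auto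
  then show *: "free_colour q w x Y < q" unfolding free_colour_def
    by (intro bleast_ex[of c]) auto
  show "Y e \<noteq> free_colour q w x Y" if "e < x" "w e = w x"
    using bleastI[OF *[unfolded free_colour_def]] that unfolding free_colour_def by blast
qed

text \<open>\<open>V\<close> is the set of edges recoloured so far. Every one of them except the current edge is
  left by the chain at an end where another edge of \<open>V\<close> carries the other colour. As the other
  colour is missing at the conflicting end of the current edge, the chain never revisits an edge.\<close>

definition chain_inv :: "nat \<Rightarrow> (nat \<Rightarrow> nat) \<Rightarrow> nat \<Rightarrow> nat \<Rightarrow> nat set \<Rightarrow> bool" where
  "chain_inv x Y a b V \<longleftrightarrow> x < n \<and> Y n \<le> x \<and> Y (n + 1) \<le> 1 \<and> Y (n + 2) = a + b \<and> a < q \<and> b < q \<and>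
     Y (Y n) = (if Y (n + 1) = 1 then a else b) \<and>
     (\<forall>e\<le>x. Y e < q) \<and>
     (\<forall>e\<le>x. \<forall>f\<le>x. \<forall>s\<le>1. e \<noteq> f \<longrightarrow> Y e = Y f \<longrightarrow> W s e = W s f \<longrightarrow> s = Y (n + 1) \<and> (e = Y n \<or> f = Y n)) \<and>
     (\<forall>f\<le>x. f \<noteq> Y n \<longrightarrow> W (Y (n + 1)) f = W (Y (n + 1)) (Y n) \<longrightarrow>
        Y f \<noteq> (if Y (n + 1) = 1 then b else a)) \<and>
     V \<subseteq> {..x} \<and> Y n \<in> V \<and>
     (\<forall>e\<in>V. e \<noteq> Y n \<longrightarrow> Y e = a \<longrightarrow> (\<exists>f\<in>V. W 1 f = W 1 e \<and> Y f = b)) \<and>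
     (\<forall>e\<in>V. e \<noteq> Y n \<longrightarrow> Y e = b \<longrightarrow> (\<exists>f\<in>V. W 0 f = W 0 e \<and> Y f = a))"

lemma chain_inv_insert:
  assumes Y: "proper x Y" and x: "x < n"
  shows "chain_inv x (insert_edge n q u v x Y) (free_colour q u x Y) (free_colour q v x Y) {x}"
proof -
  define a b where "a = free_colour q u x Y" and "b = free_colour q v x Y"
  define Z where "Z = insert_edge n q u v x Y"
  have Z: "Z x = a" "Z n = x" "Z (n + 1) = 1" "Z (n + 2) = a + b" "\<And>e. e < x \<Longrightarrow> Z e = Y e"
    using x by (auto simp: Z_def insert_edge_def a_def b_def)
  have a: "a < q" "\<And>e. e < x \<Longrightarrow> u e = u x \<Longrightarrow> Y e \<noteq> a"
    and b: "b < q" "\<And>e. e < x \<Longrightarrow> v e = v x \<Longrightarrow> Y e \<noteq> b"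
    unfolding a_def b_def using free_colour[OF x degree_u] free_colour[OF x degree_v] by blast+
  have 1: "\<forall>e\<le>x. Z e < q" using Y a Z by (auto simp: proper_def le_less)
  have 2: "s = 1 \<and> (e = x \<or> f = x)"
    if "e \<le> x" "f \<le> x" "s \<le> 1" "e \<noteq> f" "Z e = Z f" "W s e = W s f" for e f s
  proof -
    have 1: False if "e < x" "f < x"
    proof -
      have "u e \<noteq> u f \<and> v e \<noteq> v f"
        using Y that Z(5)[of e] Z(5)[of f] \<open>e \<noteq> f\<close> \<open>Z e = Z f\<close> unfolding proper_def by simp
      then show False using \<open>W s e = W s f\<close> by (simp add: endp_def split: if_splits)
    qed
    have 2: False if "g < x" "s = 0" "W s g = W s x" "Z g = Z x" for g
      using a(2)[of g] that Z(1) Z(5)[of g] by (simp add: endp_def)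
    show ?thesis
    proof (cases "s = 0")
      case True
      then show ?thesis
        using 1 2[of e] 2[of f] that by (metis le_neq_implies_less)
    next
      case False
      then show ?thesis using 1 that by (metis le_antisym le_neq_implies_less less_one linorder_not_le)
    qed
  qed
  show ?thesis
    unfolding chain_inv_def a_def[symmetric] b_def[symmetric] Z_def[symmetric] Z(1-4)
  proof (intro conjI allI impI ballI)
    fix f assume "f \<le> x" "f \<noteq> x" "W 1 f = W 1 x"
    then show "Z f \<noteq> (if (1 :: nat) = 1 then b else a)"
      using b(2)[of f] Z(5)[of f] by (simp add: endp_def)
  qed (use 1 2 a b x Z in auto)
qed

lemma chain_inv_proper:
  assumes "chain_inv x Y a b V" "\<not> conflict n u v x Y < n"
  shows "proper (Suc x) Y"
proof -
  have no: "\<not> (f \<le> x \<and> f \<noteq> Y n \<and> W (Y (n + 1)) f = W (Y (n + 1)) (Y n) \<and> Y f = Y (Y n))" for f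
  proof
    assume *: "f \<le> x \<and> f \<noteq> Y n \<and> W (Y (n + 1)) f = W (Y (n + 1)) (Y n) \<and> Y f = Y (Y n)"
    then have "f < n" using assms(1) by (auto simp: chain_inv_def)
    from bleast_ex[OF this, of "\<lambda>f. f \<le> x \<and> f \<noteq> Y n \<and> W (Y (n + 1)) f = W (Y (n + 1)) (Y n) \<and> Y f = Y (Y n)"] *
    show False using assms(2) unfolding conflict_def by blast
  qed
  have "W s e \<noteq> W s f" if "e \<le> x" "f \<le> x" "e \<noteq> f" "Y e = Y f" "s \<le> 1" for e f s
  proof
    assume W: "W s e = W s f"
    have pr: "\<forall>e\<le>x. \<forall>f\<le>x. \<forall>s\<le>1. e \<noteq> f \<longrightarrow> Y e = Y f \<longrightarrow> W s e = W s f \<longrightarrow>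
      s = Y (n + 1) \<and> (e = Y n \<or> f = Y n)"
      using assms(1) unfolding chain_inv_def by (elim conjE) assumption
    from pr[rule_format, OF that(1,2,5,3,4) W] have s: "s = Y (n + 1)" and "e = Y n \<or> f = Y n"
      by blast+
    from this(2) show False
    proof
      assume "e = Y n"
      then show False using no[of f] that W s by simp
    next
      assume "f = Y n"
      then show False using no[of e] that W s by simp
    qed
  qed
  from this[of _ _ 0] this[of _ _ 1] show ?thesis
    using assms(1) unfolding proper_def chain_inv_def by (auto simp: endp_def less_Suc_eq_le)
qed

text \<open>The conflicting edge \<open>f\<close> shares an end and a colour with the current edge
  \<open>w\<close>. After flipping \<open>f\<close>, the colour it receives is missing at the end
  shared with \<open>w\<close>, and \<open>f\<close> becomes the current edge with its other end as
  the critical one.\<close>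

lemma chain_inv_step:
  assumes inv: "chain_inv x Y a b V" and c: "conflict n u v x Y < n"
  shows "conflict n u v x Y \<notin> V"
    and "chain_inv x (chain_step n u v x Y) a b (insert (conflict n u v x Y) V)"
proof -
  define f where "f = conflict n u v x Y"
  define s where "s = Y (n + 1)"
  define w where "w = Y n"
  have f: "f \<le> x" "f \<noteq> w" "W s f = W s w" "Y f = Y w" "f < n"
    using bleastI[OF c[unfolded conflict_def]] c
    unfolding conflict_def[symmetric] f_def[symmetric] s_def w_def by simp_all
  have x: "x < n" and w: "w \<le> x" and s: "s \<le> 1" and ab: "a < q" "b < q" "Y (n + 2) = a + b"
    and Yw: "Y w = (if s = 1 then a else b)"
    and q: "\<forall>e\<le>x. Y e < q"
    and pr: "\<And>e f s'. e \<le> x \<Longrightarrow> f \<le> x \<Longrightarrow> s' \<le> 1 \<Longrightarrow> e \<noteq> f \<Longrightarrow> Y e = Y f \<Longrightarrow> W s' e = W s' f \<Longrightarrow>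
       s' = s \<and> (e = w \<or> f = w)"
    and fr: "\<And>f. f \<le> x \<Longrightarrow> f \<noteq> w \<Longrightarrow> W s f = W s w \<Longrightarrow> Y f \<noteq> (if s = 1 then b else a)"
    and V: "V \<subseteq> {..x}" "w \<in> V"
    and Va: "\<And>e. e \<in> V \<Longrightarrow> e \<noteq> w \<Longrightarrow> Y e = a \<Longrightarrow> \<exists>f\<in>V. W 1 f = W 1 e \<and> Y f = b"
    and Vb: "\<And>e. e \<in> V \<Longrightarrow> e \<noteq> w \<Longrightarrow> Y e = b \<Longrightarrow> \<exists>f\<in>V. W 0 f = W 0 e \<and> Y f = a"
    using inv[unfolded chain_inv_def, folded s_def w_def]
    by (elim conjE; assumption | simp)+
  have s01: "s = 0 \<or> s = 1" using s by auto
  have neq: "a \<noteq> b" using fr[OF f(1-3)] f(4) Yw by auto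
  have fV: "f \<notin> V"
  proof
    assume "f \<in> V"
    \<comment> \<open>An edge of \<open>V\<close> other than \<open>w\<close> has a partner in
      \<open>V\<close> of the other colour at the end where it was left, here the end shared with
      \<open>w\<close>. But that colour is missing there by \<open>fr\<close>, except possibly on
      \<open>w\<close>, which has the first colour.\<close>
    have "\<exists>g\<in>V. W s g = W s w \<and> Y g = (if s = 1 then b else a)"
      using s01 Va[OF \<open>f \<in> V\<close> f(2)] Vb[OF \<open>f \<in> V\<close> f(2)] f Yw by auto
    then obtain g where g: "g \<in> V" "W s g = W s w" "Y g = (if s = 1 then b else a)" by blast
    then have "g = w" using fr[of g] V by auto
    then show False using g Yw neq by (auto split: if_splits)
  qed
  then show "conflict n u v x Y \<notin> V" by (simp add: f_def)
  define Z where "Z = chain_step n u v x Y"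
  have Z: "Z n = f" "Z (n + 1) = 1 - s" "Z (n + 2) = a + b" "Z f = (if s = 1 then b else a)"
    "\<And>e. e \<le> x \<Longrightarrow> e \<noteq> f \<Longrightarrow> Z e = Y e"
    using c x f Yw ab by (auto simp: Z_def chain_step_def f_def[symmetric] s_def)
  have Zq: "\<forall>e\<le>x. Z e < q" using q Z ab by (metis (full_types))
  have key: "s' = 1 - s \<and> g = f" if "e \<le> x" "g \<le> x" "s' \<le> 1" "e \<noteq> g" "Z e = Z g" "W s' e = W s' g"
      "e \<noteq> f" "g = f" for e g s'
  proof (rule ccontr)
    assume "\<not> (s' = 1 - s \<and> g = f)"
    then have s': "s' = s" using that s s01 by auto
    have e: "Y e = (if s = 1 then b else a)" using that Z by auto
    show False
    proof (cases "e = w")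
      case True
      then show False using e Yw neq by (auto split: if_splits)
    next
      case False
      then show False using fr[of e] that e f s' by simp
    qed
  qed
  have pr': "s' = 1 - s \<and> (e = f \<or> g = f)"
    if *: "e \<le> x" "g \<le> x" "s' \<le> 1" "e \<noteq> g" "Z e = Z g" "W s' e = W s' g" for e g s'
  proof (cases "e = f \<or> g = f")
    case True
    then show ?thesis using key[of e g s'] key[of g e s'] * by metis
  next
    case False
    then have "Y e = Y g" using Z(5) * by metis
    then have 1: "s' = s" "e = w \<or> g = w" using pr[of e g s'] * by blast+
    \<comment> \<open>A second edge \<open>h\<close> in conflict with \<open>w\<close> at the same
      end would clash there with \<open>f\<close> too, a conflict not involving \<open>w\<close>,
      contrary to \<open>pr\<close>.\<close>
    obtain h where h: "h \<le> x" "h \<noteq> w" "h \<noteq> f" "Y h = Y w" "W s h = W s w"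
      using 1 * False \<open>Y e = Y g\<close> by metis
    have "s = s \<and> (h = w \<or> f = w)" by (rule pr[of h f s]) (use h f s in auto)
    then show ?thesis using h f by blast
  qed
  have fr': "Z g \<noteq> (if 1 - s = 1 then b else a)" if "g \<le> x" "g \<noteq> f" "W (1 - s) g = W (1 - s) f" for g
  proof
    assume g: "Z g = (if 1 - s = 1 then b else a)"
    have "Z g = Y g" using Z(5)[of g] that by simp
    then have "Y g = Y f" using g s01 f(4) Yw by (elim disjE) simp_all
    then have "1 - s = s" using pr[of g f "1 - s"] that f(1) by (meson diff_le_self)
    then show False using s01 by linarith
  qed
  have Va': "\<exists>h\<in>insert f V. W 1 h = W 1 e \<and> Z h = b" if "e \<in> V" "Z e = a" for e
  proof (cases "e = w")
    case True
    have "Y w = a" using that True Z(5)[OF w] f(2) by simp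
    then have "s = 1" using Yw neq by (auto split: if_splits)
    then show ?thesis using f(3) True Z(4) by simp
  next
    case False
    have "e \<noteq> f" "e \<le> x" using that fV V by auto
    then have "Y e = a" using Z(5)[of e] that by simp
    from Va[OF that(1) False this] obtain h where h: "h \<in> V" "W 1 h = W 1 e" "Y h = b" by blast
    then have "Z h = b" using Z(5)[of h] fV V by auto
    then show ?thesis using h by blast
  qed
  have Vb': "\<exists>h\<in>insert f V. W 0 h = W 0 e \<and> Z h = a" if "e \<in> V" "Z e = b" for e
  proof (cases "e = w")
    case True
    have "Y w = b" using that True Z(5)[OF w] f(2) by simp
    then have "s = 0" using Yw neq s01 by (auto split: if_splits)
    then show ?thesis using f(3) True Z(4) by simp
  next
    case False
    have "e \<noteq> f" "e \<le> x" using that fV V by auto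
    then have "Y e = b" using Z(5)[of e] that by simp
    from Vb[OF that(1) False this] obtain h where h: "h \<in> V" "W 0 h = W 0 e" "Y h = a" by blast
    then have "Z h = a" using Z(5)[of h] fV V by auto
    then show ?thesis using h by blast
  qed
  have zf: "Z f = (if 1 - s = 1 then a else b)" using Z(4) s01 by auto
  have "Z n \<le> x" "Z (n + 1) \<le> 1" using Z f by auto
  then show "chain_inv x (chain_step n u v x Y) a b (insert (conflict n u v x Y) V)"
    unfolding chain_inv_def f_def[symmetric] Z_def[symmetric] Z(1,2)
    using x Z(3) ab zf Zq pr' fr' V f(1) Va' Vb' by (intro conjI ballI allI impI) auto
qed

text \<open>\<open>yseq\<close> truncates after \<open>n + 3\<close> components, so successive
  states match the step functions only up to that index.\<close>

lemma chain_inv_cong: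
  assumes "chain_inv x Y a b V" "\<And>k. k < n + 3 \<Longrightarrow> Y' k = Y k"
  shows "chain_inv x Y' a b V"
proof -
  have x: "x < n" "Y n \<le> x" "V \<subseteq> {..x}" by (insert assms(1), unfold chain_inv_def) (elim conjE, assumption)+
  have Y: "Y' n = Y n" "Y' (n + 1) = Y (n + 1)" "Y' (n + 2) = Y (n + 2)" "Y' (Y n) = Y (Y n)"
    using assms(2) x by auto
  have e: "e \<le> x \<Longrightarrow> Y' e = Y e" for e using assms(2) x by auto
  have V: "e \<in> V \<Longrightarrow> Y' e = Y e" for e using e x by auto
  have 1: "(\<forall>e\<le>x. Y' e < q) \<longleftrightarrow> (\<forall>e\<le>x. Y e < q)" by (simp add: e)
  have 2: "(\<forall>e\<le>x. \<forall>f\<le>x. \<forall>s\<le>1. e \<noteq> f \<longrightarrow> Y' e = Y' f \<longrightarrow> W s e = W s f \<longrightarrow>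
      s = Y (n + 1) \<and> (e = Y n \<or> f = Y n)) \<longleftrightarrow>
    (\<forall>e\<le>x. \<forall>f\<le>x. \<forall>s\<le>1. e \<noteq> f \<longrightarrow> Y e = Y f \<longrightarrow> W s e = W s f \<longrightarrow>
      s = Y (n + 1) \<and> (e = Y n \<or> f = Y n))"
    by (intro all_cong1 imp_cong refl) (simp_all add: e)
  have 3: "(\<forall>f\<le>x. f \<noteq> Y n \<longrightarrow> W (Y (n + 1)) f = W (Y (n + 1)) (Y n) \<longrightarrow>
      Y' f \<noteq> (if Y (n + 1) = 1 then b else a)) \<longleftrightarrow>
    (\<forall>f\<le>x. f \<noteq> Y n \<longrightarrow> W (Y (n + 1)) f = W (Y (n + 1)) (Y n) \<longrightarrow>
      Y f \<noteq> (if Y (n + 1) = 1 then b else a))"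
    by (intro all_cong1 imp_cong refl) (simp_all add: e)
  have 4: "(\<forall>e\<in>V. e \<noteq> Y n \<longrightarrow> Y' e = a' \<longrightarrow> (\<exists>f\<in>V. W s f = W s e \<and> Y' f = b')) \<longleftrightarrow>
    (\<forall>e\<in>V. e \<noteq> Y n \<longrightarrow> Y e = a' \<longrightarrow> (\<exists>f\<in>V. W s f = W s e \<and> Y f = b'))" for s a' b'
    by (intro ball_cong imp_cong bex_cong conj_cong refl) (simp_all add: V)
  show ?thesis
    using assms(1) unfolding chain_inv_def Y 1 2 3 4 .
qed

lemma proper_cong:
  assumes "proper m Y" "\<And>k. k < m \<Longrightarrow> Y' k = Y k"
  shows "proper m Y'"
  using assms unfolding proper_def by simp

text \<open>Once the colouring is proper the chain idles, which makes a fixed number of steps per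
  edge harmless.\<close>

lemma chain_step_proper:
  assumes "proper (Suc x) Y" "Y n \<le> x"
  shows "chain_step n u v x Y = Y"
proof -
  have "\<not> conflict n u v x Y < n"
  proof
    assume c: "conflict n u v x Y < n"
    obtain f where f: "f \<le> x" "f \<noteq> Y n" "W (Y (n + 1)) f = W (Y (n + 1)) (Y n)" "Y f = Y (Y n)"
      using bleastI[OF c[unfolded conflict_def]] by blast
    then have "u f \<noteq> u (Y n) \<and> v f \<noteq> v (Y n)"
      using assms unfolding proper_def by (simp add: less_Suc_eq_le)
    then show False using f(3) by (simp add: endp_def split: if_splits)
  qed
  then show ?thesis by (simp add: chain_step_def fun_eq_iff)
qed

abbreviation colouring :: "nat \<Rightarrow> nat \<Rightarrow> nat" where
  "colouring \<equiv> yseq (n + 3) (koenig_step n q u v)"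

text \<open>Each chain step either finishes the edge or adds a new element to \<open>V\<close>; the
  cardinality of \<open>V\<close> therefore measures progress.\<close>

lemma colouring_chain:
  assumes "proper x (colouring (x * (n + 1)))" "x < n" "j \<le> n"
  shows "(proper (Suc x) (colouring (x * (n + 1) + 1 + j)) \<and> colouring (x * (n + 1) + 1 + j) n \<le> x) \<or>
    (\<exists>a b V. chain_inv x (colouring (x * (n + 1) + 1 + j)) a b V \<and> card V = Suc j)"
  using assms(3)
proof (induction j)
  case 0
  let ?Y = "colouring (x * (n + 1))"
  have "(x * (n + 1)) mod (n + 1) = 0" "(x * (n + 1)) div (n + 1) = x"
    by (rule mod_mult_self2_is_0, rule nonzero_mult_div_cancel_right) simp
  then have "koenig_step n q u v (x * (n + 1)) ?Y = insert_edge n q u v x ?Y"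
    unfolding koenig_step_def by (intro ext) simp
  then have "chain_inv x (colouring (x * (n + 1) + 1 + 0)) (free_colour q u x ?Y) (free_colour q v x ?Y) {x}"
    by (intro chain_inv_cong[OF chain_inv_insert[OF assms(1,2)]]) simp
  then show ?case by (intro disjI2 exI conjI) auto
next
  case (Suc j)
  let ?t = "x * (n + 1) + 1 + j"
  let ?Y = "colouring ?t"
  have "?t = Suc j + x * (n + 1)" by simp
  moreover have "(Suc j + x * (n + 1)) mod (n + 1) = Suc j"
    unfolding mod_mult_self1 by (rule mod_less) (use Suc.prems in simp)
  moreover have "(Suc j + x * (n + 1)) div (n + 1) = x"
    using Suc.prems by (subst div_mult_self1) (simp, subst div_less, simp_all)
  ultimately have "?t mod (n + 1) = Suc j" "?t div (n + 1) = x" by (simp_all only:)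
  then have st: "koenig_step n q u v ?t ?Y = chain_step n u v x ?Y"
    unfolding koenig_step_def by (intro ext) simp
  have eq: "colouring (x * (n + 1) + 1 + Suc j) k = chain_step n u v x ?Y k" if "k < n + 3" for k
  proof -
    have "colouring (x * (n + 1) + 1 + Suc j) k = koenig_step n q u v ?t ?Y k"
      using that by simp
    then show ?thesis by (simp only: st)
  qed
  have stay: "proper (Suc x) (colouring (x * (n + 1) + 1 + Suc j)) \<and>
      colouring (x * (n + 1) + 1 + Suc j) n \<le> x" if P: "proper (Suc x) ?Y" "?Y n \<le> x"
  proof
    have eq': "colouring (x * (n + 1) + 1 + Suc j) k = ?Y k" if "k < n + 3" for k
      using eq[OF that] chain_step_proper[OF P] by metis
    show "proper (Suc x) (colouring (x * (n + 1) + 1 + Suc j))"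
      by (rule proper_cong[OF P(1) eq']) (use assms(2) in simp)
    show "colouring (x * (n + 1) + 1 + Suc j) n \<le> x"
      using eq'[of n] P(2) by (simp only:)
  qed
  from Suc.IH Suc.prems consider "proper (Suc x) ?Y \<and> ?Y n \<le> x"
    | a b V where "chain_inv x ?Y a b V" "card V = Suc j" by (meson Suc_leD)
  then show ?case
  proof cases
    case 1
    then show ?thesis using stay by blast
  next
    case 2
    show ?thesis
    proof (cases "conflict n u v x ?Y < n")
      case True
      have "finite V" using 2(1) unfolding chain_inv_def by (meson finite_atMost finite_subset)
      then have "card (insert (conflict n u v x ?Y) V) = Suc (Suc j)"
        using chain_inv_step(1)[OF 2(1) True] 2(2) by simp
      moreover have "chain_inv x (colouring (x * (n + 1) + 1 + Suc j)) a b (insert (conflict n u v x ?Y) V)"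
        by (rule chain_inv_cong[OF chain_inv_step(2)[OF 2(1) True] eq])
      ultimately show ?thesis by blast
    next
      case False
      have "?Y n \<le> x" using 2(1) unfolding chain_inv_def by (elim conjE)
      then show ?thesis using stay[OF chain_inv_proper[OF 2(1) False]] by blast
    qed
  qed
qed

theorem colouring_proper: "proper n (colouring (n * (n + 1)))"
proof -
  have "proper x (colouring (x * (n + 1)))" if "x \<le> n" for x
    using that
  proof (induction x)
    case 0
    then show ?case by (simp add: proper_def)
  next
    case (Suc x)
    let ?Y = "colouring (x * (n + 1) + 1 + n)"
    \<comment> \<open>A chain still running after \<open>n\<close> steps would have visited
      \<open>n + 1\<close> edges, but only \<open>x + 1 \<le> n\<close> edges are present.\<close>
    have "\<not> (chain_inv x ?Y a b V \<and> card V = Suc n)" for a b V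
    proof
      assume *: "chain_inv x ?Y a b V \<and> card V = Suc n"
      then have "V \<subseteq> {..x}" unfolding chain_inv_def by (elim conjE)
      then have "card V \<le> card {..x}" by (intro card_mono) auto
      then show False using * Suc.prems by simp
    qed
    then have "proper (Suc x) ?Y"
      using colouring_chain[of x n] Suc.IH Suc.prems by (meson Suc_le_lessD order_refl Suc_leD)
    moreover have "x * (n + 1) + 1 + n = Suc x * (n + 1)" by simp
    ultimately show ?case by (simp only:)
  qed
  then show ?thesis by simp
qed

end

text \<open>The stored numbers are colours, edge indices, the side bit and a sum of two colours,
  whence \<open>2 * q + n + 1\<close>. This bound justifies the storage limit.\<close>

lemma koenig_step_le:
  assumes "\<And>k. Y k \<le> 2 * q + n + 1" "t < n * (n + 1)"
  shows "koenig_step n q u v t Y k \<le> 2 * q + n + 1"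
proof -
  have x: "t div (n + 1) < n" using assms(2) by (simp add: less_mult_imp_div_less)
  have f: "free_colour q w x Y \<le> q" for w x unfolding free_colour_def by (rule bleast_le)
  have c: "conflict n u v x Y \<le> n" for x unfolding conflict_def by (rule bleast_le)
  have "insert_edge n q u v (t div (n + 1)) Y k \<le> 2 * q + n + 1"
    using f[of u "t div (n + 1)"] f[of v "t div (n + 1)"] x assms(1)[of k]
    unfolding insert_edge_def by (simp only: split: if_split) (intro conjI impI; (rule TrueI | linarith))
  moreover have "chain_step n u v (t div (n + 1)) Y k \<le> 2 * q + n + 1"
  proof -
    have "Y (n + 2) - Y k \<le> 2 * q + n + 1" using assms(1)[of "n + 2"] by linarith
    then show ?thesis
      using c[of "t div (n + 1)"] assms(1)[of k]
      unfolding chain_step_def by (simp only: split: if_split) (intro conjI impI; (rule TrueI | linarith))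
  qed
  ultimately show ?thesis unfolding koenig_step_def by simp
qed

lemma yseq_le:
  assumes "t \<le> n * (n + 1)"
  shows "yseq (n + 3) (koenig_step n q u v) t k \<le> 2 * q + n + 1"
  using assms
proof (induction t arbitrary: k)
  case (Suc t)
  then have "koenig_step n q u v t (yseq (n + 3) (koenig_step n q u v) t) k \<le> 2 * q + n + 1"
    by (intro koenig_step_le) auto
  then show ?case by simp
qed simp

section \<open>Order-preserving packing on a line\<close>

lemma cnt_0 [simp]: "cnt P 0 = 0"
  and cnt_Suc: "cnt P (Suc b) = cnt P b + of_bool (P b)"
  by (simp_all add: cnt_def)

lemma cnt_mono: "a \<le> b \<Longrightarrow> cnt P a \<le> cnt P b"
  by (induction b rule: dec_induct) (auto simp: cnt_Suc)

lemma cnt_less: "P a \<Longrightarrow> a < b \<Longrightarrow> cnt P a < cnt P b"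
  using cnt_mono[of "Suc a" b P] by (simp add: cnt_Suc)

lemma cnt_le: "cnt P b \<le> b"
  by (induction b) (auto simp: cnt_Suc)

lemma cnt_cong: "(\<And>x. x < b \<Longrightarrow> P x = Q x) \<Longrightarrow> cnt P b = cnt Q b"
  by (simp add: cnt_def)

lemma cnt_attained: "u < cnt P b \<Longrightarrow> \<exists>y<b. P y \<and> cnt P y = u"
proof (induction b)
  case (Suc b)
  show ?case
  proof (cases "u < cnt P b")
    case True
    then show ?thesis using Suc.IH by (meson less_SucI)
  next
    case False
    then have "P b" "cnt P b = u" using Suc.prems by (auto simp: cnt_Suc of_bool_def split: if_splits)
    then show ?thesis by blast
  qed
qed simp

lemma bmax_attained: "bmax b f = 0 \<or> (\<exists>x<b. bmax b f = f x)"
proof (rule ccontr)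
  assume *: "\<not> ?thesis"
  have "bmax b f \<le> bmax b f - 1"
  proof (rule bmax_le)
    fix x assume "x < b"
    then show "f x \<le> bmax b f - 1" using bmax_ge[of x b f] * by fastforce
  qed
  moreover have "bmax b f \<noteq> 0" using * by simp
  ultimately show False by linarith
qed

lemma bmax_mono: "a \<le> b \<Longrightarrow> bmax a f \<le> bmax b f"
  by (rule bmax_le) (auto intro: bmax_ge)

definition gap :: "nat \<Rightarrow> nat \<Rightarrow> nat" where
  "gap x y = (x - y) + (y - x)"

lemma gap_le: "x < L \<Longrightarrow> y < L \<Longrightarrow> gap x y \<le> L"
  unfolding gap_def by (cases "x \<le> y") auto

text \<open>The robot at \<open>x\<close> takes the slot whose rank is its own rank plus a shift.
  The shift is the running maximum of the surplus of slots over robots, capped by the total surplus: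
  it never decreases, so order is preserved, and the cap guarantees that all robots find a
  slot.\<close>

definition pack :: "nat \<Rightarrow> (nat \<Rightarrow> bool) \<Rightarrow> (nat \<Rightarrow> bool) \<Rightarrow> nat \<Rightarrow> nat" where
  "pack L X Z x = bleast L (\<lambda>y. Z y \<and> cnt Z y =
     cnt X x + min (cnt Z L - cnt X L) (bmax (Suc x) (\<lambda>w. cnt Z w - cnt X w)))"

context
  fixes L :: nat and X Z :: "nat \<Rightarrow> bool"
  assumes XZ: "cnt X L \<le> cnt Z L"
begin

lemma pack_slot:
  assumes "x < L" "X x"
  shows "pack L X Z x < L" "Z (pack L X Z x)"
    "cnt Z (pack L X Z x) =
       cnt X x + min (cnt Z L - cnt X L) (bmax (Suc x) (\<lambda>w. cnt Z w - cnt X w))"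
proof -
  have "cnt X x + min (cnt Z L - cnt X L) (bmax (Suc x) (\<lambda>w. cnt Z w - cnt X w)) < cnt Z L"
    using cnt_less[of X x L] assms XZ by linarith
  from cnt_attained[OF this] obtain y where y: "y < L" "Z y"
    "cnt Z y = cnt X x + min (cnt Z L - cnt X L) (bmax (Suc x) (\<lambda>w. cnt Z w - cnt X w))" by blast
  then show *: "pack L X Z x < L" unfolding pack_def by (intro bleast_ex[of y]) auto
  show "Z (pack L X Z x)" "cnt Z (pack L X Z x) =
       cnt X x + min (cnt Z L - cnt X L) (bmax (Suc x) (\<lambda>w. cnt Z w - cnt X w))"
    using bleastI[OF *[unfolded pack_def]] unfolding pack_def by blast+
qed

lemma pack_less:
  assumes "x < y" "y < L" "X x" "X y"
  shows "pack L X Z x < pack L X Z y"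
proof -
  have "cnt Z (pack L X Z x) < cnt Z (pack L X Z y)"
    using pack_slot(3)[of x] pack_slot(3)[of y] assms cnt_less[of X x y]
      bmax_mono[of "Suc x" "Suc y" "\<lambda>w. cnt Z w - cnt X w"] by simp
  then show ?thesis using cnt_mono[of "pack L X Z y" "pack L X Z x" Z] by linarith
qed

text \<open>Robots have density at most 1/3 up to \<open>a\<close>, slots at least 1/3 up to
  \<open>b\<close>. Whenever an interval of slots contains no more of them than a certain interval
  contains robots, the former is longer by at most \<open>a + b\<close>; this is applied once from
  the left and once from the right.\<close>

lemma gap_pack_le:
  assumes X: "\<And>x y. x \<le> y \<Longrightarrow> y \<le> L \<Longrightarrow> 3 * (cnt X y - cnt X x) \<le> (y - x) + a"
    and Z: "\<And>x y. x \<le> y \<Longrightarrow> y \<le> L \<Longrightarrow> y - x \<le> 3 * (cnt Z y - cnt Z x) + b"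
    and x: "x < L" "X x"
  shows "gap x (pack L X Z x) \<le> a + b"
proof -
  let ?p = "pack L X Z x"
  let ?M = "bmax (Suc x) (\<lambda>w. cnt Z w - cnt X w)"
  let ?s = "min (cnt Z L - cnt X L) ?M"
  note p = pack_slot[OF x]
  \<comment> \<open>\<open>x0\<close> is a place where the running maximum is attained, or 0. From
    there on, the slots before the target are at most as many as the robots before
    \<open>x\<close>.\<close>
  have "\<exists>x0\<le>x. ?s + cnt X x0 \<le> cnt Z x0"
  proof (cases "?s = 0")
    case True
    then show ?thesis by (intro exI[of _ 0]) simp
  next
    case False
    then obtain w where "w < Suc x" "?M = cnt Z w - cnt X w"
      using bmax_attained[of "Suc x" "\<lambda>w. cnt Z w - cnt X w"] by auto
    then show ?thesis using False by (intro exI[of _ w]) auto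
  qed
  then obtain x0 where x0: "x0 \<le> x" "?s + cnt X x0 \<le> cnt Z x0" by blast
  have up: "?p \<le> x + (a + b)"
  proof (cases "x0 \<le> ?p")
    case True
    have "cnt Z ?p - cnt Z x0 \<le> cnt X x - cnt X x0" using p(3) x0 cnt_mono[OF x0(1), of X] by linarith
    then show ?thesis using X[OF x0(1)] Z[OF True] p(1) x(1) x0(1) True by linarith
  qed (use x0 in simp)
  \<comment> \<open>An uncapped shift puts the target at or beyond \<open>x\<close>. With the cap
    active, the slots from the target on match the robots from \<open>x\<close> on, and the density
    comparison is made up to \<open>L\<close>.\<close>
  have lo: "x \<le> ?p + (a + b)"
  proof (cases "?s = ?M")
    case True
    have "cnt Z x - cnt X x \<le> ?M" using bmax_ge[of x "Suc x" "\<lambda>w. cnt Z w - cnt X w"] by simp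
    then have "cnt Z x \<le> cnt Z ?p" using p(3) True by linarith
    then have "\<not> ?p < x" using cnt_less[of Z ?p x] p(2) by auto
    then show ?thesis by simp
  next
    case False
    then have "cnt Z L - cnt Z ?p = cnt X L - cnt X x"
      using p(3) XZ cnt_mono[of x L X] x(1) by linarith
    then show ?thesis using X[of x L] Z[of ?p L] p(1) x(1) by linarith
  qed
  show ?thesis using up lo unfolding gap_def by linarith
qed

end

section \<open>Composing plans\<close>

lemma grid_adj_sym: "grid_adj u v = grid_adj v u"
  by (auto simp: grid_adj_def)

lemma mrpp_feasible_append:
  assumes 1: "mrpp_feasible m1 m2 n s w T1 P1" and 2: "mrpp_feasible m1 m2 n w g T2 P2"
  shows "mrpp_feasible m1 m2 n s g (T1 + T2) (\<lambda>t. if t < T1 then P1 t else P2 (t - T1))"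
proof -
  define Q where "Q = (\<lambda>t. if t < T1 then P1 t else P2 (t - T1))"
  \<comment> \<open>At the seam \<open>t = T1\<close> both plans stand in \<open>w\<close>, so the
    description by \<open>P1\<close> stays valid there and the step across the seam is a step of
    \<open>P1\<close>.\<close>
  have a: "Q t i = P1 t i" if "t \<le> T1" "i < n" for t i
    using that 1 2 by (auto simp: mrpp_feasible_def Q_def)
  have b: "Q t = P2 (t - T1)" if "T1 \<le> t" for t using that by (simp add: Q_def)
  have inj: "inj_on (Q t) {0..<n}" if "t \<le> T1 + T2" for t
    using 1 2 that by (cases "t < T1") (simp_all add: mrpp_feasible_def Q_def)
  have grid: "Q t i \<in> grid_V m1 m2" if "t \<le> T1 + T2" "i < n" for t i
    using 1 2 that by (cases "t < T1") (simp_all add: mrpp_feasible_def Q_def)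
  have step: "Q (Suc t) i = Q t i \<or> grid_adj (Q t i) (Q (Suc t) i)"
    and swap: "j < n \<Longrightarrow> i \<noteq> j \<Longrightarrow> \<not> (Q (Suc t) i = Q t j \<and> Q (Suc t) j = Q t i)"
    if "t < T1 + T2" "i < n" for t i j
  proof -
    show "Q (Suc t) i = Q t i \<or> grid_adj (Q t i) (Q (Suc t) i)"
    proof (cases "t < T1")
      case True
      then have "P1 (Suc t) i = P1 t i \<or> grid_adj (P1 t i) (P1 (Suc t) i)"
        using 1 that unfolding mrpp_feasible_def by blast
      then show ?thesis using a[of t i] a[of "Suc t" i] True that by simp
    next
      case False
      then have "t - T1 < T2" using that by simp
      then have "P2 (Suc (t - T1)) i = P2 (t - T1) i \<or> grid_adj (P2 (t - T1) i) (P2 (Suc (t - T1)) i)"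
        using 2 that unfolding mrpp_feasible_def by blast
      then show ?thesis using b[of t] b[of "Suc t"] False by (simp add: Suc_diff_le)
    qed
    show "\<not> (Q (Suc t) i = Q t j \<and> Q (Suc t) j = Q t i)" if "j < n" "i \<noteq> j"
    proof (cases "t < T1")
      case True
      then have "\<not> (P1 (Suc t) i = P1 t j \<and> P1 (Suc t) j = P1 t i)"
        using 1 that \<open>i < n\<close> unfolding mrpp_feasible_def by blast
      then show ?thesis using a[of t i] a[of "Suc t" i] a[of t j] a[of "Suc t" j] True that \<open>i < n\<close>
        by simp
    next
      case False
      then have "t - T1 < T2" using \<open>t < T1 + T2\<close> by simp
      then have "\<not> (P2 (Suc (t - T1)) i = P2 (t - T1) j \<and> P2 (Suc (t - T1)) j = P2 (t - T1) i)"
        using 2 that \<open>i < n\<close> unfolding mrpp_feasible_def by blast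
      then show ?thesis using b[of t] b[of "Suc t"] False by (simp add: Suc_diff_le)
    qed
  qed
  show ?thesis
    unfolding mrpp_feasible_def Q_def[symmetric]
  proof (intro conjI allI impI)
    fix i assume "i < n"
    then show "Q 0 i = s i" using a[of 0 i] 1 by (simp add: mrpp_feasible_def)
    show "Q (T1 + T2) i = g i" using b[of "T1 + T2"] 2 \<open>i < n\<close> by (simp add: mrpp_feasible_def)
  qed (use inj step swap grid in blast)+
qed

lemma mrpp_feasible_reverse:
  assumes "mrpp_feasible m1 m2 n s g T P"
  shows "mrpp_feasible m1 m2 n g s T (\<lambda>t. P (T - t))"
proof -
  have step: "P (T - t) i = P (T - Suc t) i \<or> grid_adj (P (T - Suc t) i) (P (T - t) i)"
    "j < n \<Longrightarrow> i \<noteq> j \<Longrightarrow> \<not> (P (T - t) i = P (T - Suc t) j \<and> P (T - t) j = P (T - Suc t) i)"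
    if "t < T" "i < n" for t i j
  proof -
    have *: "T - t = Suc (T - Suc t)" "T - Suc t < T" using that by auto
    show "P (T - t) i = P (T - Suc t) i \<or> grid_adj (P (T - Suc t) i) (P (T - t) i)"
      using assms *(2) that unfolding *(1) mrpp_feasible_def by blast
    show "\<not> (P (T - t) i = P (T - Suc t) j \<and> P (T - t) j = P (T - Suc t) i)" if "j < n" "i \<noteq> j"
      using assms *(2) that \<open>i < n\<close> unfolding *(1) mrpp_feasible_def by blast
  qed
  show ?thesis
    unfolding mrpp_feasible_def
  proof (intro conjI allI impI)
    fix t i assume "t < T" "i < n"
    then show "P (T - Suc t) i = P (T - t) i \<or> grid_adj (P (T - t) i) (P (T - Suc t) i)"
      using step(1)[of t i] grid_adj_sym by metis
  next
    fix t i j assume "t < T" "i < n" "j < n" "i \<noteq> j"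
    then show "\<not> (P (T - Suc t) i = P (T - t) j \<and> P (T - Suc t) j = P (T - t) i)"
      using step(2)[of t j i] by metis
  qed (use assms in \<open>auto simp: mrpp_feasible_def\<close>)
qed

section \<open>Elementary motions\<close>

text \<open>The position at time \<open>t\<close> of a point that moves from \<open>x\<close> to
  \<open>y\<close> at unit speed and then rests. The motion preserves strict order of start and
  target at all times.\<close>

definition clip :: "nat \<Rightarrow> nat \<Rightarrow> nat \<Rightarrow> nat" where
  "clip x y t = max (x - t) (min (x + t) y)"

lemma clip_0 [simp]: "clip x y 0 = x"
  by (simp add: clip_def)

lemma clip_gap: "gap x y \<le> t \<Longrightarrow> clip x y t = y"
  by (auto simp: clip_def gap_def max_def min_def)

lemma clip_less: "x < x' \<Longrightarrow> y < y' \<Longrightarrow> clip x y t < clip x' y' t"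
  by (auto simp: clip_def max_def min_def)

lemma clip_bound: "x < L \<Longrightarrow> y < L \<Longrightarrow> clip x y t < L"
  by (auto simp: clip_def max_def min_def)

lemma clip_Suc: "clip x y (Suc t) = clip x y t \<or> clip x y (Suc t) = Suc (clip x y t) \<or>
    clip x y t = Suc (clip x y (Suc t))"
  by (auto simp: clip_def max_def min_def)

text \<open>On each path the robots are in the same strict order at all times. Two robots cannot
  meet, since positions are distinct, and cannot swap, since that would reverse their order.\<close>

lemma path_motion:
  fixes cell :: "nat \<Rightarrow> nat \<Rightarrow> nat \<times> nat" and l x y :: "nat \<Rightarrow> nat"
  assumes bound: "\<And>e. e < n \<Longrightarrow> x e < L \<and> y e < L"
    and grid: "\<And>e p. e < n \<Longrightarrow> p < L \<Longrightarrow> cell (l e) p \<in> grid_V m1 m2"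
    and inj: "\<And>e f p q. e < n \<Longrightarrow> f < n \<Longrightarrow> p < L \<Longrightarrow> q < L \<Longrightarrow> cell (l e) p = cell (l f) q \<Longrightarrow>
       l e = l f \<and> p = q"
    and adj: "\<And>e p. e < n \<Longrightarrow> Suc p < L \<Longrightarrow> grid_adj (cell (l e) p) (cell (l e) (Suc p))"
    and order: "\<And>e f. e < n \<Longrightarrow> f < n \<Longrightarrow> e \<noteq> f \<Longrightarrow> l e = l f \<Longrightarrow>
       (x e < x f \<and> y e < y f) \<or> (x f < x e \<and> y f < y e)"
    and T: "\<And>e. e < n \<Longrightarrow> gap (x e) (y e) \<le> T"
  shows "mrpp_feasible m1 m2 n (\<lambda>e. cell (l e) (x e)) (\<lambda>e. cell (l e) (y e)) T
    (\<lambda>t e. cell (l e) (clip (x e) (y e) t))"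
proof -
  let ?c = "\<lambda>t e. clip (x e) (y e) t"
  have c: "?c t e < L" if "e < n" for t e using bound[OF that] clip_bound by blast
  have order': "(?c t e < ?c t f \<and> ?c t' e < ?c t' f) \<or> (?c t f < ?c t e \<and> ?c t' f < ?c t' e)"
    if "e < n" "f < n" "e \<noteq> f" "l e = l f" for e f t t'
    using order[OF that] clip_less by blast
  show ?thesis
    unfolding mrpp_feasible_def
  proof (intro conjI allI impI)
    fix t e assume "t < T" "e < n"
    then show "cell (l e) (?c (Suc t) e) = cell (l e) (?c t e) \<or>
      grid_adj (cell (l e) (?c t e)) (cell (l e) (?c (Suc t) e))"
      using clip_Suc[of "x e" "y e" t] adj[of e "?c t e"] adj[of e "?c (Suc t) e"] c[of e t] c[of e "Suc t"]
      by (metis grid_adj_sym)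
  next
    fix t assume "t \<le> T"
    show "inj_on (\<lambda>e. cell (l e) (?c t e)) {0..<n}"
    proof (rule inj_onI, rule ccontr)
      fix e f assume *: "e \<in> {0..<n}" "f \<in> {0..<n}" "cell (l e) (?c t e) = cell (l f) (?c t f)" "e \<noteq> f"
      then have "l e = l f \<and> ?c t e = ?c t f" by (intro inj c) auto
      then show False using order'[of e f t t] * by auto
    qed
  next
    fix t e f assume *: "t < T" "e < n" "f < n" "e \<noteq> f"
    show "\<not> (cell (l e) (?c (Suc t) e) = cell (l f) (?c t f) \<and>
        cell (l f) (?c (Suc t) f) = cell (l e) (?c t e))"
    proof
      assume **: "cell (l e) (?c (Suc t) e) = cell (l f) (?c t f) \<and>
        cell (l f) (?c (Suc t) f) = cell (l e) (?c t e)"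
      have "l e = l f \<and> ?c (Suc t) e = ?c t f" "l f = l e \<and> ?c (Suc t) f = ?c t e"
        by (intro inj c *; use ** in simp)+
      then show False using order'[of e f t "Suc t"] * by auto
    qed
  qed (use grid c T clip_gap in auto)
qed

text \<open>A lane motion inside a strip of three lanes: everybody starts on the middle lane, goes to
  lane 2 to move up and to lane 0 to move down, and returns to the middle lane at its target.\<close>
definition lane :: "nat \<Rightarrow> nat \<Rightarrow> nat \<Rightarrow> nat" where
  "lane x y t = (if x < y \<and> 1 \<le> t \<and> t \<le> y - x + 1 then 2
     else if y < x \<and> 1 \<le> t \<and> t \<le> x - y + 1 then 0 else 1)"

lemma clip_up: "x \<le> y \<Longrightarrow> clip x y t = min (x + t) y"
  and clip_down: "y \<le> x \<Longrightarrow> clip x y t = max (x - t) y"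
  by (simp_all add: clip_def)

lemma lane_up: "x < y \<Longrightarrow> lane x y t = (if 1 \<le> t \<and> t \<le> y - x + 1 then 2 else 1)"
  and lane_down: "y < x \<Longrightarrow> lane x y t = (if 1 \<le> t \<and> t \<le> x - y + 1 then 0 else 1)"
  by (simp_all add: lane_def)

text \<open>From time 1 on, the lane determines what the position reveals: on lane 2 it is the start
  plus the elapsed time, on lane 0 the start minus it, and on the middle lane it is the target.
  Distinct starts and targets thus give distinct positions. The position lags by one step because
  the first step changes the lane.\<close>

lemma lane_Suc_cases:
  "(lane x y (Suc t) = 2 \<and> clip x y t = x + t) \<or>
   (lane x y (Suc t) = 0 \<and> clip x y t + t = x) \<or>
   (lane x y (Suc t) = 1 \<and> clip x y t = y)"
proof -
  consider "x < y" | "x = y" | "y < x" by linarith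
  then show ?thesis
    by cases (simp_all add: lane_def clip_up clip_down)
qed

lemma lane_Suc_eq: "lane x y (Suc (Suc t)) \<noteq> 1 \<Longrightarrow> lane x y (Suc t) = lane x y (Suc (Suc t))"
  by (simp add: lane_def split: if_splits)

lemma lane_step:
  "(lane x y (Suc t) = lane x y t \<and> (clip x y t = clip x y (t - 1) \<or>
      clip x y t = Suc (clip x y (t - 1)) \<or> clip x y (t - 1) = Suc (clip x y t))) \<or>
   (clip x y t = clip x y (t - 1) \<and>
      (lane x y (Suc t) = Suc (lane x y t) \<or> lane x y t = Suc (lane x y (Suc t))))"
proof (cases t)
  case 0
  then show ?thesis by (simp add: lane_def)
next
  case (Suc r)
  show ?thesis
  proof (cases "lane x y (Suc t) = lane x y t")
    case True
    then show ?thesis using clip_Suc[of x y r] Suc by auto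
  next
    case False
    then have l: "lane x y (Suc t) = 1" using lane_Suc_eq[of x y r] Suc by auto
    have "clip x y t = y" using lane_Suc_cases[of x y t] l by auto
    moreover have "clip x y (t - 1) = y"
    proof -
      consider "x < y" | "x = y" | "y < x" by linarith
      then show ?thesis
      proof cases
        case 1
        have "\<not> Suc t \<le> y - x + 1" using l unfolding lane_up[OF 1] by presburger
        moreover have "t \<le> y - x + 1"
        proof (rule ccontr)
          assume "\<not> t \<le> y - x + 1"
          then have "lane x y t = 1" unfolding lane_up[OF 1] by presburger
          then show False using l False by metis
        qed
        ultimately have "t = y - x + 1" by linarith
        then show ?thesis using 1 by (simp add: clip_up)
      next
        case 2
        then show ?thesis by (simp add: clip_up)
      next
        case 3
        have "\<not> Suc t \<le> x - y + 1" using l unfolding lane_down[OF 3] by presburger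
        moreover have "t \<le> x - y + 1"
        proof (rule ccontr)
          assume "\<not> t \<le> x - y + 1"
          then have "lane x y t = 1" unfolding lane_down[OF 3] by presburger
          then show False using l False by metis
        qed
        ultimately have "t = x - y + 1" by linarith
        then show ?thesis using 3 by (simp add: clip_down)
      qed
    qed
    moreover have "lane x y t = 2 \<or> lane x y t = 0"
      using lane_Suc_cases[of x y r] l False Suc by auto
    ultimately show ?thesis using l by auto
  qed
qed

lemma lane_inj:
  assumes "x \<noteq> x'" "y \<noteq> y'"
  shows "\<not> (lane x y t = lane x' y' t \<and> clip x y (t - 1) = clip x' y' (t - 1))"
proof (cases t)
  case 0
  then show ?thesis using assms by simp
next
  case (Suc r)
  then show ?thesis
    using lane_Suc_cases[of x y r] lane_Suc_cases[of x' y' r] assms by auto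
qed

text \<open>A swap on the middle lane would force equal targets, and on an outer lane both robots
  move in the same direction. A swap across lanes would need one robot to leave the middle lane
  after the first step.\<close>

lemma lane_swap:
  assumes "x \<noteq> x'" "y \<noteq> y'"
  shows "\<not> (lane x y (Suc t) = lane x' y' t \<and> clip x y t = clip x' y' (t - 1) \<and>
    lane x' y' (Suc t) = lane x y t \<and> clip x' y' t = clip x y (t - 1))"
proof (cases t)
  case 0
  then show ?thesis using assms by simp
next
  case (Suc r)
  show ?thesis
  proof
    assume *: "lane x y (Suc t) = lane x' y' t \<and> clip x y t = clip x' y' (t - 1) \<and>
      lane x' y' (Suc t) = lane x y t \<and> clip x' y' t = clip x y (t - 1)"
    show False
    proof (cases "lane x y (Suc t) = 1")
      case True
      then show False
        using * lane_Suc_cases[of x y t] lane_Suc_cases[of x' y' r] assms(2) Suc by auto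
    next
      case False
      then have "lane x y t = lane x y (Suc t)" using lane_Suc_eq[of x y r] Suc by simp
      then show False
        using * False lane_Suc_cases[of x y t] lane_Suc_cases[of x' y' t]
          lane_Suc_cases[of x y r] lane_Suc_cases[of x' y' r] Suc by auto
    qed
  qed
qed

lemma lane_le: "lane x y t < 3"
  by (simp add: lane_def)

text \<open>At most \<open>L - 1\<close> steps along the lane plus leaving and rejoining the middle
  lane give \<open>L + 1\<close>. Only distinctness of starts and of targets is required, so
  arbitrary permutations within a strip are possible.\<close>

lemma lane_motion:
  fixes cell :: "nat \<Rightarrow> nat \<Rightarrow> nat \<Rightarrow> nat \<times> nat" and l x y :: "nat \<Rightarrow> nat"
  assumes bound: "\<And>e. e < n \<Longrightarrow> x e < L \<and> y e < L"
    and grid: "\<And>e b p. e < n \<Longrightarrow> b < 3 \<Longrightarrow> p < L \<Longrightarrow> cell (l e) b p \<in> grid_V m1 m2"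
    and inj: "\<And>e f b d p q. e < n \<Longrightarrow> f < n \<Longrightarrow> b < 3 \<Longrightarrow> d < 3 \<Longrightarrow> p < L \<Longrightarrow> q < L \<Longrightarrow>
       cell (l e) b p = cell (l f) d q \<Longrightarrow> l e = l f \<and> b = d \<and> p = q"
    and adj: "\<And>e b p. grid_adj (cell e b p) (cell e b (Suc p))"
      "\<And>e b p. grid_adj (cell e b p) (cell e (Suc b) p)"
    and distinct: "\<And>e f. e < n \<Longrightarrow> f < n \<Longrightarrow> e \<noteq> f \<Longrightarrow> l e = l f \<Longrightarrow> x e \<noteq> x f \<and> y e \<noteq> y f"
  shows "mrpp_feasible m1 m2 n (\<lambda>e. cell (l e) 1 (x e)) (\<lambda>e. cell (l e) 1 (y e)) (L + 1)
    (\<lambda>t e. cell (l e) (lane (x e) (y e) t) (clip (x e) (y e) (t - 1)))"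
proof -
  let ?b = "\<lambda>t e. lane (x e) (y e) t" and ?c = "\<lambda>t e. clip (x e) (y e) (t - 1)"
  have c: "?c t e < L" if "e < n" for t e using bound[OF that] clip_bound by blast
  show ?thesis
    unfolding mrpp_feasible_def
  proof (intro conjI allI impI)
    fix e assume "e < n"
    show "cell (l e) (?b 0 e) (?c 0 e) = cell (l e) 1 (x e)" by (simp add: lane_def)
    have "gap (x e) (y e) \<le> L" using bound[OF \<open>e < n\<close>] by (intro gap_le) auto
    then have "?c (L + 1) e = y e" using clip_gap by simp
    moreover have "y e - x e < L" "x e - y e < L"
      using bound[OF \<open>e < n\<close>] by (simp_all add: less_imp_diff_less)
    then have "?b (L + 1) e = 1" by (simp add: lane_def)
    ultimately show "cell (l e) (?b (L + 1) e) (?c (L + 1) e) = cell (l e) 1 (y e)" by simp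
  next
    fix t e assume "t < L + 1" "e < n"
    show "cell (l e) (?b (Suc t) e) (?c (Suc t) e) = cell (l e) (?b t e) (?c t e) \<or>
      grid_adj (cell (l e) (?b t e) (?c t e)) (cell (l e) (?b (Suc t) e) (?c (Suc t) e))"
      using lane_step[of "x e" "y e" t] adj grid_adj_sym by (metis diff_Suc_1)
  next
    fix t assume "t \<le> L + 1"
    show "inj_on (\<lambda>e. cell (l e) (?b t e) (?c t e)) {0..<n}"
    proof (rule inj_onI, rule ccontr)
      fix e f assume *: "e \<in> {0..<n}" "f \<in> {0..<n}"
        "cell (l e) (?b t e) (?c t e) = cell (l f) (?b t f) (?c t f)" "e \<noteq> f"
      then have "l e = l f \<and> ?b t e = ?b t f \<and> ?c t e = ?c t f"
        by (intro inj c lane_le) auto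
      then show False using distinct[of e f] lane_inj[of "x e" "x f" "y e" "y f" t] * by auto
    qed
  next
    fix t e f assume *: "t < L + 1" "e < n" "f < n" "e \<noteq> f"
    show "\<not> (cell (l e) (?b (Suc t) e) (?c (Suc t) e) = cell (l f) (?b t f) (?c t f) \<and>
        cell (l f) (?b (Suc t) f) (?c (Suc t) f) = cell (l e) (?b t e) (?c t e))"
    proof
      assume **: "cell (l e) (?b (Suc t) e) (?c (Suc t) e) = cell (l f) (?b t f) (?c t f) \<and>
        cell (l f) (?b (Suc t) f) (?c (Suc t) f) = cell (l e) (?b t e) (?c t e)"
      have "l e = l f \<and> ?b (Suc t) e = ?b t f \<and> ?c (Suc t) e = ?c t f"
        "l f = l e \<and> ?b (Suc t) f = ?b t e \<and> ?c (Suc t) f = ?c t e"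
        by (intro inj c lane_le *; use ** in simp)+
      then show False using distinct[of e f] lane_swap[of "x e" "x f" "y e" "y f" t] * by auto
    qed
  qed (use grid c lane_le in auto)
qed

text \<open>In each 3 by 3 block the robots of the middle row move to the middle column, first
  vertically and then horizontally; the column residue becomes the row residue.\<close>

definition turn :: "nat \<Rightarrow> nat \<Rightarrow> nat \<Rightarrow> nat \<times> nat" where
  "turn i c t = (3 * i + (if t = 0 then 1 else c mod 3), if t \<le> 1 then c else 3 * (c div 3) + 1)"

lemma block_eq: "3 * i + c mod 3 = 3 * j + d mod 3 \<Longrightarrow> i = j \<and> c mod 3 = d mod 3" for i :: nat
  by presburger

lemma turn_motion:
  assumes "3 dvd m1" "3 dvd m2" "\<And>e. e < n \<Longrightarrow> 3 * i e < m1 \<and> c e < m2"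
    and distinct: "\<And>e f. e < n \<Longrightarrow> f < n \<Longrightarrow> e \<noteq> f \<Longrightarrow> i e = i f \<Longrightarrow> c e \<noteq> c f"
  shows "mrpp_feasible m1 m2 n (\<lambda>e. (3 * i e + 1, c e))
    (\<lambda>e. (3 * i e + c e mod 3, 3 * (c e div 3) + 1)) 2 (\<lambda>t e. turn (i e) (c e) t)"
proof -
  have eq: "i e = i f \<and> c e = c f" if "turn (i e) (c e) t = turn (i f) (c f) t" for t e f
  proof -
    consider "t = 0" | "t = 1" | "2 \<le> t" by linarith
    then show ?thesis
    proof cases
      case 1 then show ?thesis using that by (simp add: turn_def)
    next
      case 2
      then have "3 * i e + c e mod 3 = 3 * i f + c f mod 3" "c e = c f"
        using that by (auto simp: turn_def)
      then show ?thesis by simp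
    next
      case 3
      then have "3 * i e + c e mod 3 = 3 * i f + c f mod 3" "c e div 3 = c f div 3"
        using that by (auto simp: turn_def)
      then have "i e = i f" "c e mod 3 = c f mod 3" "c e div 3 = c f div 3"
        using block_eq by blast+
      then show ?thesis by (metis div_mult_mod_eq)
    qed
  qed
  show ?thesis
    unfolding mrpp_feasible_def
  proof (intro conjI allI impI)
    fix t e :: nat assume e: "e < n"
    obtain a b where ab: "m1 = 3 * a" "m2 = 3 * b" using assms(1,2) by (auto simp: dvd_def)
    then have "c e div 3 < b" "c e mod 3 < 3" "i e < a" using assms(3)[OF e] by auto
    then show "turn (i e) (c e) t \<in> grid_V m1 m2"
      using assms(3)[OF e] unfolding ab turn_def grid_V_def by auto
  next
    fix t assume "t \<le> (2 :: nat)"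
    show "inj_on (\<lambda>e. turn (i e) (c e) t) {0..<n}"
      using eq distinct by (intro inj_onI) (metis atLeastLessThan_iff)
  next
    fix t e assume t: "t < (2 :: nat)" and e: "e < n"
    have "t = 0 \<or> t = 1" using t by auto
    then show "turn (i e) (c e) (Suc t) = turn (i e) (c e) t \<or>
        grid_adj (turn (i e) (c e) t) (turn (i e) (c e) (Suc t))"
    proof
      assume "t = 0"
      have "c e mod 3 < 3" by simp
      then have "c e mod 3 = 0 \<or> c e mod 3 = 1 \<or> c e mod 3 = 2" by linarith
      then show ?thesis using \<open>t = 0\<close> by (auto simp: turn_def grid_adj_def)
    next
      assume "t = 1"
      have "c e = 3 * (c e div 3) + c e mod 3" "c e mod 3 < 3" by simp_all
      then have "c e = 3 * (c e div 3) \<or> c e = 3 * (c e div 3) + 1 \<or> c e = 3 * (c e div 3) + 2" by linarith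
      then show ?thesis using \<open>t = 1\<close> by (auto simp: turn_def grid_adj_def)
    qed
  next
    fix t e f assume *: "t < (2 :: nat)" "e < n" "f < n" "e \<noteq> f"
    show "\<not> (turn (i e) (c e) (Suc t) = turn (i f) (c f) t \<and> turn (i f) (c f) (Suc t) = turn (i e) (c e) t)"
    proof
      assume **: "turn (i e) (c e) (Suc t) = turn (i f) (c f) t \<and> turn (i f) (c f) (Suc t) = turn (i e) (c e) t"
      have "t = 0 \<or> t = 1" using *(1) by linarith
      then have "i e = i f \<and> c e = c f"
      proof
        assume "t = 0"
        then have "turn (i e) (c e) 1 = turn (i f) (c f) 0" using ** by simp
        then have "3 * i e + c e mod 3 = 3 * i f + 1 mod 3" "c e = c f" by (auto simp: turn_def)
        then show ?thesis using block_eq by blast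
      next
        assume "t = 1"
        then have 1: "3 * i e + c e mod 3 = 3 * i f + c f mod 3" "3 * (c e div 3) + 1 = c f"
          "3 * (c f div 3) + 1 = c e"
        proof -
          have "turn (i e) (c e) 2 = turn (i f) (c f) 1" "turn (i f) (c f) 2 = turn (i e) (c e) 1"
            using ** \<open>t = 1\<close> by (simp_all add: numeral_2_eq_2)
          then show "3 * i e + c e mod 3 = 3 * i f + c f mod 3" "3 * (c e div 3) + 1 = c f"
            "3 * (c f div 3) + 1 = c e" by (auto simp: turn_def)
        qed
        have "c f mod 3 = 1" "c f div 3 = c e div 3" unfolding 1(2)[symmetric] by simp_all
        moreover have "c e mod 3 = 1" unfolding 1(3)[symmetric] by simp
        ultimately show ?thesis using 1 block_eq[OF 1(1)] by metis
      qed
      then show False using distinct[of e f] * by blast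
    qed
  qed (auto simp: turn_def)
qed

section \<open>Counting residues\<close>

definition residues :: "nat \<Rightarrow> nat \<Rightarrow> nat \<Rightarrow> nat" where
  "residues p i N = cnt (\<lambda>j. j mod p = i) N"

lemma residues_eq: "i < p \<Longrightarrow> residues p i N = N div p + of_bool (i < N mod p)"
proof (induction N)
  case (Suc N)
  have "N mod p < p" using Suc.prems by simp
  then show ?case
    using Suc by (auto simp: residues_def cnt_Suc div_Suc mod_Suc split: if_splits)
qed (simp add: residues_def)

lemma residues_mono: "a \<le> b \<Longrightarrow> residues p i a \<le> residues p i b"
  unfolding residues_def by (rule cnt_mono)

lemma residues_add: "i < p \<Longrightarrow> residues p i (a + k * p) = residues p i a + k"
  by (simp add: residues_eq)

lemma sum_residues:
  assumes "0 < p"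
  shows "(\<Sum>i<p. residues p i N) = N"
proof -
  have "(\<Sum>i<p. residues p i N) = (\<Sum>i<p. N div p + of_bool (i < N mod p))"
    by (rule sum.cong) (auto simp: residues_eq)
  also have "\<dots> = p * (N div p) + (\<Sum>i<p. of_bool (i < N mod p))"
    by (simp add: sum.distrib)
  also have "(\<Sum>i<p. of_bool (i < N mod p)) = card {i. i < p \<and> i < N mod p}"
    using cnt_card[of "\<lambda>i. i < N mod p" p] by (simp only: cnt_def)
  also have "{i. i < p \<and> i < N mod p} = {..<N mod p}"
    using mod_less_divisor[OF assms, of N] by (auto intro: less_trans)
  finally show ?thesis by simp
qed

lemma residues_diff_le:
  assumes "i < p" "a \<le> b" "b \<le> a + k * p"
  shows "residues p i b - residues p i a \<le> k"
  using residues_mono[OF assms(3), of p i] residues_add[OF assms(1), of a k] by linarith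

lemma sum_residues_diff_ge:
  assumes "0 < p" "a \<le> b" "k \<le> l" "l \<le> p"
  shows "l - k \<le> (\<Sum>i=k..<l. residues p i b - residues p i a) + (p - (b - a))"
proof -
  \<comment> \<open>Completing the interval to a full period hits every residue at least once, and
    the added part can account for at most \<open>p - (b - a)\<close> of them.\<close>
  let ?c = "max b (a + p)"
  have "l - k = (\<Sum>i=k..<l. 1)" by simp
  also have "\<dots> \<le> (\<Sum>i=k..<l. (residues p i b - residues p i a) + (residues p i ?c - residues p i b))"
  proof (rule sum_mono)
    fix i assume "i \<in> {k..<l}"
    then have i: "i < p" using assms by auto
    have "residues p i a + 1 = residues p i (a + p)" using residues_add[OF i, of a 1] by simp
    also have "\<dots> \<le> residues p i ?c" by (rule residues_mono) simp
    finally show "1 \<le> (residues p i b - residues p i a) + (residues p i ?c - residues p i b)"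
      using residues_mono[OF assms(2), of p i] residues_mono[of b ?c p i] by linarith
  qed
  also have "\<dots> = (\<Sum>i=k..<l. residues p i b - residues p i a) +
      (\<Sum>i=k..<l. residues p i ?c - residues p i b)"
    by (rule sum.distrib)
  also have "(\<Sum>i=k..<l. residues p i ?c - residues p i b) \<le> (\<Sum>i<p. residues p i ?c - residues p i b)"
    by (rule sum_mono2) (use assms in auto)
  also have "(\<Sum>i<p. residues p i ?c - residues p i b) = (\<Sum>i<p. residues p i ?c) - (\<Sum>i<p. residues p i b)"
    by (rule sum_subtractf_nat) (simp add: residues_mono)
  also have "\<dots> = ?c - b" unfolding sum_residues[OF assms(1)] ..
  also have "?c - b \<le> p - (b - a)" using assms(2) by linarith
  finally show ?thesis by simp
qed

lemma cnt_from: "a \<le> b \<Longrightarrow> cnt (\<lambda>j. a \<le> j \<and> P j) b = cnt P b - cnt P a"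
proof (induction b rule: dec_induct)
  case base
  have "cnt (\<lambda>j. a \<le> j \<and> P j) a = cnt (\<lambda>j. False) a" by (rule cnt_cong) auto
  then show ?case by (simp add: cnt_def)
next
  case (step b)
  then show ?case using cnt_mono[of a b P] by (simp add: cnt_Suc)
qed

lemma cnt_blocks:
  assumes "\<And>i b. i < k \<Longrightarrow> b < 3 \<Longrightarrow> Z (3 * i + b) = (b < w i)" "\<And>i. i < k \<Longrightarrow> w i \<le> 3"
  shows "cnt Z (3 * k) = (\<Sum>i<k. w i)"
  using assms
proof (induction k)
  case (Suc k)
  have "cnt Z (3 * Suc k) = cnt Z (3 * k) + of_bool (Z (3 * k + 0)) + of_bool (Z (3 * k + 1))
      + of_bool (Z (3 * k + 2))"
    by (simp add: cnt_Suc numeral_3_eq_3)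
  also have "\<dots> = (\<Sum>i<k. w i) + (of_bool (0 < w k) + of_bool (1 < w k) + of_bool (2 < w k))"
    using Suc.IH Suc.prems(2) Suc.prems(1)[of k 0] Suc.prems(1)[of k 1] Suc.prems(1)[of k 2]
      Suc.prems(1) by simp
  also have "of_bool (0 < w k) + of_bool (1 < w k) + of_bool (2 < w k) = w k"
  proof -
    have "w k = 0 \<or> w k = 1 \<or> w k = 2 \<or> w k = 3" using Suc.prems(2)[of k] by linarith
    then show ?thesis by (elim disjE) simp_all
  qed
  finally show ?case by simp
qed simp

section \<open>Balancing a configuration\<close>

text \<open>Robot \<open>e\<close> stands in row \<open>sr e\<close> and column \<open>sc e\<close>, where \<open>m1\<close> is the number of rows. With
  \<open>p = m1 / 3\<close>, the ranks below \<open>p * m2\<close> are distributed over the columns: column \<open>c\<close> receives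
  the ranks from \<open>pre c\<close> to \<open>pre (c + 1)\<close>, at least as many as it has robots. The \<open>i\<close>-th triple
  of rows of the column offers one slot for each of its ranks congruent to \<open>i\<close> modulo \<open>p\<close>. Hence
  every triple of rows offers exactly \<open>m2\<close> slots altogether.\<close>

definition occ :: "nat \<Rightarrow> (nat \<Rightarrow> nat) \<Rightarrow> (nat \<Rightarrow> nat) \<Rightarrow> nat \<Rightarrow> nat \<Rightarrow> bool" where
  "occ n sr sc c r \<longleftrightarrow> (\<exists>e<n. sr e = r \<and> sc e = c)"

definition colcnt :: "nat \<Rightarrow> nat \<Rightarrow> (nat \<Rightarrow> nat) \<Rightarrow> (nat \<Rightarrow> nat) \<Rightarrow> nat \<Rightarrow> nat" where
  "colcnt m1 n sr sc c = cnt (occ n sr sc c) m1"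

text \<open>The first argument of \<open>min\<close> hands every column its share
  \<open>m1 div 3\<close>, or its number of robots if that is larger. The second keeps enough ranks
  in reserve for the robots of the columns from \<open>c\<close> on.\<close>

definition pre :: "nat \<Rightarrow> nat \<Rightarrow> nat \<Rightarrow> (nat \<Rightarrow> nat) \<Rightarrow> (nat \<Rightarrow> nat) \<Rightarrow> nat \<Rightarrow> nat" where
  "pre m1 m2 n sr sc c = min (\<Sum>b<c. max (colcnt m1 n sr sc b) (m1 div 3))
     (m1 div 3 * m2 - (\<Sum>b<m2. if c \<le> b then colcnt m1 n sr sc b else 0))"

definition quota :: "nat \<Rightarrow> nat \<Rightarrow> nat \<Rightarrow> (nat \<Rightarrow> nat) \<Rightarrow> (nat \<Rightarrow> nat) \<Rightarrow> nat \<Rightarrow> nat \<Rightarrow> nat" where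
  "quota m1 m2 n sr sc c i = cnt (\<lambda>j. pre m1 m2 n sr sc c \<le> j \<and> j mod (m1 div 3) = i)
     (pre m1 m2 n sr sc (Suc c))"

definition slot :: "nat \<Rightarrow> nat \<Rightarrow> nat \<Rightarrow> (nat \<Rightarrow> nat) \<Rightarrow> (nat \<Rightarrow> nat) \<Rightarrow> nat \<Rightarrow> nat \<Rightarrow> bool" where
  "slot m1 m2 n sr sc c r \<longleftrightarrow> r mod 3 < quota m1 m2 n sr sc c (r div 3)"

definition row1 :: "nat \<Rightarrow> nat \<Rightarrow> nat \<Rightarrow> (nat \<Rightarrow> nat) \<Rightarrow> (nat \<Rightarrow> nat) \<Rightarrow> nat \<Rightarrow> nat" where
  "row1 m1 m2 n sr sc e = pack m1 (occ n sr sc (sc e)) (slot m1 m2 n sr sc (sc e)) (sr e)"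

text \<open>A strip of three rows is traversed along a path that visits its columns one after the other.\<close>

definition snake :: "nat \<Rightarrow> nat \<Rightarrow> nat" where
  "snake r c = 3 * c + (if even c then r mod 3 else 2 - r mod 3)"

definition snakecell :: "nat \<Rightarrow> nat \<Rightarrow> nat \<times> nat" where
  "snakecell i x = (3 * i + (if even (x div 3) then x mod 3 else 2 - x mod 3), x div 3)"

definition snake1 :: "nat \<Rightarrow> nat \<Rightarrow> nat \<Rightarrow> (nat \<Rightarrow> nat) \<Rightarrow> (nat \<Rightarrow> nat) \<Rightarrow> nat \<Rightarrow> nat" where
  "snake1 m1 m2 n sr sc e = snake (row1 m1 m2 n sr sc e) (sc e)"

definition strip :: "nat \<Rightarrow> nat \<Rightarrow> nat \<Rightarrow> (nat \<Rightarrow> nat) \<Rightarrow> (nat \<Rightarrow> nat) \<Rightarrow> nat \<Rightarrow> nat" where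
  "strip m1 m2 n sr sc e = row1 m1 m2 n sr sc e div 3"

definition stripocc :: "nat \<Rightarrow> nat \<Rightarrow> nat \<Rightarrow> (nat \<Rightarrow> nat) \<Rightarrow> (nat \<Rightarrow> nat) \<Rightarrow> nat \<Rightarrow> nat \<Rightarrow> bool" where
  "stripocc m1 m2 n sr sc i x \<longleftrightarrow> (\<exists>e<n. strip m1 m2 n sr sc e = i \<and> snake1 m1 m2 n sr sc e = x)"

definition pos2 :: "nat \<Rightarrow> nat \<Rightarrow> nat \<Rightarrow> (nat \<Rightarrow> nat) \<Rightarrow> (nat \<Rightarrow> nat) \<Rightarrow> nat \<Rightarrow> nat" where
  "pos2 m1 m2 n sr sc e = pack (3 * m2) (stripocc m1 m2 n sr sc (strip m1 m2 n sr sc e))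
     (\<lambda>x. x mod 3 = 1) (snake1 m1 m2 n sr sc e)"

definition col2 :: "nat \<Rightarrow> nat \<Rightarrow> nat \<Rightarrow> (nat \<Rightarrow> nat) \<Rightarrow> (nat \<Rightarrow> nat) \<Rightarrow> nat \<Rightarrow> nat" where
  "col2 m1 m2 n sr sc e = pos2 m1 m2 n sr sc e div 3"

definition time1 :: "nat \<Rightarrow> nat \<Rightarrow> nat \<Rightarrow> (nat \<Rightarrow> nat) \<Rightarrow> (nat \<Rightarrow> nat) \<Rightarrow> nat" where
  "time1 m1 m2 n sr sc = bmax n (\<lambda>e. gap (sr e) (row1 m1 m2 n sr sc e))"

definition time2 :: "nat \<Rightarrow> nat \<Rightarrow> nat \<Rightarrow> (nat \<Rightarrow> nat) \<Rightarrow> (nat \<Rightarrow> nat) \<Rightarrow> nat" where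
  "time2 m1 m2 n sr sc = bmax n (\<lambda>e. gap (snake1 m1 m2 n sr sc e) (pos2 m1 m2 n sr sc e))"

lemma flip_less_3: "(if P then r mod 3 else 2 - r mod 3) < (3 :: nat)"
proof -
  have "2 - r mod 3 < (3 :: nat)" by (rule le_less_trans[OF diff_le_self]) simp
  then show ?thesis by (cases P) simp_all
qed

lemma snake_mod_div:
  "snake r c div 3 = c" "snake r c mod 3 = (if even c then r mod 3 else 2 - r mod 3)"
proof -
  note * = flip_less_3[of "even c" r]
  show "snake r c div 3 = c" "snake r c mod 3 = (if even c then r mod 3 else 2 - r mod 3)"
    unfolding snake_def
    by (subst div_mult_self4, simp, subst div_less[OF *], simp)
      (subst mod_mult_self4, rule mod_less[OF *])
qed

lemma snakecell_snake: "snakecell (r div 3) (snake r c) = (r, c)"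
proof -
  have "r mod 3 < 3" by simp
  then have "2 - (2 - r mod 3) = r mod 3" by linarith
  then show ?thesis unfolding snakecell_def snake_mod_div by simp
qed

lemma snakecell_inj:
  assumes "snakecell i x = snakecell j y"
  shows "i = j \<and> x = y"
proof -
  let ?f = "\<lambda>x :: nat. if even (x div 3) then x mod 3 else 2 - x mod 3"
  have d: "x div 3 = y div 3" and e: "3 * i + ?f x = 3 * j + ?f y"
    using assms unfolding snakecell_def prod.inject by blast+
  have "(3 * k + ?f z) div 3 = k" for k z
    by (subst div_mult_self4, simp, subst div_less[OF flip_less_3], simp)
  then have "(3 * i + ?f x) div 3 = i" "(3 * j + ?f y) div 3 = j" by blast+
  then have ij: "i = j" using e by metis
  then have f: "?f x = ?f y" using e by simp
  have "x mod 3 < 3" "y mod 3 < 3" by simp_all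
  then have "x mod 3 = y mod 3" using f d by (simp split: if_splits)
  then show ?thesis using ij d by (metis div_mult_mod_eq)
qed

lemma snakecell_adj: "grid_adj (snakecell i x) (snakecell i (Suc x))"
proof -
  define c where "c = x div 3"
  define b where "b = x mod 3"
  have x: "x = 3 * c + b" "b < 3" by (simp_all add: c_def b_def)
  have aux: "(3 * d + k) div 3 = d" "(3 * d + k) mod 3 = k" if "k < 3" for d k :: nat
    using that by simp_all
  have xc: "x div 3 = c" "x mod 3 = b" by (simp_all add: c_def b_def)
  have "b = 0 \<or> b = 1 \<or> b = 2" using x(2) by linarith
  then show ?thesis
  proof (elim disjE)
    assume b: "b = 0"
    then have S: "Suc x = 3 * c + 1" using x by simp
    have "Suc x div 3 = c" "Suc x mod 3 = 1" unfolding S by (rule aux; simp)+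
    then show ?thesis using xc b by (simp add: snakecell_def grid_adj_def)
  next
    assume b: "b = 1"
    then have S: "Suc x = 3 * c + 2" using x by simp
    have "Suc x div 3 = c" "Suc x mod 3 = 2" unfolding S by (rule aux; simp)+
    then show ?thesis using xc b by (simp add: snakecell_def grid_adj_def)
  next
    assume b: "b = 2"
    then have S: "Suc x = 3 * Suc c + 0" using x by simp
    have "Suc x div 3 = Suc c" "Suc x mod 3 = 0" unfolding S by (rule aux; simp)+
    then show ?thesis using xc b by (simp add: snakecell_def grid_adj_def)
  qed
qed

locale placement =
  fixes m1 m2 n :: nat and sr sc :: "nat \<Rightarrow> nat"
  assumes m1: "3 dvd m1" "0 < m1" and m2: "3 dvd m2"
    and bound: "\<And>e. e < n \<Longrightarrow> sr e < m1 \<and> sc e < m2"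
    and inj: "\<And>e f. e < n \<Longrightarrow> f < n \<Longrightarrow> sr e = sr f \<Longrightarrow> sc e = sc f \<Longrightarrow> e = f"
    and n: "3 * n \<le> m1 * m2"
begin

abbreviation "p \<equiv> m1 div 3"
abbreviation "OCC \<equiv> occ n sr sc"
abbreviation "CNT \<equiv> colcnt m1 n sr sc"
abbreviation "PRE \<equiv> pre m1 m2 n sr sc"
abbreviation "QUOTA \<equiv> quota m1 m2 n sr sc"
abbreviation "SLOT \<equiv> slot m1 m2 n sr sc"
abbreviation "ROW \<equiv> row1 m1 m2 n sr sc"
abbreviation "SNAKE \<equiv> snake1 m1 m2 n sr sc"
abbreviation "STRIP \<equiv> strip m1 m2 n sr sc"
abbreviation "SOCC \<equiv> stripocc m1 m2 n sr sc"
abbreviation "POS \<equiv> pos2 m1 m2 n sr sc"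
abbreviation "COL \<equiv> col2 m1 m2 n sr sc"

lemma m1_p: "m1 = 3 * p" and p_pos: "0 < p"
  using m1 by auto

lemma sum_colcnt: "(\<Sum>c<m2. CNT c) \<le> n"
proof -
  have "CNT c \<le> (\<Sum>e<n. of_bool (sc e = c))" for c
  proof -
    have "CNT c = card {r. r < m1 \<and> OCC c r}" by (simp add: colcnt_def cnt_card)
    also have "\<dots> \<le> card (sr ` {e. e < n \<and> sc e = c})"
      by (rule card_mono) (auto simp: occ_def)
    also have "\<dots> \<le> card {e. e < n \<and> sc e = c}" by (rule card_image_le) simp
    also have "\<dots> = (\<Sum>e<n. of_bool (sc e = c))"
      using cnt_card[of "\<lambda>e. sc e = c" n] by (simp only: cnt_def)
    finally show ?thesis .
  qed
  then have "(\<Sum>c<m2. CNT c) \<le> (\<Sum>c<m2. \<Sum>e<n. of_bool (sc e = c))" by (intro sum_mono) auto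
  also have "\<dots> = (\<Sum>e<n. \<Sum>c<m2. of_bool (sc e = c))" by (rule sum.swap)
  also have "\<dots> = (\<Sum>e<n. 1)"
  proof (rule sum.cong)
    fix e assume "e \<in> {..<n}"
    then have "sc e \<in> {..<m2}" using bound by auto
    then show "(\<Sum>c<m2. of_bool (sc e = c)) = (1 :: nat)" by (simp add: of_bool_def)
  qed simp
  finally show ?thesis by simp
qed

lemma n_le: "n \<le> p * m2"
proof -
  have "3 * n \<le> 3 * (p * m2)" using n m1_p by (metis mult.assoc)
  then show ?thesis by simp
qed

abbreviation "rest c \<equiv> (\<Sum>b<m2. if c \<le> b then CNT b else 0)"

lemma rest_Suc:
  assumes "c < m2"
  shows "rest c = CNT c + rest (Suc c)"
proof -
  have "rest c = (\<Sum>b<m2. (if c = b then CNT b else 0) + (if Suc c \<le> b then CNT b else 0))"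
    by (rule sum.cong) auto
  also have "\<dots> = (\<Sum>b<m2. if c = b then CNT b else 0) + rest (Suc c)" by (rule sum.distrib)
  also have "(\<Sum>b<m2. if c = b then CNT b else 0) = CNT c" using assms by simp
  finally show ?thesis .
qed

lemma rest_le: "rest c \<le> p * m2"
proof -
  have "rest c \<le> (\<Sum>b<m2. CNT b)" by (rule sum_mono) simp
  then show ?thesis using sum_colcnt n_le by linarith
qed

lemma pre_0: "PRE 0 = 0"
  by (simp add: pre_def)

lemma pre_Suc:
  assumes "c < m2"
  shows "PRE c + CNT c \<le> PRE (Suc c)" "PRE (Suc c) \<le> PRE c + max (CNT c) p"
proof -
  define A M where "A = (\<Sum>b<c. max (CNT b) p)" and "M = max (CNT c) p"
  have le: "CNT c + rest (Suc c) \<le> p * m2" "CNT c \<le> M"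
    using rest_Suc[OF assms] rest_le[of c] by (simp_all add: M_def)
  have 1: "PRE c = min A (p * m2 - (CNT c + rest (Suc c)))"
    unfolding pre_def A_def rest_Suc[OF assms] ..
  have 2: "PRE (Suc c) = min (A + M) (p * m2 - rest (Suc c))"
    unfolding pre_def A_def M_def by simp
  show "PRE c + CNT c \<le> PRE (Suc c)" "PRE (Suc c) \<le> PRE c + max (CNT c) p"
    unfolding 1 2 M_def[symmetric] using le by linarith+
qed

lemma pre_end: "PRE m2 = p * m2"
proof -
  have "(\<Sum>b<m2. p) \<le> (\<Sum>b<m2. max (CNT b) p)" by (rule sum_mono) simp
  moreover have "rest m2 = 0" by simp
  ultimately show ?thesis by (simp add: pre_def mult.commute)
qed

lemma colcnt_le: "CNT c \<le> 3 * p"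
  using cnt_le[of "OCC c" m1] m1_p by (simp add: colcnt_def)

lemma quota_residues:
  assumes "c < m2"
  shows "QUOTA c i = residues p i (PRE (Suc c)) - residues p i (PRE c)"
proof -
  have "PRE c \<le> PRE (Suc c)" using pre_Suc(1)[OF assms] by linarith
  from cnt_from[OF this] show ?thesis by (simp add: quota_def residues_def)
qed

text \<open>A column receives at most \<open>3 * p\<close> consecutive ranks, so each residue occurs
  at most three times among them and its slots fit into the three cells of the triple.\<close>

lemma quota_le_3:
  assumes "c < m2" "i < p"
  shows "QUOTA c i \<le> 3"
proof -
  have "PRE (Suc c) \<le> PRE c + 3 * p" using pre_Suc(2)[OF assms(1)] colcnt_le[of c] by linarith
  then show ?thesis
    unfolding quota_residues[OF assms(1)]
    using pre_Suc(1)[OF assms(1)] by (intro residues_diff_le assms(2)) auto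
qed

lemma cnt_slot:
  assumes "c < m2" "k \<le> p"
  shows "cnt (SLOT c) (3 * k) = (\<Sum>i<k. QUOTA c i)"
  by (rule cnt_blocks) (use assms quota_le_3 in \<open>auto simp: slot_def\<close>)

lemma cnt_slot_all:
  assumes "c < m2"
  shows "cnt (SLOT c) m1 = PRE (Suc c) - PRE c"
proof -
  have "cnt (SLOT c) m1 = (\<Sum>i<p. residues p i (PRE (Suc c)) - residues p i (PRE c))"
    using cnt_slot[OF assms order_refl] m1_p quota_residues[OF assms] by simp
  also have "\<dots> = (\<Sum>i<p. residues p i (PRE (Suc c))) - (\<Sum>i<p. residues p i (PRE c))"
    by (rule sum_subtractf_nat) (use pre_Suc(1)[OF assms] in \<open>auto intro: residues_mono\<close>)
  finally show ?thesis by (simp add: sum_residues[OF p_pos])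
qed

lemma occ_le_slot: "c < m2 \<Longrightarrow> cnt (OCC c) m1 \<le> cnt (SLOT c) m1"
  using cnt_slot_all[of c] pre_Suc(1)[of c] by (simp add: colcnt_def)

lemma row1:
  assumes "e < n"
  shows "ROW e < m1" "SLOT (sc e) (ROW e)"
proof -
  have "sc e < m2" "sr e < m1" "OCC (sc e) (sr e)"
    using bound[OF assms] assms by (auto simp: occ_def)
  from pack_slot[OF occ_le_slot[OF this(1)] this(2,3)]
  show "ROW e < m1" "SLOT (sc e) (ROW e)" unfolding row1_def by blast+
qed

lemma row1_less:
  assumes "e < n" "f < n" "sc e = sc f" "sr e < sr f"
  shows "ROW e < ROW f"
proof -
  have "OCC (sc e) (sr e)" "OCC (sc e) (sr f)" using assms by (auto simp: occ_def)
  then show ?thesis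
    unfolding row1_def assms(3)[symmetric]
    using pack_less[OF occ_le_slot, of "sc e" "sr e" "sr f"] bound[OF assms(1)] bound[OF assms(2)]
      assms(4) by blast
qed

lemma row1_inj:
  assumes "e < n" "f < n" "ROW e = ROW f" "sc e = sc f"
  shows "e = f"
  using row1_less[of e f] row1_less[of f e] inj[of e f] assms by (metis less_irrefl linorder_neqE_nat)

lemma strip_less: "e < n \<Longrightarrow> STRIP e < p"
  using row1(1)[of e] m1_p unfolding strip_def by (simp add: less_mult_imp_div_less mult.commute)

lemma snake1_div: "SNAKE e div 3 = sc e"
  and snake1_mod: "SNAKE e mod 3 = (if even (sc e) then ROW e mod 3 else 2 - ROW e mod 3)"
  unfolding snake1_def by (rule snake_mod_div)+

lemma snake1_less:
  assumes "e < n"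
  shows "SNAKE e < 3 * m2"
proof -
  have "SNAKE e div 3 < m2" using bound[OF assms] by (simp add: snake1_div)
  then show ?thesis by simp
qed

lemma snake1_inj:
  assumes "e < n" "f < n" "STRIP e = STRIP f" "SNAKE e = SNAKE f"
  shows "e = f"
proof -
  have "(ROW e, sc e) = (ROW f, sc f)"
    using snakecell_snake[of "ROW e" "sc e"] snakecell_snake[of "ROW f" "sc f"] assms(3,4)
    unfolding strip_def snake1_def by metis
  then show ?thesis using row1_inj assms(1,2) by simp
qed

text \<open>Inside column \<open>c\<close>, the robots of strip \<open>i\<close> stand in distinct
  cells, and the row residue of each is below the quota.\<close>

lemma cnt_stripocc_step:
  assumes "c < m2"
  shows "cnt (SOCC i) (3 * Suc c) \<le> cnt (SOCC i) (3 * c) + QUOTA c i"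
proof -
  have "cnt (\<lambda>x. 3 * c \<le> x \<and> SOCC i x) (3 * Suc c) \<le> card {..<QUOTA c i}"
    unfolding cnt_card
  proof (rule card_inj_on_le)
    let ?f = "\<lambda>x. if even c then x mod 3 else 2 - x mod 3"
    let ?A = "{x. x < 3 * Suc c \<and> 3 * c \<le> x \<and> SOCC i x}"
    show "inj_on ?f ?A"
    proof (rule inj_onI)
      fix x y assume *: "x \<in> ?A" "y \<in> ?A" "?f x = ?f y"
      have "x mod 3 < 3" "y mod 3 < 3" by simp_all
      then have "x mod 3 = y mod 3" using *(3) by (simp split: if_splits)
      moreover have "x div 3 = c" "y div 3 = c" using *(1,2) by auto
      ultimately show "x = y" by (metis div_mult_mod_eq)
    qed
    show "?f ` ?A \<subseteq> {..<QUOTA c i}"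
    proof
      fix y assume "y \<in> ?f ` ?A"
      then obtain x where "y = ?f x" "x \<in> ?A" by (rule imageE)
      then have x: "x < 3 * Suc c" "3 * c \<le> x" "SOCC i x" "y = ?f x" by simp_all
      then obtain e where e: "e < n" "STRIP e = i" "SNAKE e = x" by (auto simp: stripocc_def)
      have xc: "x div 3 = c" using x by auto
      then have sc: "sc e = c" using snake1_div[of e] e(3) by metis
      have xm: "x mod 3 = (if even c then ROW e mod 3 else 2 - ROW e mod 3)"
        using snake1_mod[of e] unfolding e(3) sc .
      have "ROW e mod 3 < 3" by simp
      then have "y = ROW e mod 3" unfolding x(4) xm by simp
      moreover have "ROW e mod 3 < QUOTA c i"
        using row1(2)[OF e(1)] e(2) sc by (simp add: slot_def strip_def)
      ultimately show "y \<in> {..<QUOTA c i}" by simp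
    qed
  qed simp
  then show ?thesis using cnt_from[of "3 * c" "3 * Suc c" "SOCC i"] by simp
qed

lemma cnt_stripocc_diff:
  assumes "i < p" "a \<le> b" "b \<le> m2"
  shows "cnt (SOCC i) (3 * b) - cnt (SOCC i) (3 * a) \<le> residues p i (PRE b) - residues p i (PRE a)"
proof -
  have "PRE a \<le> PRE b \<and> cnt (SOCC i) (3 * b) + residues p i (PRE a) \<le>
    cnt (SOCC i) (3 * a) + residues p i (PRE b)"
    using assms(2,3)
  proof (induction b rule: dec_induct)
    case (step b)
    then have b: "b < m2" by simp
    have "residues p i (PRE b) \<le> residues p i (PRE (Suc b))"
      using pre_Suc(1)[OF b] by (intro residues_mono) simp
    then show ?case
      using step cnt_stripocc_step[OF b, of i] pre_Suc(1)[OF b] quota_residues[OF b, of i] by linarith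
  qed simp
  then show ?thesis by linarith
qed

lemma cnt_mod_1: "cnt (\<lambda>x. x mod 3 = 1) (3 * k) = k"
  using cnt_blocks[of k "\<lambda>x. x mod 3 = 1" "\<lambda>i. 1"] residues_eq[of 1 3 "3 * k"]
  by (simp add: residues_def)

text \<open>The ranks handed out are exactly those below \<open>p * m2\<close>, and each residue
  modulo \<open>p\<close> occurs \<open>m2\<close> times among them. The middle row of a strip
  therefore has room for all its robots.\<close>

lemma stripocc_le:
  assumes "i < p"
  shows "cnt (SOCC i) (3 * m2) \<le> cnt (\<lambda>x. x mod 3 = 1) (3 * m2)"
proof -
  have "residues p i (p * m2) = m2" using residues_add[OF assms, of 0 m2]
    by (simp add: residues_def mult.commute)
  then show ?thesis
    using cnt_stripocc_diff[OF assms, of 0 m2] unfolding cnt_mod_1 pre_0 pre_end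
    by (simp add: residues_def)
qed

lemma pos2:
  assumes "e < n"
  shows "POS e < 3 * m2" "POS e mod 3 = 1"
proof -
  have "SOCC (STRIP e) (SNAKE e)" using assms by (auto simp: stripocc_def)
  from pack_slot[OF stripocc_le[OF strip_less[OF assms]] snake1_less[OF assms] this]
  show "POS e < 3 * m2" "POS e mod 3 = 1" unfolding pos2_def by blast+
qed

lemma pos2_less:
  assumes "e < n" "f < n" "STRIP e = STRIP f" "SNAKE e < SNAKE f"
  shows "POS e < POS f"
proof -
  have "SOCC (STRIP e) (SNAKE e)" "SOCC (STRIP e) (SNAKE f)" using assms by (auto simp: stripocc_def)
  then show ?thesis
    unfolding pos2_def assms(3)[symmetric]
    using pack_less[OF stripocc_le[OF strip_less[OF assms(1)]] assms(4) snake1_less[OF assms(2)]]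
    by blast
qed

lemma col2_less: "e < n \<Longrightarrow> COL e < m2"
  using pos2(1)[of e] unfolding col2_def by (simp add: less_mult_imp_div_less mult.commute)

lemma col2_inj:
  assumes "e < n" "f < n" "STRIP e = STRIP f" "COL e = COL f"
  shows "e = f"
proof -
  have "POS e = POS f"
    using assms(4) pos2(2)[OF assms(1)] pos2(2)[OF assms(2)] unfolding col2_def
    by (metis div_mult_mod_eq)
  then show ?thesis
    using pos2_less[of e f] pos2_less[of f e] snake1_inj[of e f] assms
    by (metis less_irrefl linorder_neqE_nat)
qed

text \<open>After balancing, the robots of a strip have distinct columns. This is the degree bound
  needed for colouring with \<open>m2\<close> colours.\<close>

lemma strip_degree: "card {e. e < n \<and> STRIP e = x} \<le> m2"
proof -
  have "card {e. e < n \<and> STRIP e = x} \<le> card {..<m2}"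
  proof (rule card_inj_on_le)
    show "inj_on COL {e. e < n \<and> STRIP e = x}"
    proof (rule inj_onI)
      fix e f assume "e \<in> {e. e < n \<and> STRIP e = x}" "f \<in> {e. e < n \<and> STRIP e = x}" "COL e = COL f"
      then show "e = f" using col2_inj[of e f] by simp
    qed
    show "COL ` {e. e < n \<and> STRIP e = x} \<subseteq> {..<m2}" using col2_less by auto
  qed simp
  then show ?thesis by simp
qed

end

definition half :: "nat \<Rightarrow> nat \<Rightarrow> nat \<Rightarrow> (nat \<Rightarrow> nat) \<Rightarrow> (nat \<Rightarrow> nat) \<Rightarrow> (nat \<Rightarrow> nat) \<Rightarrow> nat \<Rightarrow> nat \<Rightarrow> nat \<times> nat" where
  "half m1 m2 n sr sc k t e =
     (if t < time1 m1 m2 n sr sc then (clip (sr e) (row1 m1 m2 n sr sc e) t, sc e)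
      else if t - time1 m1 m2 n sr sc < time2 m1 m2 n sr sc then
        snakecell (strip m1 m2 n sr sc e)
          (clip (snake1 m1 m2 n sr sc e) (pos2 m1 m2 n sr sc e) (t - time1 m1 m2 n sr sc))
      else if t - time1 m1 m2 n sr sc - time2 m1 m2 n sr sc < m2 + 1 then
        (3 * strip m1 m2 n sr sc e +
           lane (col2 m1 m2 n sr sc e) (k e) (t - time1 m1 m2 n sr sc - time2 m1 m2 n sr sc),
         clip (col2 m1 m2 n sr sc e) (k e) (t - time1 m1 m2 n sr sc - time2 m1 m2 n sr sc - 1))
      else turn (strip m1 m2 n sr sc e) (k e)
        (t - time1 m1 m2 n sr sc - time2 m1 m2 n sr sc - (m2 + 1)))"

definition half_time :: "nat \<Rightarrow> nat \<Rightarrow> nat \<Rightarrow> (nat \<Rightarrow> nat) \<Rightarrow> (nat \<Rightarrow> nat) \<Rightarrow> nat" where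
  "half_time m1 m2 n sr sc = time1 m1 m2 n sr sc + (time2 m1 m2 n sr sc + (m2 + 1 + 2))"

lemma mrpp_feasible_cong:
  assumes "mrpp_feasible m1 m2 n s g T P" "\<And>i. i < n \<Longrightarrow> s i = s' i" "\<And>i. i < n \<Longrightarrow> g i = g' i"
  shows "mrpp_feasible m1 m2 n s' g' T P"
  using assms unfolding mrpp_feasible_def by simp

context placement
begin

text \<open>The only property of \<open>k\<close> used is that robots of one strip get distinct
  values. The same \<open>k\<close> therefore serves both halves of the plan, the goal half being
  run backwards.\<close>

theorem half_feasible:
  assumes k: "\<And>e. e < n \<Longrightarrow> k e < m2"
    and kd: "\<And>e f. e < n \<Longrightarrow> f < n \<Longrightarrow> e \<noteq> f \<Longrightarrow> STRIP e = STRIP f \<Longrightarrow> k e \<noteq> k f"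
  shows "mrpp_feasible m1 m2 n (\<lambda>e. (sr e, sc e))
    (\<lambda>e. (3 * STRIP e + k e mod 3, 3 * (k e div 3) + 1))
    (half_time m1 m2 n sr sc) (half m1 m2 n sr sc k)"
proof -
  let ?T1 = "time1 m1 m2 n sr sc" and ?T2 = "time2 m1 m2 n sr sc"
  have S: "3 * STRIP e + 2 < m1" if "e < n" for e using strip_less[OF that] m1_p by linarith
  have 1: "mrpp_feasible m1 m2 n (\<lambda>e. (sr e, sc e)) (\<lambda>e. (ROW e, sc e)) ?T1
    (\<lambda>t e. (clip (sr e) (ROW e) t, sc e))"
  proof (rule path_motion[where cell = "\<lambda>l p. (p, l)" and l = sc and L = m1])
    fix e assume e: "e < n"
    show "sr e < m1 \<and> ROW e < m1" using bound[OF e] row1(1)[OF e] by simp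
    show "gap (sr e) (ROW e) \<le> ?T1" unfolding time1_def by (rule bmax_ge[OF e])
    show "(p, sc e) \<in> grid_V m1 m2" if "p < m1" for p
      using bound[OF e] that by (simp add: grid_V_def)
    show "grid_adj (p, sc e) (Suc p, sc e)" for p by (simp add: grid_adj_def)
    fix f assume f: "f < n"
    show "sc e = sc f \<and> p = q" if "(p, sc e) = (q, sc f)" for p q using that by simp
    assume "e \<noteq> f" "sc e = sc f"
    then have "sr e \<noteq> sr f" using inj[OF e f] by blast
    then show "(sr e < sr f \<and> ROW e < ROW f) \<or> (sr f < sr e \<and> ROW f < ROW e)"
      using row1_less[OF e f] row1_less[OF f e] \<open>sc e = sc f\<close> by (metis linorder_neqE_nat)
  qed
  have 2: "mrpp_feasible m1 m2 n (\<lambda>e. (ROW e, sc e)) (\<lambda>e. (3 * STRIP e + 1, COL e)) ?T2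
    (\<lambda>t e. snakecell (STRIP e) (clip (SNAKE e) (POS e) t))"
  proof (rule mrpp_feasible_cong)
    show "mrpp_feasible m1 m2 n (\<lambda>e. snakecell (STRIP e) (SNAKE e)) (\<lambda>e. snakecell (STRIP e) (POS e)) ?T2
      (\<lambda>t e. snakecell (STRIP e) (clip (SNAKE e) (POS e) t))"
    proof (rule path_motion[where L = "3 * m2"])
      fix e assume e: "e < n"
      show "SNAKE e < 3 * m2 \<and> POS e < 3 * m2" using snake1_less[OF e] pos2(1)[OF e] by simp
      show "gap (SNAKE e) (POS e) \<le> ?T2" unfolding time2_def by (rule bmax_ge[OF e])
      show "snakecell (STRIP e) p \<in> grid_V m1 m2" if "p < 3 * m2" for p
      proof -
        have "p div 3 < m2" using that by (simp add: less_mult_imp_div_less mult.commute)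
        moreover have "(if even (p div 3) then p mod 3 else 2 - p mod 3) < 3"
          by (rule flip_less_3)
        ultimately show ?thesis using S[OF e] unfolding snakecell_def grid_V_def
          by (simp only: mem_Times_iff fst_conv snd_conv atLeastLessThan_iff)
            (intro conjI; (rule TrueI | linarith))
      qed
      show "grid_adj (snakecell (STRIP e) p) (snakecell (STRIP e) (Suc p))" for p
        by (rule snakecell_adj)
      fix f assume f: "f < n"
      show "STRIP e = STRIP f \<and> p = q" if "snakecell (STRIP e) p = snakecell (STRIP f) q" for p q
        by (rule snakecell_inj[OF that])
      assume "e \<noteq> f" "STRIP e = STRIP f"
      then have "SNAKE e \<noteq> SNAKE f" using snake1_inj[OF e f] by blast
      then show "(SNAKE e < SNAKE f \<and> POS e < POS f) \<or> (SNAKE f < SNAKE e \<and> POS f < POS e)"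
        using pos2_less[OF e f] pos2_less[OF f e] \<open>STRIP e = STRIP f\<close> by (metis linorder_neqE_nat)
    qed
  next
    fix e assume e: "e < n"
    show "snakecell (STRIP e) (SNAKE e) = (ROW e, sc e)"
      unfolding strip_def snake1_def by (rule snakecell_snake)
    show "snakecell (STRIP e) (POS e) = (3 * STRIP e + 1, COL e)"
      unfolding snakecell_def pos2(2)[OF e] col2_def by simp
  qed
  have 3: "mrpp_feasible m1 m2 n (\<lambda>e. (3 * STRIP e + 1, COL e)) (\<lambda>e. (3 * STRIP e + 1, k e)) (m2 + 1)
    (\<lambda>t e. (3 * STRIP e + lane (COL e) (k e) t, clip (COL e) (k e) (t - 1)))"
  proof (rule lane_motion[where cell = "\<lambda>i b x. (3 * i + b, x)" and l = STRIP])
    fix e assume e: "e < n"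
    show "COL e < m2 \<and> k e < m2" using col2_less[OF e] k[OF e] by simp
    show "(3 * STRIP e + b, x) \<in> grid_V m1 m2" if "b < 3" "x < m2" for b x
      using S[OF e] that by (simp add: grid_V_def)
    fix f assume f: "f < n"
    show "STRIP e = STRIP f \<and> b = d \<and> x = y"
      if bd: "b < 3" "d < 3" and eq: "(3 * STRIP e + b, x) = (3 * STRIP f + d, y)" for b d x y
    proof -
      have "3 * STRIP e + b mod 3 = 3 * STRIP f + d mod 3" using eq bd by simp
      from block_eq[OF this] show ?thesis using eq bd by simp
    qed
    assume "e \<noteq> f" "STRIP e = STRIP f"
    then show "COL e \<noteq> COL f \<and> k e \<noteq> k f" using col2_inj[OF e f] kd[OF e f] by blast
  qed (simp_all add: grid_adj_def)
  have 4: "mrpp_feasible m1 m2 n (\<lambda>e. (3 * STRIP e + 1, k e))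
    (\<lambda>e. (3 * STRIP e + k e mod 3, 3 * (k e div 3) + 1)) 2 (\<lambda>t e. turn (STRIP e) (k e) t)"
  proof (rule turn_motion[OF m1(1) m2])
    show "3 * STRIP e < m1 \<and> k e < m2" if "e < n" for e using S[OF that] k[OF that] by simp
  qed (rule kd)
  have *: "half m1 m2 n sr sc k =
    (\<lambda>t. if t < ?T1 then (\<lambda>e. (clip (sr e) (ROW e) t, sc e))
       else (\<lambda>t. if t < ?T2 then (\<lambda>e. snakecell (STRIP e) (clip (SNAKE e) (POS e) t))
         else (\<lambda>t. if t < m2 + 1 then (\<lambda>e. (3 * STRIP e + lane (COL e) (k e) t, clip (COL e) (k e) (t - 1)))
           else (\<lambda>t e. turn (STRIP e) (k e) t) (t - (m2 + 1))) (t - ?T2)) (t - ?T1))"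
    by (intro ext) (simp only: half_def split: if_split, simp)
  show ?thesis
    unfolding * half_time_def
    by (rule mrpp_feasible_append[OF 1 mrpp_feasible_append[OF 2 mrpp_feasible_append[OF 3 4]]])
qed

end

definition plan :: "nat \<Rightarrow> nat \<Rightarrow> nat \<Rightarrow> (nat \<Rightarrow> nat) \<Rightarrow> (nat \<Rightarrow> nat) \<Rightarrow> (nat \<Rightarrow> nat) \<Rightarrow> (nat \<Rightarrow> nat) \<Rightarrow>
    (nat \<Rightarrow> nat) \<Rightarrow> nat \<Rightarrow> nat \<Rightarrow> nat \<times> nat" where
  "plan m1 m2 n sr sc gr gc k t e =
     (if t < half_time m1 m2 n sr sc then half m1 m2 n sr sc k t e
      else if t - half_time m1 m2 n sr sc < m1 + 1 then
        (clip (3 * strip m1 m2 n sr sc e + k e mod 3) (3 * strip m1 m2 n gr gc e + k e mod 3)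
           (t - half_time m1 m2 n sr sc - 1),
         3 * (k e div 3) + lane (3 * strip m1 m2 n sr sc e + k e mod 3)
           (3 * strip m1 m2 n gr gc e + k e mod 3) (t - half_time m1 m2 n sr sc))
      else half m1 m2 n gr gc k
        (half_time m1 m2 n gr gc - (t - half_time m1 m2 n sr sc - (m1 + 1))) e)"

definition plan_time :: "nat \<Rightarrow> nat \<Rightarrow> nat \<Rightarrow> (nat \<Rightarrow> nat) \<Rightarrow> (nat \<Rightarrow> nat) \<Rightarrow> (nat \<Rightarrow> nat) \<Rightarrow> (nat \<Rightarrow> nat) \<Rightarrow> nat" where
  "plan_time m1 m2 n sr sc gr gc = half_time m1 m2 n sr sc + (m1 + 1 + half_time m1 m2 n gr gc)"

text \<open>Both halves end in the same middle columns \<open>3 * (k e div 3) + 1\<close>, so only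
  rows remain to be changed. Two robots of one column block share a start row or a target row only
  if they agree in the strip and in \<open>k mod 3\<close>, hence in the whole colour, which
  properness excludes.\<close>

theorem plan_feasible:
  assumes S: "placement m1 m2 n sr sc" and G: "placement m1 m2 n gr gc"
    and k: "\<And>e. e < n \<Longrightarrow> k e < m2"
    and ks: "\<And>e f. e < n \<Longrightarrow> f < n \<Longrightarrow> e \<noteq> f \<Longrightarrow> k e = k f \<Longrightarrow>
      strip m1 m2 n sr sc e \<noteq> strip m1 m2 n sr sc f \<and> strip m1 m2 n gr gc e \<noteq> strip m1 m2 n gr gc f"
  shows "mrpp_feasible m1 m2 n (\<lambda>e. (sr e, sc e)) (\<lambda>e. (gr e, gc e))
    (plan_time m1 m2 n sr sc gr gc) (plan m1 m2 n sr sc gr gc k)"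
proof -
  interpret S: placement m1 m2 n sr sc by (rule S)
  interpret G: placement m1 m2 n gr gc by (rule G)
  let ?u = "strip m1 m2 n sr sc" and ?v = "strip m1 m2 n gr gc"
  let ?x = "\<lambda>e. 3 * ?u e + k e mod 3" and ?y = "\<lambda>e. 3 * ?v e + k e mod 3"
  have 1: "mrpp_feasible m1 m2 n (\<lambda>e. (sr e, sc e)) (\<lambda>e. (?x e, 3 * (k e div 3) + 1))
    (half_time m1 m2 n sr sc) (half m1 m2 n sr sc k)"
    by (rule S.half_feasible[OF k]) (use ks in blast)+
  have 3: "mrpp_feasible m1 m2 n (\<lambda>e. (gr e, gc e)) (\<lambda>e. (?y e, 3 * (k e div 3) + 1))
    (half_time m1 m2 n gr gc) (half m1 m2 n gr gc k)"
    by (rule G.half_feasible[OF k]) (use ks in blast)+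
  have 2: "mrpp_feasible m1 m2 n (\<lambda>e. (?x e, 3 * (k e div 3) + 1)) (\<lambda>e. (?y e, 3 * (k e div 3) + 1))
    (m1 + 1) (\<lambda>t e. (clip (?x e) (?y e) (t - 1), 3 * (k e div 3) + lane (?x e) (?y e) t))"
  proof (rule lane_motion[where cell = "\<lambda>j b x. (x, 3 * j + b)" and l = "\<lambda>e. k e div 3"])
    fix e assume e: "e < n"
    have "k e mod 3 < 3" by simp
    then show "?x e < m1 \<and> ?y e < m1"
      using S.strip_less[OF e] G.strip_less[OF e] S.m1_p by linarith
    show "(x, 3 * (k e div 3) + b) \<in> grid_V m1 m2" if "b < 3" "x < m1" for b x
    proof -
      obtain q where q: "m2 = 3 * q" using S.m2 by (auto simp: dvd_def)
      have "k e div 3 < q" using k[OF e] q by (simp add: less_mult_imp_div_less mult.commute)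
      then show ?thesis using that q by (simp add: grid_V_def)
    qed
    fix f assume f: "f < n"
    show "k e div 3 = k f div 3 \<and> b = d \<and> x = y"
      if bd: "b < 3" "d < 3" and eq: "(x, 3 * (k e div 3) + b) = (y, 3 * (k f div 3) + d)" for b d x y
    proof -
      have "3 * (k e div 3) + b mod 3 = 3 * (k f div 3) + d mod 3" using eq bd by simp
      from block_eq[OF this] show ?thesis using eq bd by simp
    qed
    assume ef: "e \<noteq> f" "k e div 3 = k f div 3"
    have m: "k e mod 3 = k f mod 3 \<Longrightarrow> k e = k f" using ef(2) by (metis div_mult_mod_eq)
    show "?x e \<noteq> ?x f \<and> ?y e \<noteq> ?y f"
    proof
      show "?x e \<noteq> ?x f" using block_eq[of "?u e" "k e" "?u f" "k f"] m ks[OF e f ef(1)] by blast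
      show "?y e \<noteq> ?y f" using block_eq[of "?v e" "k e" "?v f" "k f"] m ks[OF e f ef(1)] by blast
    qed
  qed (simp_all add: grid_adj_def)
  have *: "plan m1 m2 n sr sc gr gc k =
    (\<lambda>t. if t < half_time m1 m2 n sr sc then half m1 m2 n sr sc k t
       else (\<lambda>t. if t < m1 + 1 then (\<lambda>e. (clip (?x e) (?y e) (t - 1), 3 * (k e div 3) + lane (?x e) (?y e) t))
         else (\<lambda>t. half m1 m2 n gr gc k (half_time m1 m2 n gr gc - t)) (t - (m1 + 1)))
           (t - half_time m1 m2 n sr sc))"
    by (intro ext) (simp only: plan_def split: if_split, simp)
  show ?thesis
    unfolding * plan_time_def
    by (rule mrpp_feasible_append[OF 1 mrpp_feasible_append[OF 2 mrpp_feasible_reverse[OF 3]]])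
qed

section \<open>The makespan for evenly spread configurations\<close>

text \<open>The assumptions bound the deviation of counts by \<open>d\<close>: \<open>upper\<close>
  is density 1/3 multiplied out by 3, and \<open>column\<close> compares the number of robots in a
  column with the average \<open>n / m2\<close>, multiplied out by \<open>m2\<close>.\<close>

locale even_placement = placement +
  fixes d :: nat
  assumes m21: "m2 \<le> m1"
    and upper: "\<And>c a b. c < m2 \<Longrightarrow> a \<le> b \<Longrightarrow> b \<le> m1 \<Longrightarrow>
       3 * (cnt (OCC c) b - cnt (OCC c) a) \<le> (b - a) + 3 * d"
    and column: "\<And>c. c < m2 \<Longrightarrow> n \<le> m2 * (CNT c + d)" "\<And>c. c < m2 \<Longrightarrow> CNT c * m2 \<le> n + d * m2"
begin

lemma colcnt_upper: "c < m2 \<Longrightarrow> CNT c \<le> p + d"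
  using upper[of c 0 m1] m1_p unfolding colcnt_def by simp

text \<open>If some column has more than \<open>p\<close> robots, the average exceeds
  \<open>p - d\<close>, so every column has more than \<open>p - 2 * d\<close> robots of its own.
  Otherwise both arguments of the \<open>min\<close> in \<open>pre\<close> are at least
  \<open>p\<close> per column, and every column gets exactly \<open>p\<close> ranks.\<close>

lemma pre_gap:
  assumes c: "c < m2"
  shows "p \<le> PRE (Suc c) - PRE c + 2 * d"
proof (cases "\<exists>b<m2. p < CNT b")
  case True
  then obtain b where b: "b < m2" "p < CNT b" by blast
  have "p * m2 < CNT b * m2" using b by simp
  also have "\<dots> \<le> n + d * m2" by (rule column(2)[OF b(1)])
  also have "\<dots> \<le> m2 * (CNT c + d) + d * m2" using column(1)[OF c] by simp
  also have "\<dots> = (CNT c + 2 * d) * m2" by (simp add: algebra_simps)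
  finally have "p < CNT c + 2 * d" by simp
  then show ?thesis using pre_Suc(1)[OF c] by linarith
next
  case False
  then have le: "CNT b \<le> p" if "b < m2" for b using that by (meson not_less)
  have "PRE a = p * a" if "a \<le> m2" for a
  proof -
    have "(\<Sum>b<a. max (CNT b) p) = (\<Sum>b<a. p)"
      using le that by (intro sum.cong) (auto simp: max_absorb2)
    moreover have "rest a \<le> p * (m2 - a)"
    proof -
      have "rest a = (\<Sum>b\<in>{..<m2} \<inter> {b. a \<le> b}. CNT b)" by (simp add: sum.If_cases)
      also have "{..<m2} \<inter> {b. a \<le> b} = {a..<m2}" by auto
      also have "(\<Sum>b\<in>{a..<m2}. CNT b) \<le> (\<Sum>b\<in>{a..<m2}. p)"
        using le by (intro sum_mono) auto
      finally show ?thesis by (simp add: mult.commute)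
    qed
    moreover have "p * a + p * (m2 - a) = p * m2" using that by (simp add: add_mult_distrib2[symmetric])
    ultimately show ?thesis unfolding pre_def by (simp add: mult.commute) linarith
  qed
  from this[of c] this[of "Suc c"] c show ?thesis by simp
qed

text \<open>Rounding to whole triples costs 2 rows at each end, hence the 4. A column lacking at
  most \<open>2 * d\<close> ranks misses at most that many triples, of three rows each, hence
  \<open>6 * d\<close>.\<close>

lemma slot_density:
  assumes c: "c < m2" and xy: "x \<le> y" "y \<le> m1"
  shows "y - x \<le> 3 * (cnt (SLOT c) y - cnt (SLOT c) x) + (6 * d + 4)"
proof -
  define k l where "k = (x + 2) div 3" and "l = y div 3"
  have k: "x \<le> 3 * k" "3 * k \<le> x + 2" and l: "3 * l \<le> y" "y \<le> 3 * l + 2"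
    unfolding k_def l_def by linarith+
  show ?thesis
  proof (cases "k \<le> l")
    case True
    have lp: "l \<le> p" using l(1) xy(2) m1_p by linarith
    have ge: "PRE c \<le> PRE (Suc c)" using pre_Suc(1)[OF c] by linarith
    have "(\<Sum>i<l. QUOTA c i) = (\<Sum>i<k. QUOTA c i) + (\<Sum>i=k..<l. QUOTA c i)"
      using sum.atLeastLessThan_concat[of 0 k l "QUOTA c"] True by (simp add: lessThan_atLeast0)
    then have "cnt (SLOT c) (3 * l) = cnt (SLOT c) (3 * k) + (\<Sum>i=k..<l. QUOTA c i)"
      using cnt_slot[OF c lp] cnt_slot[OF c, of k] True lp by simp
    moreover have "l - k \<le> (\<Sum>i=k..<l. QUOTA c i) + (p - (PRE (Suc c) - PRE c))"
      using sum_residues_diff_ge[OF p_pos ge True lp] by (simp add: quota_residues[OF c])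
    moreover have "cnt (SLOT c) x \<le> cnt (SLOT c) (3 * k)" by (rule cnt_mono[OF k(1)])
    moreover have "cnt (SLOT c) (3 * l) \<le> cnt (SLOT c) y" by (rule cnt_mono[OF l(1)])
    ultimately show ?thesis using pre_gap[OF c] k l by linarith
  next
    case False
    then show ?thesis using k l by linarith
  qed
qed

lemma time1_le: "time1 m1 m2 n sr sc \<le> 9 * d + 4"
  unfolding time1_def
proof (rule bmax_le)
  fix e assume e: "e < n"
  have c: "sc e < m2" "sr e < m1" "OCC (sc e) (sr e)" using bound[OF e] e by (auto simp: occ_def)
  have "gap (sr e) (ROW e) \<le> 3 * d + (6 * d + 4)"
    unfolding row1_def
    by (rule gap_pack_le[OF occ_le_slot[OF c(1)] upper[OF c(1)] slot_density[OF c(1)] c(2,3)])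
  then show "gap (sr e) (ROW e) \<le> 9 * d + 4" by simp
qed

lemma pre_diff:
  assumes "a \<le> b" "b \<le> m2"
  shows "PRE b \<le> PRE a + (b - a) * (p + d)"
  using assms
proof (induction b rule: dec_induct)
  case (step b)
  then have "PRE (Suc b) \<le> PRE b + (p + d)"
    using pre_Suc(2)[of b] colcnt_upper[of b] by simp
  moreover have "(Suc b - a) * (p + d) = (b - a) * (p + d) + (p + d)"
    using step.hyps by (simp add: Suc_diff_le)
  ultimately show ?case using step by simp
qed simp

text \<open>Consecutive columns receive consecutive ranks, so the robots of a strip in an interval
  of columns are bounded by the occurrences of one residue in an interval of ranks, essentially its
  length divided by \<open>p\<close>.\<close>

lemma strip_density:
  assumes i: "i < p" and xy: "x \<le> y" "y \<le> 3 * m2"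
  shows "3 * (cnt (SOCC i) y - cnt (SOCC i) x) \<le> (y - x) + (9 * d + 4)"
proof -
  define k l where "k = x div 3" and "l = (y + 2) div 3"
  have k: "3 * k \<le> x" "x \<le> 3 * k + 2" and l: "y \<le> 3 * l" "3 * l \<le> y + 2"
    unfolding k_def l_def by linarith+
  have kl: "k \<le> l" "l \<le> m2" using k l xy by linarith+
  have "PRE l \<le> PRE k + (l - k) * (p + d)" by (rule pre_diff[OF kl])
  also have "(l - k) * (p + d) = (l - k) * p + (l - k) * d" by (rule add_mult_distrib2)
  \<comment> \<open>The excess of up to \<open>d\<close> ranks per column accumulates to at most
    \<open>m1 * d\<close>, that is, \<open>3 * d\<close> periods of length \<open>p\<close>;
    \<open>m2 \<le> m1\<close> is used here. A strip thus gains only \<open>3 * d\<close>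
    robots.\<close>
  also have "(l - k) * d \<le> m1 * d" using kl m21 by (intro mult_right_mono) auto
  also have "m1 * d = (3 * d) * p" using m1_p by (metis mult.assoc mult.commute)
  finally have le: "PRE l \<le> PRE k + (l - k + 3 * d) * p" by (simp add: add_mult_distrib)
  have "PRE k \<le> PRE l"
    using kl
  proof (induction l rule: dec_induct)
    case (step l)
    then show ?case using pre_Suc(1)[of l] by linarith
  qed simp
  from residues_diff_le[OF i this le] cnt_stripocc_diff[OF i kl]
  have "cnt (SOCC i) (3 * l) - cnt (SOCC i) (3 * k) \<le> l - k + 3 * d" by linarith
  moreover have "cnt (SOCC i) y \<le> cnt (SOCC i) (3 * l)" by (rule cnt_mono[OF l(1)])
  moreover have "cnt (SOCC i) (3 * k) \<le> cnt (SOCC i) x" by (rule cnt_mono[OF k(1)])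
  ultimately show ?thesis using k l xy kl by linarith
qed

lemma centre_density:
  assumes "x \<le> y"
  shows "y - x \<le> 3 * (cnt (\<lambda>x. x mod 3 = 1) y - cnt (\<lambda>x. x mod 3 = 1) x) + 4"
proof -
  define k l where "k = (x + 2) div 3" and "l = y div 3"
  have k: "x \<le> 3 * k" "3 * k \<le> x + 2" and l: "3 * l \<le> y" "y \<le> 3 * l + 2"
    unfolding k_def l_def by linarith+
  have "l \<le> cnt (\<lambda>x. x mod 3 = 1) y" using cnt_mono[OF l(1), of "\<lambda>x. x mod 3 = 1"] unfolding cnt_mod_1 .
  moreover have "cnt (\<lambda>x. x mod 3 = 1) x \<le> k" using cnt_mono[OF k(1), of "\<lambda>x. x mod 3 = 1"] unfolding cnt_mod_1 .
  ultimately show ?thesis using k l by linarith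
qed

lemma time2_le: "time2 m1 m2 n sr sc \<le> 9 * d + 8"
  unfolding time2_def
proof (rule bmax_le)
  fix e assume e: "e < n"
  have o: "SOCC (STRIP e) (SNAKE e)" using e by (auto simp: stripocc_def)
  have "gap (SNAKE e) (POS e) \<le> (9 * d + 4) + 4"
    unfolding pos2_def
    by (rule gap_pack_le[OF stripocc_le[OF strip_less[OF e]] strip_density[OF strip_less[OF e]]
        centre_density snake1_less[OF e] o])
  then show "gap (SNAKE e) (POS e) \<le> 9 * d + 8" by simp
qed

lemma half_time_le: "half_time m1 m2 n sr sc \<le> m2 + 18 * d + 15"
  unfolding half_time_def using time1_le time2_le by linarith

end

section \<open>Computability of the plan\<close>

definition CE2 :: "nat \<Rightarrow> ((nat \<Rightarrow> nat) \<Rightarrow> (nat \<Rightarrow> nat) \<Rightarrow> nat \<times> nat) \<Rightarrow> bool" where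
  "CE2 d F \<longleftrightarrow> CE d (\<lambda>e h. fst (F e h)) \<and> CE d (\<lambda>e h. snd (F e h))"

lemma CE2_Pair [ce]: "CE d f \<Longrightarrow> CE d g \<Longrightarrow> CE2 d (\<lambda>e h. (f e h, g e h))"
  by (simp add: CE2_def)

lemma CE2_if [ce]: "CP d P \<Longrightarrow> CE2 d F \<Longrightarrow> CE2 d G \<Longrightarrow> CE2 d (\<lambda>e h. if P e h then F e h else G e h)"
  unfolding CE2_def if_distrib[of fst] if_distrib[of snd] by (intro conjI CE_if) auto

lemma CE_clip [ce]: "CE d x \<Longrightarrow> CE d y \<Longrightarrow> CE d t \<Longrightarrow> CE d (\<lambda>e h. clip (x e h) (y e h) (t e h))"
  unfolding clip_def by (intro ce) (assumption | linarith | (erule CE_lift, linarith))+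

lemma CE_gap [ce]: "CE d x \<Longrightarrow> CE d y \<Longrightarrow> CE d (\<lambda>e h. gap (x e h) (y e h))"
  unfolding gap_def by (intro ce) (assumption | linarith | (erule CE_lift, linarith))+

lemma CE_lane [ce]: "CE d x \<Longrightarrow> CE d y \<Longrightarrow> CE d t \<Longrightarrow> CE d (\<lambda>e h. lane (x e h) (y e h) (t e h))"
  unfolding lane_def by (intro ce) (assumption | linarith | (erule CE_lift, linarith))+

lemma CE2_turn [ce]: "CE d i \<Longrightarrow> CE d c \<Longrightarrow> CE d t \<Longrightarrow> CE2 d (\<lambda>e h. turn (i e h) (c e h) (t e h))"
  unfolding turn_def by (intro ce) (assumption | linarith | (erule CE_lift, linarith))+

lemma CE_snake [ce]: "CE d r \<Longrightarrow> CE d c \<Longrightarrow> CE d (\<lambda>e h. snake (r e h) (c e h))"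
  unfolding snake_def by (intro ce) (assumption | linarith | (erule CE_lift, linarith))+

lemma CE2_snakecell [ce]: "CE d i \<Longrightarrow> CE d x \<Longrightarrow> CE2 d (\<lambda>e h. snakecell (i e h) (x e h))"
  unfolding snakecell_def by (intro ce) (assumption | linarith | (erule CE_lift, linarith))+

lemma CE_pack [ce]:
  assumes L: "CE d L" and X: "CPF d X" and Z: "CPF d Z" and x: "CE d x"
  shows "CE d (\<lambda>e h. pack (L e h) (X e h) (Z e h) (x e h))"
  unfolding pack_def using L x
  by (intro ce CPFD[OF X] CPFD[OF Z]) (assumption | linarith | (erule CE_lift, linarith))+

locale computable_placement =
  fixes D :: nat and m1 m2 n :: "(nat \<Rightarrow> nat) \<Rightarrow> (nat \<Rightarrow> nat) \<Rightarrow> nat"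
    and sr sc :: "(nat \<Rightarrow> nat) \<Rightarrow> (nat \<Rightarrow> nat) \<Rightarrow> nat \<Rightarrow> nat"
  assumes m1: "CE D m1" and m2: "CE D m2" and n: "CE D n" and sr: "CF D sr" and sc: "CF D sc"
begin

lemmas ce_par = CE_lift[OF m1] CE_lift[OF m2] CE_lift[OF n] CFD[OF sr] CFD[OF sc]

lemma CP_occ: "D \<le> d \<Longrightarrow> CE d c \<Longrightarrow> CE d r \<Longrightarrow>
    CP d (\<lambda>e h. occ (n e h) (sr e h) (sc e h) (c e h) (r e h))"
  unfolding occ_def by (intro ce ce_par) (assumption | linarith | (erule CE_lift, linarith))+

lemma CE_colcnt: "D \<le> d \<Longrightarrow> CE d c \<Longrightarrow>
    CE d (\<lambda>e h. colcnt (m1 e h) (n e h) (sr e h) (sc e h) (c e h))"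
  unfolding colcnt_def by (intro ce ce_par CP_occ) (assumption | linarith | (erule CE_lift, linarith))+

lemma CE_pre: "D \<le> d \<Longrightarrow> CE d c \<Longrightarrow>
    CE d (\<lambda>e h. pre (m1 e h) (m2 e h) (n e h) (sr e h) (sc e h) (c e h))"
  unfolding pre_def by (intro ce ce_par CE_colcnt) (assumption | linarith | (erule CE_lift, linarith))+

lemma CE_quota: "D \<le> d \<Longrightarrow> CE d c \<Longrightarrow> CE d i \<Longrightarrow>
    CE d (\<lambda>e h. quota (m1 e h) (m2 e h) (n e h) (sr e h) (sc e h) (c e h) (i e h))"
  unfolding quota_def by (intro ce ce_par CE_pre) (assumption | linarith | (erule CE_lift, linarith))+

lemma CP_slot: "D \<le> d \<Longrightarrow> CE d c \<Longrightarrow> CE d r \<Longrightarrow>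
    CP d (\<lambda>e h. slot (m1 e h) (m2 e h) (n e h) (sr e h) (sc e h) (c e h) (r e h))"
  unfolding slot_def by (intro ce ce_par CE_quota) (assumption | linarith | (erule CE_lift, linarith))+

lemma CE_row1: "D \<le> d \<Longrightarrow> CE d x \<Longrightarrow>
    CE d (\<lambda>e h. row1 (m1 e h) (m2 e h) (n e h) (sr e h) (sc e h) (x e h))"
  unfolding row1_def by (intro ce ce_par CP_occ CP_slot) (assumption | linarith | (erule CE_lift, linarith))+

lemma CE_snake1: "D \<le> d \<Longrightarrow> CE d x \<Longrightarrow>
    CE d (\<lambda>e h. snake1 (m1 e h) (m2 e h) (n e h) (sr e h) (sc e h) (x e h))"
  unfolding snake1_def by (intro ce ce_par CE_row1) (assumption | linarith | (erule CE_lift, linarith))+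

lemma CE_strip: "D \<le> d \<Longrightarrow> CE d x \<Longrightarrow>
    CE d (\<lambda>e h. strip (m1 e h) (m2 e h) (n e h) (sr e h) (sc e h) (x e h))"
  unfolding strip_def by (intro ce ce_par CE_row1) (assumption | linarith | (erule CE_lift, linarith))+

lemma CP_stripocc: "D \<le> d \<Longrightarrow> CE d i \<Longrightarrow> CE d x \<Longrightarrow>
    CP d (\<lambda>e h. stripocc (m1 e h) (m2 e h) (n e h) (sr e h) (sc e h) (i e h) (x e h))"
  unfolding stripocc_def
  by (intro ce ce_par CE_strip CE_snake1) (assumption | linarith | (erule CE_lift, linarith))+

lemma CE_pos2: "D \<le> d \<Longrightarrow> CE d x \<Longrightarrow>
    CE d (\<lambda>e h. pos2 (m1 e h) (m2 e h) (n e h) (sr e h) (sc e h) (x e h))"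
  unfolding pos2_def
  by (intro ce ce_par CP_stripocc CE_strip CE_snake1) (assumption | linarith | (erule CE_lift, linarith))+

lemma CE_col2: "D \<le> d \<Longrightarrow> CE d x \<Longrightarrow>
    CE d (\<lambda>e h. col2 (m1 e h) (m2 e h) (n e h) (sr e h) (sc e h) (x e h))"
  unfolding col2_def by (intro ce ce_par CE_pos2) (assumption | linarith | (erule CE_lift, linarith))+

lemma CE_time1: "D \<le> d \<Longrightarrow> CE d (\<lambda>e h. time1 (m1 e h) (m2 e h) (n e h) (sr e h) (sc e h))"
  unfolding time1_def by (intro ce ce_par CE_row1) (assumption | linarith | (erule CE_lift, linarith))+

lemma CE_time2: "D \<le> d \<Longrightarrow> CE d (\<lambda>e h. time2 (m1 e h) (m2 e h) (n e h) (sr e h) (sc e h))"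
  unfolding time2_def by (intro ce ce_par CE_snake1 CE_pos2) (assumption | linarith | (erule CE_lift, linarith))+

lemma CE_half_time: "D \<le> d \<Longrightarrow> CE d (\<lambda>e h. half_time (m1 e h) (m2 e h) (n e h) (sr e h) (sc e h))"
  unfolding half_time_def
  by (intro ce ce_par CE_time1 CE_time2) (assumption | linarith | (erule CE_lift, linarith))+

lemma CE2_half:
  assumes "D \<le> d" "CF d k" "CE d t" "CE d x"
  shows "CE2 d (\<lambda>e h. half (m1 e h) (m2 e h) (n e h) (sr e h) (sc e h) (k e h) (t e h) (x e h))"
  unfolding half_def using assms(1,3,4)
  by (intro ce ce_par CE_time1 CE_time2 CE_row1 CE_strip CE_snake1 CE_pos2 CE_col2 CFD[OF assms(2)])
    (assumption | linarith | (erule CE_lift, linarith))+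

end

lemma CE_plan_time:
  assumes S: "computable_placement D m1 m2 n sr sc" and G: "computable_placement D m1 m2 n gr gc"
    and d: "D \<le> d"
  shows "CE d (\<lambda>e h. plan_time (m1 e h) (m2 e h) (n e h) (sr e h) (sc e h) (gr e h) (gc e h))"
  unfolding plan_time_def using d
  by (intro ce computable_placement.CE_half_time[OF S] computable_placement.CE_half_time[OF G]
      CE_lift[OF computable_placement.m1[OF S]]) assumption+

lemma CE2_plan:
  assumes S: "computable_placement D m1 m2 n sr sc" and G: "computable_placement D m1 m2 n gr gc"
    and d: "D \<le> d" and k: "CF d k" and t: "CE d t" and x: "CE d x"
  shows "CE2 d (\<lambda>e h. plan (m1 e h) (m2 e h) (n e h) (sr e h) (sc e h) (gr e h) (gc e h) (k e h) (t e h) (x e h))"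
  unfolding plan_def using d t x
  by (intro ce computable_placement.CE_half_time[OF S] computable_placement.CE_half_time[OF G]
      CE_lift[OF computable_placement.m1[OF S]] computable_placement.CE_strip[OF S]
      computable_placement.CE_strip[OF G] computable_placement.CE2_half[OF S]
      computable_placement.CE2_half[OF G] CFD[OF k])
    (assumption | linarith | (erule CE_lift, linarith) | rule k)+

section \<open>Computability of the colouring steps\<close>

lemma CE_free_colour:
  assumes q: "CE d q" and w: "CF d w" and x: "CE d x" and Y: "CF d Y"
  shows "CE d (\<lambda>e h. free_colour (q e h) (w e h) (x e h) (Y e h))"
  unfolding free_colour_def using q x
  by (intro ce CFD[OF w] CFD[OF Y]) (assumption | linarith | (erule CE_lift, linarith))+

lemma CE_insert_edge:
  assumes n: "CE d n" and q: "CE d q" and u: "CF d u" and v: "CF d v" and x: "CE d x"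
    and Y: "CF d Y" and k: "CE d k"
  shows "CE d (\<lambda>e h. insert_edge (n e h) (q e h) (u e h) (v e h) (x e h) (Y e h) (k e h))"
  unfolding insert_edge_def
  by (rule CE_if CP_eq CE_add CE_free_colour CE_const CFD[OF Y order_refl] assms)+

lemma CE_conflict:
  assumes n: "CE d n" and u: "CF d u" and v: "CF d v" and x: "CE d x" and Y: "CF d Y"
  shows "CE d (\<lambda>e h. conflict (n e h) (u e h) (v e h) (x e h) (Y e h))"
  unfolding conflict_def endp_def using n x
  by (intro ce CFD[OF Y] CFD[OF u] CFD[OF v]) (assumption | linarith | (erule CE_lift, linarith))+

lemma CE_chain_step:
  assumes n: "CE d n" and u: "CF d u" and v: "CF d v" and x: "CE d x" and Y: "CF d Y" and k: "CE d k"
  shows "CE d (\<lambda>e h. chain_step (n e h) (u e h) (v e h) (x e h) (Y e h) (k e h))"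
  unfolding chain_step_def
  by (rule CE_if CP_less CP_eq CE_sub CE_add CE_conflict CE_const CFD[OF Y order_refl] assms)+

lemma CE_koenig_step:
  assumes "CE d n" "CE d q" "CF d u" "CF d v" "CE d t" "CF d Y" "CE d k"
  shows "CE d (\<lambda>e h. koenig_step (n e h) (q e h) (u e h) (v e h) (t e h) (Y e h) (k e h))"
  unfolding koenig_step_def
  by (rule CE_if CP_eq CE_mod CE_div CE_add CE_insert_edge CE_chain_step CE_const assms)+

section \<open>Random subsets\<close>

definition subsets :: "'a set \<Rightarrow> nat \<Rightarrow> 'a set set" where
  "subsets V n = {S. S \<subseteq> V \<and> card S = n}"

lemma finite_subsets: "finite V \<Longrightarrow> finite (subsets V n)"
  unfolding subsets_def by (rule finite_subset[of _ "Pow V"]) auto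

lemma card_subsets: "finite V \<Longrightarrow> card (subsets V n) = card V choose n"
  unfolding subsets_def by (rule n_subsets)

lemma card_subsets_containing:
  assumes "finite V" "J \<subseteq> V" "card J \<le> n"
  shows "card {S \<in> subsets V n. J \<subseteq> S} = (card V - card J) choose (n - card J)"
proof -
  have fJ: "finite J" using assms finite_subset by blast
  have "bij_betw (\<lambda>B. B \<union> J) (subsets (V - J) (n - card J)) {S \<in> subsets V n. J \<subseteq> S}"
  proof (rule bij_betwI[where g = "\<lambda>S. S - J"])
    show "(\<lambda>B. B \<union> J) \<in> subsets (V - J) (n - card J) \<rightarrow> {S \<in> subsets V n. J \<subseteq> S}"
    proof
      fix B assume "B \<in> subsets (V - J) (n - card J)"
      then have B: "B \<subseteq> V - J" "card B = n - card J" by (auto simp: subsets_def)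
      then have "finite B" "B \<inter> J = {}" using assms(1) finite_subset by blast+
      then have "card (B \<union> J) = n" using B(2) fJ assms(3) by (simp add: card_Un_disjoint)
      then show "B \<union> J \<in> {S \<in> subsets V n. J \<subseteq> S}" using B(1) assms(2) by (auto simp: subsets_def)
    qed
    show "(\<lambda>S. S - J) \<in> {S \<in> subsets V n. J \<subseteq> S} \<rightarrow> subsets (V - J) (n - card J)"
      by (auto simp: subsets_def card_Diff_subset[OF fJ])
  qed (auto simp: subsets_def)
  then have "card {S \<in> subsets V n. J \<subseteq> S} = card (subsets (V - J) (n - card J))"
    by (simp add: bij_betw_same_card)
  also have "\<dots> = card (V - J) choose (n - card J)" using assms(1) by (intro card_subsets) simp
  also have "card (V - J) = card V - card J" by (rule card_Diff_subset[OF fJ assms(2)])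
  finally show ?thesis .
qed

text \<open>The chance that a random \<open>n\<close>-subset contains \<open>j\<close> given points
  is a product of ratios \<open>(n - i) / (N - i)\<close>, each at most \<open>n / N\<close>:
  sampling without replacement is dominated by independent sampling.\<close>

lemma binomial_diff_le:
  assumes "j \<le> n" "n \<le> N" "0 < N"
  shows "real ((N - j) choose (n - j)) \<le> (real n / real N) ^ j * real (N choose n)"
  using assms(1)
proof (induction j)
  case (Suc j)
  obtain a where a: "N - j = Suc a" using Suc.prems assms(2) by (metis Suc_diff_Suc Suc_le_lessD le_trans)
  obtain b where b: "n - j = Suc b" using Suc.prems by (metis Suc_diff_Suc Suc_le_lessD)
  have "real (Suc b) * real (Suc a choose Suc b) = real (Suc a) * real (a choose b)"
    using Suc_times_binomial[of b a] by (metis of_nat_mult)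
  then have "real (a choose b) = real (Suc b) / real (Suc a) * real (Suc a choose Suc b)"
    by (simp add: field_simps)
  also have "real (Suc b) / real (Suc a) \<le> real n / real N"
  proof -
    have nj: "real (Suc b) = real n - real j" "real (Suc a) = real N - real j"
      using a b Suc.prems assms(2) by (simp_all flip: a b add: of_nat_diff)
    have "real (Suc b) * real N \<le> real n * real (Suc a)"
      unfolding nj using mult_left_mono[of "real n" "real N" "real j"] assms(2) by (simp add: algebra_simps)
    then show ?thesis using assms(3) by (simp add: field_simps)
  qed
  finally have "real (a choose b) \<le> real n / real N * real (Suc a choose Suc b)"
    by (simp add: mult_right_mono)
  also have "\<dots> \<le> real n / real N * ((real n / real N) ^ j * real (N choose n))"
    using Suc.IH Suc.prems a b by (intro mult_left_mono) auto
  finally have "real (a choose b) \<le> real n / real N * ((real n / real N) ^ j * real (N choose n))" .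
  moreover have "N - Suc j = a" "n - Suc j = b" using a b by simp_all
  ultimately show ?case by (simp add: mult.assoc)
qed simp

lemma sum_power_subsets:
  fixes x :: real
  assumes "finite A"
  shows "(\<Sum>J\<in>Pow A. x ^ card J) = (1 + x) ^ card A"
  using prod_add[OF assms, of "\<lambda>_. x" "\<lambda>_. 1"] by (simp add: add.commute)

text \<open>Expanding the power over the subsets \<open>J\<close> of \<open>S \<inter> A\<close> and
  exchanging the sums reduces the moment to the probabilities of \<open>J \<subseteq> S\<close>,
  which are bounded by those of independent points; summing up again gives the binomial generating
  function.\<close>

lemma moment_bound:
  fixes \<theta> :: real
  assumes V: "finite V" "V \<noteq> {}" and A: "A \<subseteq> V" and n: "n \<le> card V" and t: "0 \<le> \<theta>"
  shows "(\<Sum>S\<in>subsets V n. (1 + \<theta>) ^ card (S \<inter> A))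
    \<le> (1 + real n / real (card V) * \<theta>) ^ card A * real (card V choose n)"
proof -
  let ?r = "real n / real (card V)"
  have fA: "finite A" using A V finite_subset by blast
  have N: "0 < card V" using V by (simp add: card_gt_0_iff)
  have "(\<Sum>S\<in>subsets V n. (1 + \<theta>) ^ card (S \<inter> A)) = (\<Sum>S\<in>subsets V n. \<Sum>J\<in>Pow A. if J \<subseteq> S then \<theta> ^ card J else 0)"
  proof (rule sum.cong[OF refl])
    fix S
    have "(1 + \<theta>) ^ card (S \<inter> A) = (\<Sum>J\<in>Pow (S \<inter> A). \<theta> ^ card J)"
      by (rule sum_power_subsets[symmetric]) (use fA in simp)
    also have "Pow (S \<inter> A) = Pow A \<inter> {J. J \<subseteq> S}" by auto
    also have "(\<Sum>J\<in>Pow A \<inter> {J. J \<subseteq> S}. \<theta> ^ card J) = (\<Sum>J\<in>Pow A. if J \<subseteq> S then \<theta> ^ card J else 0)"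
      using fA by (simp add: sum.inter_restrict)
    finally show "(1 + \<theta>) ^ card (S \<inter> A) = (\<Sum>J\<in>Pow A. if J \<subseteq> S then \<theta> ^ card J else 0)" .
  qed
  also have "\<dots> = (\<Sum>J\<in>Pow A. \<Sum>S\<in>subsets V n. if J \<subseteq> S then \<theta> ^ card J else 0)" by (rule sum.swap)
  also have "\<dots> = (\<Sum>J\<in>Pow A. \<theta> ^ card J * real (card {S \<in> subsets V n. J \<subseteq> S}))"
  proof (rule sum.cong[OF refl])
    fix J
    have "(\<Sum>S\<in>subsets V n. if J \<subseteq> S then \<theta> ^ card J else 0) = (\<Sum>S\<in>{S \<in> subsets V n. J \<subseteq> S}. \<theta> ^ card J)"
      by (rule sum.inter_filter[OF finite_subsets[OF V(1)], symmetric])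
    then show "(\<Sum>S\<in>subsets V n. if J \<subseteq> S then \<theta> ^ card J else 0)
      = \<theta> ^ card J * real (card {S \<in> subsets V n. J \<subseteq> S})" by simp
  qed
  also have "\<dots> \<le> (\<Sum>J\<in>Pow A. (?r * \<theta>) ^ card J * real (card V choose n))"
  proof (rule sum_mono)
    fix J assume "J \<in> Pow A"
    then have J: "J \<subseteq> V" using A by auto
    have "real (card {S \<in> subsets V n. J \<subseteq> S}) \<le> ?r ^ card J * real (card V choose n)"
    proof (cases "card J \<le> n")
      case True
      then show ?thesis
        using binomial_diff_le[OF True n N] by (simp add: card_subsets_containing[OF V(1) J])
    next
      case False
      have "card J \<le> n" if "S \<in> subsets V n" "J \<subseteq> S" for S
        using card_mono[of S J] finite_subset[of S V] that V(1) by (auto simp: subsets_def)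
      then have "{S \<in> subsets V n. J \<subseteq> S} = {}" using False by auto
      then show ?thesis by (simp only: card.empty) simp
    qed
    then have "\<theta> ^ card J * real (card {S \<in> subsets V n. J \<subseteq> S})
      \<le> \<theta> ^ card J * (?r ^ card J * real (card V choose n))"
      using t by (intro mult_left_mono) auto
    then show "\<theta> ^ card J * real (card {S \<in> subsets V n. J \<subseteq> S})
      \<le> (?r * \<theta>) ^ card J * real (card V choose n)"
      unfolding power_mult_distrib[of ?r] by (simp only: mult_ac)
  qed
  also have "\<dots> = (1 + ?r * \<theta>) ^ card A * real (card V choose n)"
    unfolding sum_distrib_right[symmetric] sum_power_subsets[OF fA] ..
  finally show ?thesis .
qed

text \<open>Markov's inequality for \<open>(1 + t) ^ card (S \<inter> A)\<close> with
  \<open>t = 1 / sqrt m\<close> and \<open>ln (1 + t)\<close> bounded below by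
  \<open>t - t * t\<close>. The terms linear in the mean cancel, \<open>t * d\<close> is the gain,
  and the quadratic remainder is at most 2 because the threshold is at most
  \<open>2 * m\<close>.\<close>

lemma upper_tail:
  fixes d m :: nat
  assumes V: "finite V" "V \<noteq> {}" and A: "A \<subseteq> V" and n: "n \<le> card V"
    and m: "card A \<le> m" "d \<le> m" "0 < m"
  shows "real (card {S \<in> subsets V n. real n / real (card V) * real (card A) + real d < real (card (S \<inter> A))})
    \<le> exp (2 - real d / sqrt (real m)) * real (card V choose n)"
proof -
  define r t where "r = real n / real (card V)" and "t = 1 / sqrt (real m)"
  define M where "M = r * real (card A) + real d"
  let ?B = "{S \<in> subsets V n. M < real (card (S \<inter> A))}"
  have N: "0 < card V" using V by (simp add: card_gt_0_iff)
  have r: "0 \<le> r" "r \<le> 1" using n N by (simp_all add: r_def)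
  have t: "0 < t" "t \<le> 1" "t * t = 1 / real m" using m(3) by (simp_all add: t_def)
  have "r * real (card A) \<le> 1 * real m" using r m(1) by (intro mult_mono) auto
  then have M: "M \<le> 2 * real m" "0 \<le> M" using m(2) r(1) by (simp_all add: M_def)
  have ln: "t - t\<^sup>2 \<le> ln (1 + t)" using t by (intro ln_one_plus_pos_lower_bound) auto
  have "exp ((t - t\<^sup>2) * M) * real (card ?B) = (\<Sum>S\<in>?B. exp ((t - t\<^sup>2) * M))" by simp
  also have "\<dots> \<le> (\<Sum>S\<in>?B. (1 + t) ^ card (S \<inter> A))"
  proof (rule sum_mono)
    fix S assume S: "S \<in> ?B"
    have "exp ((t - t\<^sup>2) * M) \<le> exp (ln (1 + t) * M)" using ln M(2) by (simp add: mult_right_mono)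
    also have "\<dots> \<le> exp (ln (1 + t) * real (card (S \<inter> A)))"
      using S t by (simp add: mult_left_mono)
    also have "\<dots> = (1 + t) ^ card (S \<inter> A)"
      using t by (simp add: exp_of_nat2_mult)
    finally show "exp ((t - t\<^sup>2) * M) \<le> (1 + t) ^ card (S \<inter> A)" .
  qed
  also have "\<dots> \<le> (\<Sum>S\<in>subsets V n. (1 + t) ^ card (S \<inter> A))"
    using finite_subsets[OF V(1)] t by (intro sum_mono2) auto
  also have "\<dots> \<le> (1 + r * t) ^ card A * real (card V choose n)"
    unfolding r_def using t by (intro moment_bound[OF V A n]) simp
  also have "(1 + r * t) ^ card A \<le> exp (r * t) ^ card A"
    using r t by (intro power_mono) (auto simp: exp_ge_add_one_self)
  also have "exp (r * t) ^ card A = exp (real (card A) * (r * t))" by (rule exp_of_nat_mult[symmetric])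
  finally have "exp ((t - t\<^sup>2) * M) * real (card ?B) \<le> exp (real (card A) * (r * t)) * real (card V choose n)"
    by (simp add: mult_right_mono)
  then have "real (card ?B) \<le> exp (real (card A) * (r * t)) * real (card V choose n) / exp ((t - t\<^sup>2) * M)"
    by (simp add: pos_le_divide_eq mult.commute)
  also have "\<dots> = exp (real (card A) * (r * t) - (t - t\<^sup>2) * M) * real (card V choose n)"
    by (simp add: exp_diff)
  also have "real (card A) * (r * t) - (t - t\<^sup>2) * M = t\<^sup>2 * M - t * real d"
    by (simp add: M_def algebra_simps)
  also have "t\<^sup>2 * M - t * real d \<le> 2 - real d / sqrt (real m)"
  proof -
    have "t\<^sup>2 * M = M / real m" using t(3) by (simp add: power2_eq_square)
    also have "\<dots> \<le> 2" using M(1) m(3) by (simp add: pos_divide_le_eq)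
    finally show ?thesis by (simp add: t_def)
  qed
  finally show ?thesis unfolding M_def r_def by (simp add: mult_right_mono)
qed

text \<open>Complementation turns a deficit of \<open>S\<close> in \<open>A\<close> into an excess
  of \<open>V - S\<close> in \<open>A\<close>, so the upper tail applies to subsets of size
  \<open>card V - n\<close>.\<close>

lemma lower_tail:
  fixes d m :: nat
  assumes V: "finite V" "V \<noteq> {}" and A: "A \<subseteq> V" and n: "n \<le> card V"
    and m: "card A \<le> m" "d \<le> m" "0 < m"
  shows "real (card {S \<in> subsets V n. real (card (S \<inter> A)) < real n / real (card V) * real (card A) - real d})
    \<le> exp (2 - real d / sqrt (real m)) * real (card V choose n)"
proof -
  let ?B = "{S \<in> subsets V n. real (card (S \<inter> A)) < real n / real (card V) * real (card A) - real d}"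
  let ?k = "card V - n"
  let ?C = "{S \<in> subsets V ?k. real ?k / real (card V) * real (card A) + real d < real (card (S \<inter> A))}"
  have N: "0 < card V" using V by (simp add: card_gt_0_iff)
  have fA: "finite A" using A V finite_subset by blast
  have "card ?B \<le> card ?C"
  proof (rule card_inj_on_le)
    show "inj_on (\<lambda>S. V - S) ?B" by (rule inj_onI) (auto simp: subsets_def)
    show "(\<lambda>S. V - S) ` ?B \<subseteq> ?C"
    proof
      fix T assume "T \<in> (\<lambda>S. V - S) ` ?B"
      then obtain S where S: "S \<subseteq> V" "card S = n" "T = V - S"
        "real (card (S \<inter> A)) < real n / real (card V) * real (card A) - real d"
        by (auto simp: subsets_def)
      have fS: "finite S" using S V finite_subset by blast
      have cT: "card T = ?k" using S fS by (simp add: card_Diff_subset)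
      have "T \<inter> A = A - S \<inter> A" using S(3) A by auto
      then have "card (T \<inter> A) = card A - card (S \<inter> A)" using fA fS by (simp add: card_Diff_subset)
      then have cTA: "real (card (T \<inter> A)) = real (card A) - real (card (S \<inter> A))"
        using card_mono[OF fA, of "S \<inter> A"] by (simp add: of_nat_diff)
      have "real ?k / real (card V) * real (card A) = real (card A) - real n / real (card V) * real (card A)"
        using n N by (simp add: of_nat_diff field_simps)
      then show "T \<in> ?C" using S cT cTA by (auto simp: subsets_def)
    qed
    show "finite ?C" using finite_subsets[OF V(1)] by simp
  qed
  then have "real (card ?B) \<le> real (card ?C)" by simp
  also have "\<dots> \<le> exp (2 - real d / sqrt (real m)) * real (card V choose ?k)"
    by (rule upper_tail[OF V A _ m]) simp
  also have "card V choose ?k = card V choose n" using n by (simp add: binomial_symmetric[symmetric])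
  finally show ?thesis .
qed

section \<open>Random configurations are evenly spread\<close>

definition rect :: "nat \<Rightarrow> nat \<Rightarrow> nat \<Rightarrow> (nat \<times> nat) set" where
  "rect c a b = {a..<b} \<times> {c}"

definition even_set :: "nat \<Rightarrow> nat \<Rightarrow> nat \<Rightarrow> nat \<Rightarrow> (nat \<times> nat) set \<Rightarrow> bool" where
  "even_set m1 m2 n d S \<longleftrightarrow> (\<forall>c<m2. \<forall>a\<le>m1. \<forall>b\<le>m1.
      real (card (S \<inter> rect c a b)) \<le> real n / real (m1 * m2) * real (card (rect c a b)) + real d \<and>
      real n / real (m1 * m2) * real (card (rect c a b)) - real d \<le> real (card (S \<inter> rect c a b)))"

text \<open>A union bound: at most \<open>m * (m + 1) ^ 2\<close> choices of a column and two
  interval ends, with an upper and a lower tail for each.\<close>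

definition tail :: "nat \<Rightarrow> nat \<Rightarrow> real" where
  "tail m d = 2 * real m * (real m + 1)\<^sup>2 * exp (2 - real d / sqrt (real m))"

lemma card_not_even_set:
  assumes m: "0 < m2" "m2 \<le> m1" "d \<le> m1" and n: "n \<le> m1 * m2"
  shows "real (card {S \<in> subsets (grid_V m1 m2) n. \<not> even_set m1 m2 n d S})
    \<le> tail m1 d * real (m1 * m2 choose n)"
proof -
  let ?V = "grid_V m1 m2"
  let ?r = "real n / real (m1 * m2)"
  let ?e = "exp (2 - real d / sqrt (real m1))"
  have V: "finite ?V" "card ?V = m1 * m2" "?V \<noteq> {}" using m by (auto simp: grid_V_def)
  define U where "U = (\<lambda>(c, a, b). {S \<in> subsets ?V n. ?r * real (card (rect c a b)) + real d < real (card (S \<inter> rect c a b))}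
    \<union> {S \<in> subsets ?V n. real (card (S \<inter> rect c a b)) < ?r * real (card (rect c a b)) - real d})"
  let ?I = "{..<m2} \<times> {..m1} \<times> {..m1}"
  have "{S \<in> subsets ?V n. \<not> even_set m1 m2 n d S} \<subseteq> (\<Union>i\<in>?I. U i)"
    unfolding even_set_def U_def by (auto simp: not_le)
  then have "card {S \<in> subsets ?V n. \<not> even_set m1 m2 n d S} \<le> card (\<Union>i\<in>?I. U i)"
    by (rule card_mono[rotated]) (auto simp: U_def finite_subsets[OF V(1)])
  also have "\<dots> \<le> (\<Sum>i\<in>?I. card (U i))" by (rule card_UN_le) simp
  finally have "real (card {S \<in> subsets ?V n. \<not> even_set m1 m2 n d S}) \<le> (\<Sum>i\<in>?I. real (card (U i)))"
    by (simp flip: of_nat_sum)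
  also have "\<dots> \<le> (\<Sum>i\<in>?I. 2 * ?e * real (m1 * m2 choose n))"
  proof (rule sum_mono)
    fix i assume "i \<in> ?I"
    then obtain c a b where i: "i = (c, a, b)" and c: "c < m2" "a \<le> m1" "b \<le> m1" by auto
    have A: "rect c a b \<subseteq> ?V" using c by (auto simp: rect_def grid_V_def)
    have cA: "card (rect c a b) \<le> m1" using c by (simp add: rect_def)
    have nV: "n \<le> card ?V" using n V by simp
    have m1: "0 < m1" using m by simp
    have "card (U i) \<le> card {S \<in> subsets ?V n. ?r * real (card (rect c a b)) + real d < real (card (S \<inter> rect c a b))}
      + card {S \<in> subsets ?V n. real (card (S \<inter> rect c a b)) < ?r * real (card (rect c a b)) - real d}"
      unfolding U_def i by (simp add: card_Un_le)
    then have "real (card (U i)) \<le> real (card {S \<in> subsets ?V n. ?r * real (card (rect c a b)) + real d < real (card (S \<inter> rect c a b))})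
      + real (card {S \<in> subsets ?V n. real (card (S \<inter> rect c a b)) < ?r * real (card (rect c a b)) - real d})"
      by linarith
    then show "real (card (U i)) \<le> 2 * ?e * real (m1 * m2 choose n)"
      using upper_tail[OF V(1,3) A nV cA m(3) m1] lower_tail[OF V(1,3) A nV cA m(3) m1]
      unfolding V(2) by linarith
  qed
  also have "\<dots> = real m2 * (real m1 + 1)\<^sup>2 * (2 * ?e * real (m1 * m2 choose n))"
    by (simp add: power2_eq_square algebra_simps)
  also have "\<dots> \<le> real m1 * (real m1 + 1)\<^sup>2 * (2 * ?e * real (m1 * m2 choose n))"
    using m(2) by (intro mult_right_mono) auto
  also have "\<dots> = tail m1 d * real (m1 * m2 choose n)" by (simp add: tail_def)
  finally show ?thesis .
qed

lemma finite_configs: "finite (configs m1 m2 n)"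
  unfolding configs_def grid_V_def
  by (rule finite_subset[of _ "{0..<n} \<rightarrow>\<^sub>E {0..<m1} \<times> {0..<m2}"]) (auto intro: finite_PiE)

text \<open>Every \<open>n\<close>-set is the image of exactly \<open>fact n\<close> configurations,
  so the occupied set of a uniform configuration is a uniform \<open>n\<close>-subset of the
  grid.\<close>

lemma card_configs_image:
  "card {s \<in> configs m1 m2 n. Q (s ` {0..<n})} = fact n * card {S \<in> subsets (grid_V m1 m2) n. Q S}"
proof -
  let ?V = "grid_V m1 m2"
  let ?F = "\<lambda>S. {s \<in> {0..<n} \<rightarrow>\<^sub>E S. inj_on s {0..<n}}"
  let ?I = "{S \<in> subsets ?V n. Q S}"
  have V: "finite ?V" by (simp add: grid_V_def)
  have im: "s ` {0..<n} = S" if "s \<in> ?F S" "S \<in> ?I" for s S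
  proof (rule card_subset_eq)
    show "finite S" using that V by (auto simp: subsets_def intro: finite_subset)
    show "s ` {0..<n} \<subseteq> S" using that by auto
    show "card (s ` {0..<n}) = card S" using that by (simp add: card_image subsets_def)
  qed
  have "{s \<in> configs m1 m2 n. Q (s ` {0..<n})} = (\<Union>S\<in>?I. ?F S)"
  proof (intro set_eqI iffI)
    fix s assume s: "s \<in> {s \<in> configs m1 m2 n. Q (s ` {0..<n})}"
    then have "s ` {0..<n} \<in> ?I" by (auto simp: configs_def subsets_def card_image)
    moreover have "s \<in> ?F (s ` {0..<n})" using s by (auto simp: configs_def)
    ultimately show "s \<in> (\<Union>S\<in>?I. ?F S)" by blast
  next
    fix s assume "s \<in> (\<Union>S\<in>?I. ?F S)"
    then obtain S where S: "S \<in> ?I" "s \<in> ?F S" by blast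
    then have "s \<in> configs m1 m2 n" by (auto simp: configs_def subsets_def)
    then show "s \<in> {s \<in> configs m1 m2 n. Q (s ` {0..<n})}" using im[OF S(2,1)] S(1) by auto
  qed
  also have "card \<dots> = (\<Sum>S\<in>?I. card (?F S))"
  proof (rule card_UN_disjoint)
    show "finite ?I" using finite_subsets[OF V] by simp
    show "\<forall>S\<in>?I. finite (?F S)"
    proof
      fix S assume "S \<in> ?I"
      then have "finite S" using V by (auto simp: subsets_def intro: finite_subset)
      then have "finite ({0..<n} \<rightarrow>\<^sub>E S)" by (intro finite_PiE) auto
      then show "finite (?F S)" by simp
    qed
    show "\<forall>S\<in>?I. \<forall>T\<in>?I. S \<noteq> T \<longrightarrow> ?F S \<inter> ?F T = {}" using im by blast
  qed
  also have "\<dots> = (\<Sum>S\<in>?I. fact n)"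
  proof (rule sum.cong[OF refl])
    fix S assume "S \<in> ?I"
    then have "finite S" "card S = n" using V by (auto simp: subsets_def intro: finite_subset)
    then show "card (?F S) = fact n"
      using card_inj_on_subset_funcset[of "{0..<n}" S "{0..<n}"] by (simp add: fact_prod_rev)
  qed
  finally show ?thesis by simp
qed

section \<open>The algorithm\<close>

definition start_row :: "(nat \<Rightarrow> nat) \<Rightarrow> nat \<Rightarrow> nat" where "start_row I e = I (3 + 2 * e)"
definition start_col :: "(nat \<Rightarrow> nat) \<Rightarrow> nat \<Rightarrow> nat" where "start_col I e = I (4 + 2 * e)"
definition goal_row :: "(nat \<Rightarrow> nat) \<Rightarrow> nat \<Rightarrow> nat" where "goal_row I e = I (3 + 2 * I 2 + 2 * e)"
definition goal_col :: "(nat \<Rightarrow> nat) \<Rightarrow> nat \<Rightarrow> nat" where "goal_col I e = I (4 + 2 * I 2 + 2 * e)"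

definition alg_time :: "(nat \<Rightarrow> nat) \<Rightarrow> nat" where
  "alg_time I = plan_time (I 0) (I 1) (I 2) (start_row I) (start_col I) (goal_row I) (goal_col I)"

definition alg_plan :: "(nat \<Rightarrow> nat) \<Rightarrow> (nat \<Rightarrow> nat) \<Rightarrow> nat \<Rightarrow> nat \<Rightarrow> nat \<times> nat" where
  "alg_plan I Y = plan (I 0) (I 1) (I 2) (start_row I) (start_col I) (goal_row I) (goal_col I) Y"

definition alg_length :: "(nat \<Rightarrow> nat) \<Rightarrow> nat" where
  "alg_length I = 1 + 2 * (alg_time I + 1) * I 2"

text \<open>A crude common bound for the entries of the colouring state, twice its width, the
  coordinates, the makespan and the output length.\<close>

definition alg_limit :: "(nat \<Rightarrow> nat) \<Rightarrow> nat" where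
  "alg_limit I = alg_time I + alg_length I + 10 * (I 0 + I 1 + I 2 + 1)"

definition alg_rounds :: "(nat \<Rightarrow> nat) \<Rightarrow> nat" where "alg_rounds I = I 2 * (I 2 + 1)"
definition alg_width :: "(nat \<Rightarrow> nat) \<Rightarrow> nat" where "alg_width I = I 2 + 3"

definition alg_step :: "(nat \<Rightarrow> nat) \<Rightarrow> nat \<Rightarrow> (nat \<Rightarrow> nat) \<Rightarrow> nat \<Rightarrow> nat" where
  "alg_step I t Y k = koenig_step (I 2) (I 1)
     (strip (I 0) (I 1) (I 2) (start_row I) (start_col I))
     (strip (I 0) (I 1) (I 2) (goal_row I) (goal_col I)) t Y k"

text \<open>The memory image of the output: its length, the makespan, and the coordinates.\<close>
definition alg_out :: "(nat \<Rightarrow> nat) \<Rightarrow> (nat \<Rightarrow> nat) \<Rightarrow> nat \<Rightarrow> nat" where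
  "alg_out I Y j =
     (if j = 0 then alg_length I else if j = 1 then alg_time I
      else if even j then fst (alg_plan I Y ((j - 2) div 2 div I 2) ((j - 2) div 2 mod I 2))
      else snd (alg_plan I Y ((j - 2) div 2 div I 2) ((j - 2) div 2 mod I 2)))"

lemma CE_at: "CF d I \<Longrightarrow> CE d (\<lambda>e h. I e h c)"
  by (rule CFD[OF _ order_refl CE_const])

lemma computable_start:
  assumes I: "CF d I"
  shows "computable_placement d (\<lambda>e h. I e h 0) (\<lambda>e h. I e h 1) (\<lambda>e h. I e h 2)
    (\<lambda>e h. start_row (I e h)) (\<lambda>e h. start_col (I e h))"
proof
  show "CF d (\<lambda>e h. start_row (I e h))" unfolding start_row_def
    by (rule CFI, rule CFD[OF I], assumption, intro CE_add CE_mult CE_const)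
  show "CF d (\<lambda>e h. start_col (I e h))" unfolding start_col_def
    by (rule CFI, rule CFD[OF I], assumption, intro CE_add CE_mult CE_const)
qed (rule CE_at[OF I])+

lemma computable_goal:
  assumes I: "CF d I"
  shows "computable_placement d (\<lambda>e h. I e h 0) (\<lambda>e h. I e h 1) (\<lambda>e h. I e h 2)
    (\<lambda>e h. goal_row (I e h)) (\<lambda>e h. goal_col (I e h))"
proof
  show "CF d (\<lambda>e h. goal_row (I e h))" unfolding goal_row_def
    by (rule CFI, rule CFD[OF I], assumption, intro CE_add CE_mult CE_const CE_lift[OF CE_at[OF I]])
  show "CF d (\<lambda>e h. goal_col (I e h))" unfolding goal_col_def
    by (rule CFI, rule CFD[OF I], assumption, intro CE_add CE_mult CE_const CE_lift[OF CE_at[OF I]])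
qed (rule CE_at[OF I])+

lemma CE_alg_time: "CF d I \<Longrightarrow> CE d (\<lambda>e h. alg_time (I e h))"
  unfolding alg_time_def by (rule CE_plan_time[OF computable_start computable_goal order_refl])

lemma CE2_alg_plan:
  assumes "CF d I" "CF d Y" "CE d t" "CE d x"
  shows "CE2 d (\<lambda>e h. alg_plan (I e h) (Y e h) (t e h) (x e h))"
  unfolding alg_plan_def
  by (rule CE2_plan[OF computable_start[OF assms(1)] computable_goal[OF assms(1)] order_refl assms(2-4)])

lemma CE_alg_length: "CF d I \<Longrightarrow> CE d (\<lambda>e h. alg_length (I e h))"
  unfolding alg_length_def by (intro CE_add CE_mult CE_const CE_alg_time CE_at)

interpretation alg: vector_iteration alg_limit alg_rounds alg_width alg_step alg_out
proof
  fix d and I :: "(nat \<Rightarrow> nat) \<Rightarrow> (nat \<Rightarrow> nat) \<Rightarrow> nat \<Rightarrow> nat" assume I: "CF d I"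
  show "CE d (\<lambda>e h. alg_limit (I e h))"
    unfolding alg_limit_def by (intro CE_add CE_mult CE_const CE_alg_time CE_alg_length CE_at I)
  show "CE d (\<lambda>e h. alg_rounds (I e h))"
    unfolding alg_rounds_def by (intro CE_add CE_mult CE_const CE_at I)
  show "CE d (\<lambda>e h. alg_width (I e h))"
    unfolding alg_width_def by (intro CE_add CE_const CE_at I)
  fix Y :: "(nat \<Rightarrow> nat) \<Rightarrow> (nat \<Rightarrow> nat) \<Rightarrow> nat \<Rightarrow> nat" and k :: "(nat \<Rightarrow> nat) \<Rightarrow> (nat \<Rightarrow> nat) \<Rightarrow> nat"
  assume Y: "CF d Y" and k: "CE d k"
  show "CE d (\<lambda>e h. alg_step (I e h) (t e h) (Y e h) (k e h))" if t: "CE d t" for t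
    unfolding alg_step_def
  proof (rule CE_koenig_step[OF CE_at[OF I] CE_at[OF I] _ _ t Y k])
    show "CF d (\<lambda>e h. strip (I e h 0) (I e h 1) (I e h 2) (start_row (I e h)) (start_col (I e h)))"
      by (rule CFI, rule computable_placement.CE_strip[OF computable_start[OF I]])
    show "CF d (\<lambda>e h. strip (I e h 0) (I e h 1) (I e h 2) (goal_row (I e h)) (goal_col (I e h)))"
      by (rule CFI, rule computable_placement.CE_strip[OF computable_goal[OF I]])
  qed
  have p: "CE2 d (\<lambda>e h. alg_plan (I e h) (Y e h) ((k e h - 2) div 2 div I e h 2) ((k e h - 2) div 2 mod I e h 2))"
    by (intro CE2_alg_plan I Y CE_div CE_mod CE_sub CE_const CE_at k)
  show "CE d (\<lambda>e h. alg_out (I e h) (Y e h) (k e h))"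
    unfolding alg_out_def using p unfolding CE2_def
    by (intro CE_if CP_eq CP_even CE_const CE_alg_length CE_alg_time I k) auto
qed

subsection \<open>Encodings\<close>

lemma length_enc_conf: "length (enc_conf n s) = 2 * n"
  by (induction n) (auto simp: enc_conf_def)

lemma nth_enc_conf:
  "e < n \<Longrightarrow> enc_conf n s ! (2 * e) = fst (s e)" "e < n \<Longrightarrow> enc_conf n s ! (2 * e + 1) = snd (s e)"
proof (induction n)
  case (Suc n)
  have eq: "enc_conf (Suc n) s = enc_conf n s @ [fst (s n), snd (s n)]" by (simp add: enc_conf_def)
  { case 1
    then show ?case using Suc.IH(1) unfolding eq nth_append length_enc_conf by (cases "e = n") auto
  next
    case 2
    then show ?case using Suc.IH(2) unfolding eq nth_append length_enc_conf by (cases "e = n") auto }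
qed auto

definition input :: "nat list \<Rightarrow> nat \<Rightarrow> nat" where
  "input xs = (\<lambda>i. if i < length xs then xs ! i else 0)"

lemma length_enc_instance: "length (enc_instance m1 m2 n s g) = 3 + 4 * n"
  by (simp add: enc_instance_def length_enc_conf)

lemma input_enc:
  fixes m1 m2 n s g
  defines "I \<equiv> input (enc_instance m1 m2 n s g)"
  shows "I 0 = m1" "I 1 = m2" "I 2 = n"
    and "e < n \<Longrightarrow> start_row I e = fst (s e)" "e < n \<Longrightarrow> start_col I e = snd (s e)"
    and "e < n \<Longrightarrow> goal_row I e = fst (g e)" "e < n \<Longrightarrow> goal_col I e = snd (g e)"
proof -
  let ?xs = "enc_instance m1 m2 n s g"
  have s: "?xs ! (3 + i) = enc_conf n s ! i" if "i < 2 * n" for i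
    using that by (simp add: enc_instance_def nth_append length_enc_conf)
  have g: "?xs ! (3 + 2 * n + i) = enc_conf n g ! i" if "i < 2 * n" for i
    using that by (simp add: enc_instance_def nth_append length_enc_conf)
  have I: "I i = ?xs ! i" if "i < 3 + 4 * n" for i
    using that by (simp add: I_def input_def length_enc_instance)
  show "I 0 = m1" "I 1 = m2" and n: "I 2 = n"
    by (simp_all add: I enc_instance_def)
  assume e: "e < n"
  show "start_row I e = fst (s e)"
    using e I[of "3 + 2 * e"] s[of "2 * e"] nth_enc_conf(1)[OF e, of s] by (simp add: start_row_def)
  show "start_col I e = snd (s e)"
    using e I[of "4 + 2 * e"] s[of "2 * e + 1"] nth_enc_conf(2)[OF e, of s] by (simp add: start_col_def)
  show "goal_row I e = fst (g e)"
    using e I[of "3 + 2 * n + 2 * e"] g[of "2 * e"] nth_enc_conf(1)[OF e, of g]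
    by (simp add: goal_row_def n)
  show "goal_col I e = snd (g e)"
    using e I[of "4 + 2 * n + 2 * e"] g[of "2 * e + 1"] nth_enc_conf(2)[OF e, of g]
    by (simp add: goal_col_def n add.assoc)
qed

lemma mrpp_feasible_cong_plan:
  assumes "mrpp_feasible m1 m2 n s g T P" "\<And>t i. t \<le> T \<Longrightarrow> i < n \<Longrightarrow> P' t i = P t i"
  shows "mrpp_feasible m1 m2 n s g T P'"
proof -
  have "inj_on (P' t) {0..<n}" if "t \<le> T" for t
  proof -
    have "inj_on (P t) {0..<n}" using assms(1) that by (simp add: mrpp_feasible_def)
    then show ?thesis using assms(2)[OF that] by (simp add: inj_on_def)
  qed
  then show ?thesis using assms unfolding mrpp_feasible_def by simp
qed

section \<open>The algorithm on a single instance\<close>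

locale instance_ctx =
  fixes m1 m2 n :: nat and s g :: "nat \<Rightarrow> nat \<times> nat"
  assumes m: "3 dvd m1" "3 dvd m2" "0 < m2" "m2 \<le> m1" and n: "3 * n \<le> m1 * m2"
    and s: "s \<in> configs m1 m2 n" and g: "g \<in> configs m1 m2 n"
begin

definition I where "I = input (enc_instance m1 m2 n s g)"
definition Y where "Y = yseq (alg_width I) (alg_step I) (alg_rounds I)"

lemmas I_enc = input_enc[where ?m1.0 = m1 and ?m2.0 = m2 and n = n and s = s and g = g, folded I_def]
lemmas I_simps = I_enc I_enc(2)[unfolded One_nat_def]

lemma placementI:
  assumes "c \<in> configs m1 m2 n" "\<And>e. e < n \<Longrightarrow> r e = fst (c e)" "\<And>e. e < n \<Longrightarrow> l e = snd (c e)"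
  shows "placement m1 m2 n r l"
proof
  fix e assume e: "e < n"
  have c: "c e \<in> grid_V m1 m2" using assms(1) e by (auto simp: configs_def)
  then show "r e < m1 \<and> l e < m2"
    using assms(2,3)[OF e] by (auto simp: grid_V_def)
  fix f assume f: "f < n" "r e = r f" "l e = l f"
  have "c e = c f" using assms(2,3)[OF e] assms(2,3)[OF f(1)] f by (simp add: prod_eq_iff)
  then show "e = f" using assms(1) e f(1) by (auto simp: configs_def inj_on_def)
qed (use m n in auto)

lemma S: "placement m1 m2 n (start_row I) (start_col I)"
  by (rule placementI[OF s]) (auto simp: I_simps)

lemma G: "placement m1 m2 n (goal_row I) (goal_col I)"
  by (rule placementI[OF g]) (auto simp: I_simps)

sublocale edges: bipartite_edges n m2 "strip m1 m2 n (start_row I) (start_col I)"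
    "strip m1 m2 n (goal_row I) (goal_col I)"
  by standard (rule placement.strip_degree[OF S], rule placement.strip_degree[OF G])

lemma alg_step_eq: "alg_step I = koenig_step n m2 (strip m1 m2 n (start_row I) (start_col I))
    (strip m1 m2 n (goal_row I) (goal_col I))"
  by (intro ext) (simp add: alg_step_def I_simps)

lemma Y_eq: "Y = edges.colouring (n * (n + 1))"
  unfolding Y_def alg_step_eq alg_width_def alg_rounds_def I_simps ..

lemma feasible: "mrpp_feasible m1 m2 n s g (alg_time I) (alg_plan I Y)"
proof -
  note pr = edges.colouring_proper[folded Y_eq, unfolded edges.proper_def]
  have "mrpp_feasible m1 m2 n (\<lambda>e. (start_row I e, start_col I e)) (\<lambda>e. (goal_row I e, goal_col I e))
    (alg_time I) (alg_plan I Y)"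
    unfolding alg_time_def alg_plan_def I_simps
    by (rule plan_feasible[OF S G]) (use pr in blast)+
  then show ?thesis by (rule mrpp_feasible_cong) (simp_all add: I_simps)
qed

definition out where "out = map (\<lambda>i. alg_out I Y (Suc i)) [0..<alg_out I Y 0]"

lemma length_out: "length out = 1 + 2 * (alg_time I + 1) * n"
  by (simp add: out_def alg_out_def alg_length_def I_simps)

lemma makespan_out: "dec_makespan out = alg_time I"
proof -
  have "0 < alg_out I Y 0" by (simp add: alg_out_def alg_length_def)
  then have "out ! 0 = alg_out I Y 1" unfolding out_def by simp
  then show ?thesis by (simp add: dec_makespan_def alg_out_def)
qed

lemma alg_out_coord:
  assumes "i < n"
  shows "alg_out I Y (2 + 2 * (t * n + i)) = fst (alg_plan I Y t i)"
    "alg_out I Y (3 + 2 * (t * n + i)) = snd (alg_plan I Y t i)"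
proof -
  have 1: "(t * n + i) div n = t" "(t * n + i) mod n = i" using assms by simp_all
  have 2: "(2 + 2 * (t * n + i) - 2) div 2 = t * n + i" "(3 + 2 * (t * n + i) - 2) div 2 = t * n + i"
    by simp_all
  have 3: "2 + 2 * (t * n + i) \<noteq> 0" "2 + 2 * (t * n + i) \<noteq> 1" "even (2 + 2 * (t * n + i))"
    "3 + 2 * (t * n + i) \<noteq> 0" "3 + 2 * (t * n + i) \<noteq> 1" "odd (3 + 2 * (t * n + i))" by simp_all
  show "alg_out I Y (2 + 2 * (t * n + i)) = fst (alg_plan I Y t i)"
    "alg_out I Y (3 + 2 * (t * n + i)) = snd (alg_plan I Y t i)"
    unfolding alg_out_def 2 I_simps 1 using 3 by (simp_all only: if_False if_True simp_thms)
qed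

lemma paths_out:
  assumes "t \<le> alg_time I" "i < n"
  shows "dec_paths n out t i = alg_plan I Y t i"
proof -
  have "t * n + i < (alg_time I + 1) * n"
  proof -
    have "t * n + i < (t + 1) * n" using assms(2) by simp
    also have "\<dots> \<le> (alg_time I + 1) * n" using assms(1) by (intro mult_right_mono) auto
    finally show ?thesis .
  qed
  then have l: "2 + 2 * (t * n + i) < alg_out I Y 0"
    by (simp add: alg_out_def alg_length_def I_simps)
  have "out ! (1 + 2 * (t * n + i)) = alg_out I Y (2 + 2 * (t * n + i))"
    "out ! (2 + 2 * (t * n + i)) = alg_out I Y (3 + 2 * (t * n + i))"
    using l unfolding out_def by (simp_all add: numeral_3_eq_3)
  then show ?thesis unfolding dec_paths_def alg_out_coord[OF assms(2)] by simp
qed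

lemma output_feasible_out: "output_feasible m1 m2 n s g out"
  unfolding output_feasible_def makespan_out
proof (intro conjI)
  show "out \<noteq> []" using length_out by auto
  show "length out = 1 + 2 * (alg_time I + 1) * n" by (rule length_out)
  show "mrpp_feasible m1 m2 n s g (alg_time I) (dec_paths n out)"
    by (rule mrpp_feasible_cong_plan[OF feasible paths_out])
qed

lemma limits:
  "2 * alg_width I \<le> alg_limit I"
  "\<forall>t<alg_rounds I. \<forall>k<alg_width I. alg_step I t (yseq (alg_width I) (alg_step I) t) k \<le> alg_limit I"
  "\<forall>k\<le>alg_out I Y 0. alg_out I Y k \<le> alg_limit I"
proof -
  show "2 * alg_width I \<le> alg_limit I" by (simp add: alg_width_def alg_limit_def)
  show "\<forall>t<alg_rounds I. \<forall>k<alg_width I. alg_step I t (yseq (alg_width I) (alg_step I) t) k \<le> alg_limit I"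
  proof (intro allI impI)
    fix t k assume t: "t < alg_rounds I"
    have "alg_step I t (yseq (alg_width I) (alg_step I) t) k \<le> 2 * m2 + n + 1"
      unfolding alg_step_eq alg_width_def I_simps
      using t unfolding alg_rounds_def I_simps by (intro koenig_step_le yseq_le) auto
    then show "alg_step I t (yseq (alg_width I) (alg_step I) t) k \<le> alg_limit I"
      by (simp add: alg_limit_def I_simps)
  qed
  show "\<forall>k\<le>alg_out I Y 0. alg_out I Y k \<le> alg_limit I"
  proof (intro allI impI)
    fix k assume k: "k \<le> alg_out I Y 0"
    consider "k = 0" | "k = 1" | "2 \<le> k" by linarith
    then show "alg_out I Y k \<le> alg_limit I"
    proof cases
      case 3
      define q where "q = (k - 2) div 2"
      have "k \<le> 1 + 2 * ((alg_time I + 1) * n)" using k by (simp add: alg_out_def alg_length_def I_simps)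
      then have q: "q < (alg_time I + 1) * n" using 3 unfolding q_def by linarith
      then have n0: "0 < n" by (cases n) auto
      then have i: "q mod n < n" by simp
      have t: "q div n \<le> alg_time I"
        using q n0 by (simp add: less_Suc_eq_le[symmetric] less_mult_imp_div_less)
      have qe: "q = q div n * n + q mod n" by simp
      have "k = 2 + 2 * q \<or> k = 3 + 2 * q" using 3 unfolding q_def by linarith
      then have "alg_out I Y k = fst (alg_plan I Y (q div n) (q mod n)) \<or>
          alg_out I Y k = snd (alg_plan I Y (q div n) (q mod n))"
        using alg_out_coord[OF i, of "q div n"] unfolding qe[symmetric] by metis
      moreover have "alg_plan I Y (q div n) (q mod n) \<in> grid_V m1 m2"
        using feasible t i unfolding mrpp_feasible_def by blast
      ultimately have "alg_out I Y k \<le> m1 + m2" by (auto simp: grid_V_def)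
      then show ?thesis by (simp add: alg_limit_def I_simps)
    qed (simp_all add: alg_out_def alg_limit_def)
  qed
qed

lemma input_le:
  "x \<in> set (enc_instance m1 m2 n s g) \<Longrightarrow> x \<le> 3 + 4 * n + m1 + m2"
proof -
  have "fst (c i) \<le> m1 \<and> snd (c i) \<le> m2" if "c \<in> configs m1 m2 n" "i < n" for c i
  proof -
    have "c i \<in> grid_V m1 m2" using that by (auto simp: configs_def)
    then show ?thesis by (auto simp: grid_V_def)
  qed
  note * = this[OF s] this[OF g]
  assume "x \<in> set (enc_instance m1 m2 n s g)"
  then show ?thesis using * unfolding enc_instance_def enc_conf_def by (auto simp: trans_le_add1 trans_le_add2)
qed

lemma even_placementI:
  assumes P: "placement m1 m2 n r l" and c: "\<And>e. e < n \<Longrightarrow> r e = fst (c e)" "\<And>e. e < n \<Longrightarrow> l e = snd (c e)"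
    and even: "even_set m1 m2 n d (c ` {0..<n})"
  shows "even_placement m1 m2 n r l d"
proof -
  interpret placement m1 m2 n r l by (rule P)
  let ?S = "c ` {0..<n}"
  have cnt: "cnt (OCC j) b - cnt (OCC j) a = card (?S \<inter> rect j a b)" if "a \<le> b" for j a b
  proof -
    have "cnt (OCC j) b - cnt (OCC j) a = card {i. i < b \<and> a \<le> i \<and> OCC j i}"
      using cnt_from[OF that, of "OCC j"] by (simp add: cnt_card)
    also have "\<dots> = card ((\<lambda>i. (i, j)) ` {i. i < b \<and> a \<le> i \<and> OCC j i})"
      by (rule card_image[symmetric]) (auto simp: inj_on_def)
    also have "(\<lambda>i. (i, j)) ` {i. i < b \<and> a \<le> i \<and> OCC j i} = ?S \<inter> rect j a b"
    proof (intro set_eqI iffI)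
      fix z assume "z \<in> (\<lambda>i. (i, j)) ` {i. i < b \<and> a \<le> i \<and> OCC j i}"
      then obtain e where e: "e < n" "z = (r e, j)" "r e < b" "a \<le> r e" "l e = j" by (auto simp: occ_def)
      then have "z = c e" using c[of e] by (simp add: prod_eq_iff)
      then have "z \<in> ?S" using e(1) by simp
      moreover have "z \<in> rect j a b" using e by (simp add: rect_def)
      ultimately show "z \<in> ?S \<inter> rect j a b" by simp
    next
      fix z assume z: "z \<in> ?S \<inter> rect j a b"
      then obtain e where "e < n" "z = c e" by auto
      moreover have "a \<le> fst z" "fst z < b" "snd z = j"
        using z by (auto simp: rect_def mem_Times_iff)
      ultimately have e: "e < n" "z = c e" "a \<le> fst (c e)" "fst (c e) < b" "snd (c e) = j" by auto
      then have "OCC j (fst z)" "z = (fst z, j)" using c[of e] by (auto simp: occ_def prod_eq_iff)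
      then show "z \<in> (\<lambda>i. (i, j)) ` {i. i < b \<and> a \<le> i \<and> OCC j i}"
        using e by (intro image_eqI[of _ _ "fst z"]) simp_all
    qed
    finally show ?thesis .
  qed
  have mm: "0 < real m1" "0 < real m2" using m by auto
  \<comment> \<open>The bound on the number of robots becomes the density 1/3 on which the packing
    estimates rest.\<close>
  have rho: "real n / real (m1 * m2) \<le> 1 / 3"
  proof -
    have "3 * real n \<le> real (m1 * m2)" using n by (metis of_nat_le_iff of_nat_mult of_nat_numeral)
    then show ?thesis using mm by (simp add: divide_le_eq)
  qed
  have ev: "real (card (?S \<inter> rect j a b)) \<le> real n / real (m1 * m2) * real (b - a) + real d"
    "real n / real (m1 * m2) * real (b - a) - real d \<le> real (card (?S \<inter> rect j a b))"
    if "j < m2" "a \<le> m1" "b \<le> m1" for j a b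
    using even that unfolding even_set_def by (auto simp: rect_def)
  have col: "real (CNT j) \<le> real n / real m2 + real d" "real n / real m2 - real d \<le> real (CNT j)"
    if "j < m2" for j
  proof -
    have 1: "CNT j = card (?S \<inter> rect j 0 m1)" using cnt[of 0 m1 j] by (simp add: colcnt_def)
    have 2: "real n / real (m1 * m2) * real (m1 - 0) = real n / real m2" using mm by (simp add: field_simps)
    show "real (CNT j) \<le> real n / real m2 + real d" "real n / real m2 - real d \<le> real (CNT j)"
      using ev[OF that, of 0 m1] unfolding 1 2 by simp_all
  qed
  show ?thesis
  proof
    show "m2 \<le> m1" by (rule m(4))
  next
    fix j a b assume j: "j < m2" and ab: "a \<le> b" "b \<le> m1"
    have "real n / real (m1 * m2) * real (b - a) \<le> 1 / 3 * real (b - a)"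
      by (rule mult_right_mono[OF rho]) simp
    then have "3 * real (card (?S \<inter> rect j a b)) \<le> real (b - a) + 3 * real d"
      using ev(1)[OF j _ ab(2), of a] ab by linarith
    then show "3 * (cnt (OCC j) b - cnt (OCC j) a) \<le> (b - a) + 3 * d"
      unfolding cnt[OF ab(1)] by linarith
  next
    fix j assume j: "j < m2"
    have "real n \<le> real (m2 * (CNT j + d))"
      using col(2)[OF j] mm by (simp add: field_simps)
    then show "n \<le> m2 * (CNT j + d)" by linarith
    have "real (CNT j * m2) \<le> real (n + d * m2)"
      using col(1)[OF j] mm by (simp add: field_simps)
    then show "CNT j * m2 \<le> n + d * m2" by linarith
  qed
qed

lemma alg_time_le:
  assumes "even_set m1 m2 n d (s ` {0..<n})" "even_set m1 m2 n d (g ` {0..<n})"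
  shows "alg_time I \<le> m1 + 2 * m2 + 36 * d + 31"
proof -
  have "even_placement m1 m2 n (start_row I) (start_col I) d"
    by (rule even_placementI[OF S _ _ assms(1)]) (simp_all add: I_simps)
  moreover have "even_placement m1 m2 n (goal_row I) (goal_col I) d"
    by (rule even_placementI[OF G _ _ assms(2)]) (simp_all add: I_simps)
  ultimately show ?thesis
    using even_placement.half_time_le[of m1 m2 n "start_row I" "start_col I" d]
      even_placement.half_time_le[of m1 m2 n "goal_row I" "goal_col I" d]
    unfolding alg_time_def plan_time_def I_simps by linarith
qed

end

section \<open>Random instances\<close>

text \<open>The exponent 3/4 lies strictly between 1/2 and 1: the deviation exceeds
  \<open>sqrt m\<close> by the factor \<open>m powr (1 / 4)\<close>, whose exponential beats the
  polynomial in \<open>tail\<close>, and is still of lower order than \<open>m\<close>.\<close>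

definition slack :: "nat \<Rightarrow> nat" where "slack m = nat \<lceil>real m powr (3 / 4)\<rceil>"

lemma slack_bounds: "real m powr (3 / 4) \<le> real (slack m)" "real (slack m) \<le> real m powr (3 / 4) + 1"
  unfolding slack_def by (simp_all add: of_nat_ceiling)

lemma tail_slack: "((\<lambda>m. tail m (slack m)) \<longlongrightarrow> 0) at_top"
proof (rule tendsto_sandwich)
  show "\<forall>\<^sub>F m in at_top. 0 \<le> tail m (slack m)" by (simp add: tail_def)
  show "\<forall>\<^sub>F m in at_top. tail m (slack m) \<le> 2 * real m * (real m + 1)\<^sup>2 * exp (2 - real m powr (1 / 4))"
    using eventually_gt_at_top[of 0]
  proof eventually_elim
    case (elim m)
    have "real m powr (1 / 4) = real m powr (3 / 4) / sqrt (real m)"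
      using elim by (simp add: powr_half_sqrt[symmetric] powr_diff[symmetric])
    also have "\<dots> \<le> real (slack m) / sqrt (real m)"
      using slack_bounds(1) by (simp add: divide_right_mono)
    finally show ?case unfolding tail_def by (intro mult_left_mono) auto
  qed
  show "((\<lambda>m. 2 * real m * (real m + 1)\<^sup>2 * exp (2 - real m powr (1 / 4))) \<longlongrightarrow> 0) at_top"
    by real_asymp
qed simp

lemma card_even_configs:
  assumes m: "0 < m2" "m2 \<le> m1" and n: "n \<le> m1 * m2" and d: "d \<le> m1"
  shows "(1 - tail m1 d) * real (card (configs m1 m2 n))
      \<le> real (card {s \<in> configs m1 m2 n. even_set m1 m2 n d (s ` {0..<n})})"
    and "0 < card (configs m1 m2 n)"
proof -
  let ?V = "grid_V m1 m2"
  have V: "finite ?V" "card ?V = m1 * m2" by (auto simp: grid_V_def)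
  have C: "card (configs m1 m2 n) = fact n * (m1 * m2 choose n)"
    using card_configs_image[of m1 m2 n "\<lambda>_. True"] card_subsets[OF V(1), of n] V(2) by simp
  then show "0 < card (configs m1 m2 n)" using n by simp
  let ?G = "{S \<in> subsets ?V n. even_set m1 m2 n d S}"
  let ?B = "{S \<in> subsets ?V n. \<not> even_set m1 m2 n d S}"
  have "card (subsets ?V n) = card ?G + card ?B"
  proof -
    have "card (?G \<union> ?B) = card ?G + card ?B"
      by (rule card_Un_disjoint) (use finite_subsets[OF V(1)] in auto)
    moreover have "?G \<union> ?B = subsets ?V n" by auto
    ultimately show ?thesis by (simp only:)
  qed
  then have "real (m1 * m2 choose n) = real (card ?G) + real (card ?B)"
    using card_subsets[OF V(1), of n] V(2) by simp
  then have "(1 - tail m1 d) * real (m1 * m2 choose n) \<le> real (card ?G)"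
    using card_not_even_set[OF m d n] by (simp add: algebra_simps)
  then have "fact n * ((1 - tail m1 d) * real (m1 * m2 choose n)) \<le> fact n * real (card ?G)"
    by (rule mult_left_mono) simp
  then show "(1 - tail m1 d) * real (card (configs m1 m2 n))
      \<le> real (card {s \<in> configs m1 m2 n. even_set m1 m2 n d (s ` {0..<n})})"
    unfolding card_configs_image[of m1 m2 n "even_set m1 m2 n d"] C by (simp add: mult_ac)
qed

theorem mainTheorem5:
  "\<exists>(prog :: instr list) (c :: nat) (k :: nat) (f :: nat \<Rightarrow> real).
     f \<in> o(\<lambda>m. real m) \<and>
     (\<forall>m1 m2 n s g. 3 dvd m1 \<longrightarrow> 3 dvd m2 \<longrightarrow> 0 < m2 \<longrightarrow> m2 \<le> m1 \<longrightarrow>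
        3 * n \<le> m1 * m2 \<longrightarrow> s \<in> configs m1 m2 n \<longrightarrow> g \<in> configs m1 m2 n \<longrightarrow>
        (\<exists>t out. t \<le> c * (m1 * m2) ^ k + c \<and>
                 ram_computes_within prog (enc_instance m1 m2 n s g) t out \<and>
                 output_feasible m1 m2 n s g out)) \<and>
     (\<forall>\<epsilon>>0. \<exists>M. \<forall>m1 m2 n. M \<le> m1 \<longrightarrow> 3 dvd m1 \<longrightarrow> 3 dvd m2 \<longrightarrow> 0 < m2 \<longrightarrow> m2 \<le> m1 \<longrightarrow>
        3 * n \<le> m1 * m2 \<longrightarrow>
        real (card {(s, g). s \<in> configs m1 m2 n \<and> g \<in> configs m1 m2 n \<and>
                  (\<exists>t out. ram_computes_within prog (enc_instance m1 m2 n s g) t out \<and>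
                           real (dec_makespan out) \<le> real m1 + 2 * real m2 + f m1)})
          / real (card (configs m1 m2 n \<times> configs m1 m2 n)) \<ge> 1 - \<epsilon>)"
proof -
  obtain prog P where P: "pb P" and prog: "\<And>xs B. length xs = 3 + 4 * xs ! 2 \<Longrightarrow> length xs \<le> B \<Longrightarrow> (\<forall>x\<in>set xs. x \<le> B) \<Longrightarrow>
     (let I = input xs; Y = yseq (alg_width I) (alg_step I) (alg_rounds I) in
       2 * alg_width I \<le> alg_limit I \<longrightarrow>
       (\<forall>t<alg_rounds I. \<forall>k<alg_width I. alg_step I t (yseq (alg_width I) (alg_step I) t) k \<le> alg_limit I) \<longrightarrow>
       (\<forall>k\<le>alg_out I Y 0. alg_out I Y k \<le> alg_limit I) \<longrightarrow>
       (\<exists>t\<le>P B. ram_computes_within prog xs t (map (\<lambda>i. alg_out I Y (Suc i)) [0..<alg_out I Y 0])))"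
    using alg.program_exists unfolding input_def by blast
  have run: "\<exists>t\<le>P (3 + 4 * n + m1 + m2). ram_computes_within prog (enc_instance m1 m2 n s g) t
      (instance_ctx.out m1 m2 n s g)" if "instance_ctx m1 m2 n s g" for m1 m2 n s g
  proof -
    interpret instance_ctx m1 m2 n s g by (rule that)
    let ?xs = "enc_instance m1 m2 n s g"
    have "?xs ! 2 = n" by (simp add: enc_instance_def)
    then have "length ?xs = 3 + 4 * ?xs ! 2" "length ?xs \<le> 3 + 4 * n + m1 + m2"
      by (simp_all add: length_enc_instance)
    from prog[OF this, folded I_def] input_le show ?thesis
      unfolding Let_def Y_def[symmetric] out_def[symmetric] using limits by blast
  qed
  obtain k where k: "\<And>B. P B \<le> (B + 2) ^ k" using P unfolding pb_def by blast
  define c :: nat where "c = 11 ^ k"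
  \<comment> \<open>Two halves of at most \<open>m2 + 18 * d + 15\<close> steps and a row phase of
    \<open>m1 + 1\<close> steps add up to the error \<open>36 * d + 31\<close>; the summand 1 comes
    from rounding up in \<open>slack\<close>.\<close>
  define f where "f = (\<lambda>m. 36 * (real m powr (3 / 4) + 1) + 31)"
  show ?thesis
  proof (rule exI[of _ prog], rule exI[of _ c], rule exI[of _ k], rule exI[of _ f],
      intro conjI allI impI)
    show "f \<in> o(\<lambda>m. real m)" unfolding f_def by real_asymp
  next
    fix m1 m2 n s g
    assume a: "3 dvd m1" "3 dvd m2" "0 < m2" "m2 \<le> m1" "3 * n \<le> m1 * m2"
      "s \<in> configs m1 m2 n" "g \<in> configs m1 m2 n"
    interpret instance_ctx m1 m2 n s g by standard (fact a)+
    obtain t where t: "t \<le> P (3 + 4 * n + m1 + m2)"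
      "ram_computes_within prog (enc_instance m1 m2 n s g) t out"
      using run[OF instance_ctx_axioms] by blast
    have "m1 \<le> m1 * m2" "m2 \<le> m1 * m2" "1 \<le> m1 * m2" using a(3,4) by auto
    \<comment> \<open>The factor is 5 + 4 + 2: each of 1, \<open>n\<close>, \<open>m1\<close> and
      \<open>m2\<close> is at most \<open>m1 * m2\<close>.\<close>
    then have "3 + 4 * n + m1 + m2 + 2 \<le> 11 * (m1 * m2)" using a(5) by linarith
    then have "(3 + 4 * n + m1 + m2 + 2) ^ k \<le> (11 * (m1 * m2)) ^ k" by (rule power_mono) simp
    then have "t \<le> c * (m1 * m2) ^ k + c"
      using t(1) k[of "3 + 4 * n + m1 + m2"] by (simp add: c_def power_mult_distrib)
    then show "\<exists>t out. t \<le> c * (m1 * m2) ^ k + c \<and>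
        ram_computes_within prog (enc_instance m1 m2 n s g) t out \<and> output_feasible m1 m2 n s g out"
      using t(2) output_feasible_out by blast
  next
    fix \<epsilon> :: real assume e: "0 < \<epsilon>"
    have "\<forall>\<^sub>F m in at_top. tail m (slack m) < min 1 (\<epsilon> / 2)"
      using e by (intro order_tendstoD(2)[OF tail_slack]) auto
    moreover have "\<forall>\<^sub>F m :: nat in at_top. real m powr (3 / 4) + 1 \<le> real m" by real_asymp
    ultimately have "\<forall>\<^sub>F m in at_top. tail m (slack m) < min 1 (\<epsilon> / 2) \<and> slack m \<le> m"
    proof eventually_elim
      case (elim m)
      then show ?case using slack_bounds(2)[of m] by linarith
    qed
    then obtain M where M: "\<And>m. M \<le> m \<Longrightarrow> tail m (slack m) < min 1 (\<epsilon> / 2) \<and> slack m \<le> m"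
      unfolding eventually_at_top_linorder by blast
    show "\<exists>M. \<forall>m1 m2 n. M \<le> m1 \<longrightarrow> 3 dvd m1 \<longrightarrow> 3 dvd m2 \<longrightarrow> 0 < m2 \<longrightarrow> m2 \<le> m1 \<longrightarrow>
        3 * n \<le> m1 * m2 \<longrightarrow>
        real (card {(s, g). s \<in> configs m1 m2 n \<and> g \<in> configs m1 m2 n \<and>
                  (\<exists>t out. ram_computes_within prog (enc_instance m1 m2 n s g) t out \<and>
                           real (dec_makespan out) \<le> real m1 + 2 * real m2 + f m1)})
          / real (card (configs m1 m2 n \<times> configs m1 m2 n)) \<ge> 1 - \<epsilon>"
    proof (rule exI[of _ M], intro allI impI)
      fix m1 m2 n :: nat
      assume a: "M \<le> m1" "3 dvd m1" "3 dvd m2" "0 < m2" "m2 \<le> m1" "3 * n \<le> m1 * m2"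
      let ?C = "configs m1 m2 n" and ?d = "slack m1"
      let ?E = "{s \<in> ?C. even_set m1 m2 n ?d (s ` {0..<n})}"
      let ?R = "{(s, g). s \<in> ?C \<and> g \<in> ?C \<and>
                  (\<exists>t out. ram_computes_within prog (enc_instance m1 m2 n s g) t out \<and>
                           real (dec_makespan out) \<le> real m1 + 2 * real m2 + f m1)}"
      define \<tau> where "\<tau> = tail m1 ?d"
      have tau: "\<tau> < 1" "\<tau> < \<epsilon> / 2" and d: "?d \<le> m1" using M[OF a(1)] by (auto simp: \<tau>_def)
      have n: "n \<le> m1 * m2" using a(6) by linarith
      note E = card_even_configs[OF a(4,5) n d, folded \<tau>_def]
      \<comment> \<open>Start and goal are independent, so it suffices that both are even; this
        costs at most twice the failure probability, hence the threshold
        \<open>\<epsilon> / 2\<close> for \<open>tail\<close>.\<close>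
      have sub: "?E \<times> ?E \<subseteq> ?R"
      proof
        fix z assume "z \<in> ?E \<times> ?E"
        then obtain s g where z: "z = (s, g)" and zs: "s \<in> ?C" "even_set m1 m2 n ?d (s ` {0..<n})"
          and zg: "g \<in> ?C" "even_set m1 m2 n ?d (g ` {0..<n})" by blast
        interpret instance_ctx m1 m2 n s g by standard (fact a zs zg)+
        obtain t where t: "ram_computes_within prog (enc_instance m1 m2 n s g) t out"
          using run[OF instance_ctx_axioms] by blast
        have "alg_time I \<le> m1 + 2 * m2 + 36 * ?d + 31" by (rule alg_time_le[OF zs(2) zg(2)])
        then have "real (alg_time I) \<le> real (m1 + 2 * m2 + 36 * ?d + 31)" by (rule of_nat_mono)
        then have "real (dec_makespan out) \<le> real m1 + 2 * real m2 + f m1"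
          using slack_bounds(2)[of m1] by (simp add: makespan_out f_def)
        then show "z \<in> ?R" using z zs(1) zg(1) t by blast
      qed
      have fin: "finite ?R"
        by (rule finite_subset[of _ "?C \<times> ?C"]) (auto intro: finite_configs)
      have "(1 - \<epsilon>) * (real (card ?C) * real (card ?C)) \<le> (1 - \<tau>)\<^sup>2 * (real (card ?C) * real (card ?C))"
      proof (rule mult_right_mono)
        have "(1 - \<tau>)\<^sup>2 = 1 - 2 * \<tau> + \<tau>\<^sup>2" by (simp add: power2_eq_square algebra_simps)
        then show "1 - \<epsilon> \<le> (1 - \<tau>)\<^sup>2" using tau(2) zero_le_power2[of \<tau>] by linarith
      qed simp
      also have "\<dots> = ((1 - \<tau>) * real (card ?C)) * ((1 - \<tau>) * real (card ?C))"
        by (simp add: power2_eq_square mult_ac)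
      also have "\<dots> \<le> real (card ?E) * real (card ?E)"
        using E(1) tau by (intro mult_mono) auto
      also have "\<dots> = real (card (?E \<times> ?E))" by (simp add: card_cartesian_product)
      also have "\<dots> \<le> real (card ?R)" using card_mono[OF fin sub] by simp
      finally have "(1 - \<epsilon>) * (real (card ?C) * real (card ?C)) \<le> real (card ?R)" .
      then show "1 - \<epsilon> \<le> real (card ?R) / real (card (?C \<times> ?C))"
        using E(2) by (simp add: card_cartesian_product pos_le_divide_eq)
    qed
  qed
qed

end
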